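(* Let $n\to+\infty$ and $p=p_n\to+\infty$, and for each $n$ let $X^{(1)},\dots,X^{(n)}$ be i.i.d. $\mathcal{N}(\mu,\Sigma)$ in $\mathbb{R}^p$, where $\mu\in\mathbb{R}^p$ and the symmetric positive definite matrix $\Sigma=(\sigma_{ij})$ may depend on $n$. Let $B^*=B(\Sigma)$ be the finest block decomposition of $\Sigma$. Assume: (1) $p/n\to y\in\,]0,1[$; (2) there exist $\lambda_{\inf}>0$ and $\lambda_{\sup}<+\infty$ such that for all $n$ the eigenvalues of $\Sigma$ lie in $[\lambda_{\inf},\lambda_{\sup}]$; (3) there exists $m\in\mathbb{N}^*$ such that for all $n$, $|A|\le m$ for every $A\in B^*$; (4) there exists $a>0$ such that for all $n$ and all partitions $B<B^*$, $\|\Sigma_B-\Sigma\|_{\max}\ge a\,n^{-1/4}$. Fix $\delta\in\,]1/2,1[$ and let $\kappa=\frac{1}{pn^\delta}$. Then $$\mathbb{P}\left(\widehat{B}_{tot}=B^*\right)\longrightarrow 1,$$ where $\widehat{B}_{tot}$ is the minimizer over all partitions $B$ of $\{1,\dots,p\}$ of the penalized criterion $\Psi(B)$ (with penalization coefficient $\kappa$).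
   Context: Partitions: $[1:p]=\{1,\dots,p\}$ and $\mathcal{P}_p$ is the set of partitions of $[1:p]$. For $B,B'\in\mathcal{P}_p$, $B\le B'$ ($B$ is finer than $B'$) if every element of $B'$ is a disjoint union of elements of $B$; $B<B'$ means $B\le B'$ and $B\ne B'$. Write $(i,j)\in B$ if $i,j$ belong to the same element of $B$. For a symmetric matrix $\Gamma=(\gamma_{ij})$, $\Gamma_B$ is the matrix with entries $\gamma_{ij}$ if $(i,j)\in B$ and $0$ otherwise. $B(\Gamma)$ is the unique finest partition $B$ with $\Gamma=\Gamma_B$ (i.e. $\Gamma=\Gamma_B$ and $\Gamma\neq\Gamma_{B'}$ for all $B'<B$). $\|M\|_{\max}=\max_{i,j}|m_{ij}|$. Empirical quantities: $\overline{X}=\frac1n\sum_{l=1}^nX^{(l)}$, $S=\frac1n\sum_{l=1}^n(X^{(l)}-\overline X)(X^{(l)}-\overline X)^T$ (for large $n$, $n>p$ and $S$ is almost surely positive definite). Criterion: for $\Gamma$ symmetric positive definite, $l_\Gamma=\frac1p\left(\log|\Gamma|+\mathrm{Tr}(\Gamma^{-1}S)\right)$, where $|\Gamma|$ is the determinant; $\mathrm{pen}(\Gamma)=\mathrm{pen}(B(\Gamma))=\sum_{k=1}^Kp_k^2$ if $B(\Gamma)=\{B_1,\dots,B_K\}$ with $|B_k|=p_k$; $\Phi(\Gamma)=l_\Gamma+\kappa\,\mathrm{pen}(\Gamma)$; $\Psi(B)=\Phi(S_B)$; $\widehat B_{tot}=\operatorname{argmin}_{B\in\mathcal P_p}\Psi(B)$.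 *)

theory Defs
  imports
    "HOL-Library.Disjoint_Sets"
    "HOL-Probability.Probability"
    "Jordan_Normal_Form.Determinant"
    "Jordan_Normal_Form.Char_Poly"
    "Jordan_Normal_Form.Gauss_Jordan_Elimination"
begin

unbundle no vec_syntax and no inner_syntax

text \<open>Vectors and matrices have run-time dimensions and are indexed from \<open>0\<close>, so the index set
  of a \<open>p\<close>-dimensional vector is \<open>{..<p}\<close>.\<close>

definition finer_than :: "nat \<Rightarrow> nat set set \<Rightarrow> nat set set \<Rightarrow> bool" where
  "finer_than p B B' \<longleftrightarrow> refines {..<p} B B' \<and> B \<noteq> B'"

definition restrict_blocks :: "real mat \<Rightarrow> nat set set \<Rightarrow> real mat" where
  "restrict_blocks \<Gamma> B = mat (dim_row \<Gamma>) (dim_col \<Gamma>)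
     (\<lambda>(i, j). if \<exists>A\<in>B. i \<in> A \<and> j \<in> A then \<Gamma> $$ (i, j) else 0)"

definition is_finest_decomp :: "real mat \<Rightarrow> nat set set \<Rightarrow> bool" where
  "is_finest_decomp \<Gamma> B \<longleftrightarrow>
     partition_on {..<dim_row \<Gamma>} B \<and> \<Gamma> = restrict_blocks \<Gamma> B \<and>
     (\<forall>B'. finer_than (dim_row \<Gamma>) B' B \<longrightarrow> \<Gamma> \<noteq> restrict_blocks \<Gamma> B')"

definition block_decomp :: "real mat \<Rightarrow> nat set set" where
  "block_decomp \<Gamma> = (THE B. is_finest_decomp \<Gamma> B)"

lemma is_finest_decomp_ex1:
  assumes sq: "dim_row \<Gamma> = dim_col \<Gamma>"
  shows "\<exists>!B. is_finest_decomp \<Gamma> B"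
proof -
  define p where "p = dim_row \<Gamma>"
  have dims: "dim_row \<Gamma> = p" "dim_col \<Gamma> = p" using sq by (auto simp: p_def)
  have eq_iff: "\<Gamma> = restrict_blocks \<Gamma> B \<longleftrightarrow>
      (\<forall>i<p. \<forall>j<p. (\<forall>A\<in>B. i \<in> A \<longrightarrow> j \<notin> A) \<longrightarrow> \<Gamma> $$ (i, j) = 0)" for B
    unfolding restrict_blocks_def dims by (subst mat_eq_iff) (simp add: dims, metis)
  define F where "F = {B. partition_on {..<p} B \<and> \<Gamma> = restrict_blocks \<Gamma> B}"
  define Q where "Q = common_refinement F"
  have "{{..<p}} - {{}} \<in> F"
  proof -
    have "partition_on {..<p} ({{..<p}} - {{}})"
      by (auto simp: partition_on_def disjoint_def)
    then show ?thesis unfolding F_def mem_Collect_eq eq_iff by (simp, blast)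
  qed
  then have F_ne: "F \<noteq> {}" by auto
  have F_part: "\<And>B. B \<in> F \<Longrightarrow> partition_on {..<p} B" by (auto simp: F_def)
  have Q_ref: "refines {..<p} Q B" if "B \<in> F" for B
    unfolding Q_def using F_part that by (rule refines_common_refinement)
  have "\<Gamma> = restrict_blocks \<Gamma> Q"
    unfolding eq_iff
  proof (intro allI impI, rule ccontr)
    fix i j assume ij: "i < p" "j < p" and no: "\<forall>A\<in>Q. i \<in> A \<longrightarrow> j \<notin> A" and nz: "\<Gamma> $$ (i, j) \<noteq> 0"
    have "\<exists>A\<in>B. i \<in> A \<and> j \<in> A" if "B \<in> F" for B
      using that ij nz unfolding F_def mem_Collect_eq eq_iff by blast
    then obtain f where f: "\<And>B. B \<in> F \<Longrightarrow> f B \<in> B \<and> i \<in> f B \<and> j \<in> f B" by metis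
    then have mem: "i \<in> \<Inter> (f ` F)" "j \<in> \<Inter> (f ` F)" by auto
    moreover have "\<Inter> (f ` F) \<in> Q"
    proof -
      have "f \<in> (\<Pi> B\<in>F. B)" using f by auto
      moreover have "\<Inter> (f ` F) \<noteq> {}" using mem(1) by blast
      ultimately show ?thesis unfolding Q_def common_refinement by blast
    qed
    ultimately show False using no by blast
  qed
  moreover have "partition_on {..<p} Q"
    unfolding Q_def using F_part F_ne by (rule partition_on_common_refinement)
  ultimately have QF: "Q \<in> F" by (simp add: F_def)
  have "is_finest_decomp \<Gamma> Q"
    unfolding is_finest_decomp_def dims
  proof (intro conjI allI impI notI)
    show "partition_on {..<p} Q" "\<Gamma> = restrict_blocks \<Gamma> Q" using QF by (auto simp: F_def)
    fix B' assume B': "finer_than p B' Q" "\<Gamma> = restrict_blocks \<Gamma> B'"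
    then have "B' \<in> F" by (simp add: F_def finer_than_def refines_def)
    then show False using B'(1) Q_ref refines_asym by (auto simp: finer_than_def)
  qed
  moreover have "B = Q" if B: "is_finest_decomp \<Gamma> B" for B
  proof (rule ccontr)
    assume "B \<noteq> Q"
    moreover have "B \<in> F" using B by (simp add: F_def is_finest_decomp_def dims)
    ultimately have "finer_than p Q B" using Q_ref by (simp add: finer_than_def)
    then show False using B QF by (auto simp: is_finest_decomp_def dims F_def)
  qed
  ultimately show ?thesis by blast
qed

definition max_norm :: "real mat \<Rightarrow> real" where
  "max_norm A = Max (abs ` elements_mat A)"

definition mat_trace :: "real mat \<Rightarrow> real" where
  "mat_trace A = (\<Sum>i<dim_row A. A $$ (i, i))"

text \<open>Only meaningful for invertible arguments.\<close>

definition mat_inv :: "real mat \<Rightarrow> real mat" where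
  "mat_inv A = the (mat_inverse A)"

definition sym_pos_def :: "real mat \<Rightarrow> bool" where
  "sym_pos_def A \<longleftrightarrow> square_mat A \<and> transpose_mat A = A \<and>
     (\<forall>v\<in>carrier_vec (dim_row A). v \<noteq> 0\<^sub>v (dim_row A) \<longrightarrow> scalar_prod v (A *\<^sub>v v) > 0)"

text \<open>Lebesgue measure on the Borel sets of \<open>p\<close>-dimensional vectors, transported from the product
  measure along the coordinate maps.\<close>

definition vec_lborel :: "nat \<Rightarrow> real vec measure" where
  "vec_lborel p =
     distr (\<Pi>\<^sub>M i\<in>{..<p}. lborel)
       (vimage_algebra (carrier_vec p) (\<lambda>v. \<lambda>i\<in>{..<p}. v $ i) (\<Pi>\<^sub>M i\<in>{..<p}. lborel))
       (vec p)"

lemma measurable_vec_of_coords: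
  "vec p \<in> (\<Pi>\<^sub>M i\<in>{..<p}. lborel) \<rightarrow>\<^sub>M
     vimage_algebra (carrier_vec p) (\<lambda>v. \<lambda>i\<in>{..<p}. v $ i) (\<Pi>\<^sub>M i\<in>{..<p}. (lborel :: real measure))"
proof (rule measurable_vimage_algebra2)
  show "(\<lambda>x. \<lambda>i\<in>{..<p}. vec p x $ i) \<in>
      (\<Pi>\<^sub>M i\<in>{..<p}. lborel) \<rightarrow>\<^sub>M (\<Pi>\<^sub>M i\<in>{..<p}. (lborel :: real measure))"
    by (rule measurable_restrict) simp
qed auto

definition mvn_density :: "real vec \<Rightarrow> real mat \<Rightarrow> real vec \<Rightarrow> real" where
  "mvn_density \<mu> \<Sigma> x =
     exp (- (1 / 2) * scalar_prod (x - \<mu>) (mat_inv \<Sigma> *\<^sub>v (x - \<mu>)))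
       / sqrt ((2 * pi) ^ dim_vec \<mu> * det \<Sigma>)"

definition emp_mean :: "nat \<Rightarrow> nat \<Rightarrow> (nat \<Rightarrow> real vec) \<Rightarrow> real vec" where
  "emp_mean p n x = vec p (\<lambda>i. (\<Sum>l=1..n. x l $ i) / real n)"

definition emp_cov :: "nat \<Rightarrow> nat \<Rightarrow> (nat \<Rightarrow> real vec) \<Rightarrow> real mat" where
  "emp_cov p n x = mat p p (\<lambda>(i, j).
     (\<Sum>l=1..n. (x l - emp_mean p n x) $ i * (x l - emp_mean p n x) $ j) / real n)"

definition neg_loglik :: "real mat \<Rightarrow> real mat \<Rightarrow> real" where
  "neg_loglik S \<Gamma> = (ln (det \<Gamma>) + mat_trace (mat_inv \<Gamma> * S)) / real (dim_row \<Gamma>)"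

definition pen :: "real mat \<Rightarrow> real" where
  "pen \<Gamma> = (\<Sum>A\<in>block_decomp \<Gamma>. (real (card A))\<^sup>2)"

definition Phi :: "real \<Rightarrow> real mat \<Rightarrow> real mat \<Rightarrow> real" where
  "Phi \<kappa> S \<Gamma> = neg_loglik S \<Gamma> + \<kappa> * pen \<Gamma>"

definition Psi :: "real \<Rightarrow> real mat \<Rightarrow> nat set set \<Rightarrow> real" where
  "Psi \<kappa> S B = Phi \<kappa> S (restrict_blocks S B)"

text \<open>The set of all minimizers, so that "\<open>B\<close> is the minimizer" reads \<open>B_tot \<kappa> S = {B}\<close>. The criterion
  is only meaningful for positive definite \<open>S\<close>.\<close>

definition B_tot :: "real \<Rightarrow> real mat \<Rightarrow> nat set set set" where
  "B_tot \<kappa> S = {B. is_arg_min (Psi \<kappa> S) (partition_on {..<dim_row S}) B}"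

end

theory Submission
  imports
    Defs
    "HOL-Complex_Analysis.Conformal_Mappings"
    "HOL-Real_Asymp.Real_Asymp"
    "Jordan_Normal_Form.Schur_Decomposition"
begin

text \<open>
  Write \<open>B\<^sup>*\<close> for the true partition and \<open>\<beta> = n\<^sup>-\<^sup>\<delta>\<close>, so that \<open>\<kappa> = \<beta> / p\<close>. When \<open>S\<close> is positive definite and
  has no zero off its diagonal, the inverse of \<open>S\<^sub>B\<close> is again block diagonal, hence
  \<open>Tr (S\<^sub>B\<^sup>-\<^sup>1 S) = p\<close>, and the finest decomposition of \<open>S\<^sub>B\<close> is \<open>B\<close> itself (\<open>Psi_eq\<close>). Up to constants the
  criterion is therefore \<open>F B = ln det S\<^sub>B + \<beta> c(B)\<close>, where \<open>c(B)\<close> counts the ordered pairs \<open>(i, j)\<close> in a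
  common block. Two comparisons show that no \<open>B \<noteq> B\<^sup>*\<close> minimizes \<open>F\<close>; both are deterministic
  (\<open>true_partition_is_unique_minimizer\<close>) once the entries of \<open>S\<close> are within \<open>\<epsilon>\<close> of those of \<open>\<Sigma>\<close>.

  If \<open>B\<close> does not refine \<open>B\<^sup>*\<close>, replace it by the common refinement \<open>C\<close> of \<open>B\<close> and \<open>B\<^sup>*\<close>. The entries that
  are lost estimate zeros of \<open>\<Sigma>\<close>, so each is at most \<open>\<epsilon>\<close>, and
  \<open>ln det S\<^sub>C - ln det S\<^sub>B\<close> is at most a constant times \<open>ln (1 / \<lambda>) \<epsilon>\<^sup>2\<close> per lost pair, where \<open>\<lambda>\<close> is a lower
  bound for the spectrum of \<open>S\<close> (\<open>log_det_cost_of_coarsening\<close>), whereas the penalty falls by \<open>\<beta>\<close> per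
  lost pair. The inverse that enters here is that of \<open>S\<^sub>C\<close>, whose blocks have size at most \<open>m\<close> and whose
  spectrum is thus controlled by \<open>\<epsilon>\<close> and the spectrum of \<open>\<Sigma>\<close>. If \<open>B\<close> strictly refines \<open>B\<^sup>*\<close>, the
  separation hypothesis gives a pair \<open>(i, j)\<close> split by \<open>B\<close> with \<open>\<sigma>\<^sub>i\<^sub>j\<close> of order at least \<open>n\<^sup>-\<^sup>1\<^sup>/\<^sup>4\<close>. Merging
  the blocks of \<open>i\<close> and \<open>j\<close> lowers \<open>ln det\<close> by a constant times \<open>n\<^sup>-\<^sup>1\<^sup>/\<^sup>2\<close>
  (\<open>log_det_gain_of_merging\<close>) and costs at most \<open>m\<^sup>2 \<beta>\<close>, which is smaller because \<open>\<delta> > 1 / 2\<close>.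

  Both log-determinant estimates come from the eigenvalues \<open>x\<^sub>i\<close> of a product of positive definite
  matrices: \<open>ln x \<le> x - 1\<close> everywhere, and \<open>ln x \<ge> (x - 1) - K (x - 1)\<^sup>2\<close> for \<open>x \<ge> \<rho>\<close> with \<open>K\<close> of order
  \<open>ln (1 / \<rho>)\<close> (\<open>log_det_bounds\<close>). The smallest eigenvalue of \<open>S\<close> enters only through
  its logarithm, so a lower bound that is polynomial in \<open>1 / n\<close> suffices.
  This replaces the edge of the spectrum of large sample covariance matrices by a union
  bound (\<open>coercive_S\<close>, \<open>prob_near_hyperplane\<close>): if the entries of \<open>S\<close> are concentrated but \<open>S\<close> has an
  eigenvalue below \<open>N\<^sup>-\<^sup>2\<close>, all \<open>n\<close> observations lie within \<open>3 n\<^sup>2 / N\<close> of a hyperplane from a list of at most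
  \<open>n (3 N)\<^sup>p\<^sup>+\<^sup>1\<close>, and for each of them this event has probability at most \<open>(C n\<^sup>2 / N)\<^sup>n\<close>. Since \<open>p / n\<close> has a limit below \<open>1\<close>, a large power \<open>N\<close> of \<open>n\<close> wins
  (\<open>grid_bound_tendsto\<close>).

  The remaining ingredients are probabilistic. Linear forms of an observation are normal (\<open>mvn_linear_form\<close>):
  tilting the density by an exponential only translates it, which gives the moment generating
  function, and the latter determines the law. Chernoff bounds then give \<open>\<epsilon> = n\<^sup>-\<^sup>d\<^sup>/\<^sup>2\<close> up to a constant for any
  \<open>d < 1\<close>, and \<open>d > \<delta>\<close> is what the first comparison needs. Finally an off-diagonal entry of \<open>S\<close>
  vanishes with probability zero (\<open>prob_S_zero\<close>), and the event in question is measurable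
  (\<open>pred_B_tot\<close>).
\<close>

unbundle no vec_syntax and no inner_syntax and no fps_syntax

section \<open>Log-determinants through complex eigenvalues\<close>

text \<open>Generic in the entries, because traces of complex triangular forms are compared with traces of real
  matrices.\<close>

definition trace :: "'a::comm_monoid_add mat \<Rightarrow> 'a" where
  "trace A = (\<Sum>i<dim_row A. A $$ (i, i))"

lemma mat_trace_eq_trace: "mat_trace A = trace A"
  by (simp add: mat_trace_def trace_def)

lemma times_mat_entry:
  assumes "A \<in> carrier_mat n k" "B \<in> carrier_mat k m" "i < n" "j < m"
  shows "(A * B) $$ (i, j) = (\<Sum>l<k. A $$ (i, l) * B $$ (l, j))"
  using assms by (auto simp: scalar_prod_def atLeast0LessThan intro!: sum.cong)

lemma trace_mult_comm:
  fixes A B :: "'a::comm_semiring_0 mat"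
  assumes A: "A \<in> carrier_mat n m" and B: "B \<in> carrier_mat m n"
  shows "trace (A * B) = trace (B * A)"
proof -
  have "trace (A * B) = (\<Sum>i<n. \<Sum>k<m. A $$ (i, k) * B $$ (k, i))"
    using A B by (auto simp: trace_def times_mat_entry[OF A B] simp del: index_mult_mat(1) intro!: sum.cong)
  also have "\<dots> = (\<Sum>k<m. \<Sum>i<n. B $$ (k, i) * A $$ (i, k))"
    by (subst sum.swap) (simp add: mult.commute)
  also have "\<dots> = trace (B * A)"
    using A B by (auto simp: trace_def times_mat_entry[OF B A] simp del: index_mult_mat(1) intro!: sum.cong)
  finally show ?thesis .
qed

lemma trace_similar:
  fixes A B :: "'a::comm_ring_1 mat"
  assumes "similar_mat A B"
  shows "trace A = trace B"
proof -
  obtain n P Q where *: "{A, B, P, Q} \<subseteq> carrier_mat n n" "P * Q = 1\<^sub>m n" "Q * P = 1\<^sub>m n" "A = P * B * Q"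
    using similar_matD[OF assms] by blast
  then have c: "A \<in> carrier_mat n n" "B \<in> carrier_mat n n" "P \<in> carrier_mat n n" "Q \<in> carrier_mat n n"
    by auto
  have "trace A = trace (Q * (P * B))"
    unfolding *(4) by (rule trace_mult_comm) (use c in auto)
  also have "Q * (P * B) = B"
    using c *(3) by (simp add: assoc_mult_mat[symmetric])
  finally show ?thesis .
qed

lemma similar_mat_square:
  fixes A B :: "'a::comm_ring_1 mat"
  assumes "similar_mat A B"
  shows "similar_mat (A * A) (B * B)"
proof -
  obtain n P Q where *: "{A, B, P, Q} \<subseteq> carrier_mat n n" "P * Q = 1\<^sub>m n" "Q * P = 1\<^sub>m n" "A = P * B * Q"
    using similar_matD[OF assms] by blast
  then have c: "A \<in> carrier_mat n n" "B \<in> carrier_mat n n" "P \<in> carrier_mat n n" "Q \<in> carrier_mat n n"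
    by auto
  note as = assoc_mult_mat[of _ n n _ n _ n] and mc = mult_carrier_mat[of _ n n _ n]
  have "Q * (P * (B * Q)) = (Q * P) * (B * Q)" using c by (simp add: as mc)
  also have "\<dots> = B * Q" unfolding *(3) using c by (simp add: mc)
  finally have "A * A = P * (B * B) * Q"
    unfolding *(4) using c by (simp add: as mc)
  then show ?thesis
    unfolding similar_mat_def similar_mat_wit_def Let_def using *(2,3) c
    by (intro exI[of _ P] exI[of _ Q]) (auto simp: mc)
qed

text \<open>Eigenvalues with multiplicity, read off the diagonal of a triangular matrix similar to
  \<open>A\<close>. Similarity preserves the determinant and the traces of \<open>A\<close> and
  \<open>A\<^sup>2\<close>, so no diagonalization is required.\<close>

lemma complex_eigenvalue_expansion:
  fixes A :: "complex mat"
  assumes A: "A \<in> carrier_mat n n"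
  obtains e :: "nat \<Rightarrow> complex"
  where "\<And>i. i < n \<Longrightarrow> eigenvalue A (e i)" "det A = (\<Prod>i<n. e i)"
    "trace A = (\<Sum>i<n. e i)" "trace (A * A) = (\<Sum>i<n. e i * e i)"
proof -
  obtain es where "char_poly A = (\<Prod>a\<leftarrow>es. [:- a, 1:])"
    using char_poly_factorized[OF A] by blast
  from schur_decomposition_exists[OF A this] obtain B where
    B: "B \<in> carrier_mat n n" and ut: "upper_triangular B" and sim: "similar_mat A B" by blast
  define e where "e i = B $$ (i, i)" for i
  have dm: "diag_mat B = map e [0..<n]" using B by (simp add: diag_mat_def e_def)
  have "eigenvalue A (e i)" if "i < n" for i
  proof -
    have "poly (char_poly B) (e i) = 0"
      using that unfolding char_poly_upper_triangular[OF B ut] dm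
      by (auto simp: poly_prod_list prod_list_zero_iff image_iff)
    then show ?thesis using eigenvalue_root_char_poly[OF A] char_poly_similar[OF sim] by simp
  qed
  moreover have "det A = (\<Prod>i<n. e i)"
    unfolding det_similar[OF sim] det_upper_triangular[OF ut B] dm
    by (simp add: prod.list_conv_set_nth atLeast0LessThan)
  moreover have "trace A = (\<Sum>i<n. e i)"
    using B unfolding trace_similar[OF sim] by (simp add: trace_def e_def)
  moreover have "trace (A * A) = (\<Sum>i<n. e i * e i)"
  proof -
    have "(B * B) $$ (i, i) = e i * e i" if i: "i < n" for i
    proof -
      have "(B * B) $$ (i, i) = (\<Sum>k<n. B $$ (i, k) * B $$ (k, i))"
        by (rule times_mat_entry[OF B B i i])
      also have "\<dots> = (\<Sum>k<n. if k = i then e i * e i else 0)"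
      proof (rule sum.cong)
        fix k assume "k \<in> {..<n}"
        then show "B $$ (i, k) * B $$ (k, i) = (if k = i then e i * e i else 0)"
          using upper_triangularD[OF ut, of i k] upper_triangularD[OF ut, of k i] B i
          by (cases "k < i"; cases "i < k") (auto simp: e_def)
      qed simp
      also have "\<dots> = e i * e i" using i by simp
      finally show ?thesis .
    qed
    then show ?thesis using B unfolding trace_similar[OF similar_mat_square[OF sim]] by (simp add: trace_def del: index_mult_mat(1))
  qed
  ultimately show ?thesis by (rule that)
qed

text \<open>The constant grows only like \<open>ln (1 / \<rho>)\<close>: near \<open>\<rho>\<close> the
  quadratic term is at least \<open>1 / 4\<close>, so multiplying it by \<open>4 ln (1 /
  \<rho>)\<close> already pays for \<open>ln \<rho>\<close>.\<close>

lemma ln_lower_quadratic: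
  fixes x \<rho> :: real
  assumes "0 < \<rho>" "\<rho> \<le> 1" "\<rho> \<le> x"
  shows "(x - 1) - (2 + 4 * ln (1 / \<rho>)) * (x - 1)\<^sup>2 \<le> ln x"
proof -
  have l0: "0 \<le> ln (1 / \<rho>)" using assms by simp
  show ?thesis
  proof (cases "x < 1 / 2")
    case True
    have sq: "1 / 4 \<le> (x - 1)\<^sup>2"
      using power_mono[of "1/2" "1 - x" 2] True by (simp add: power2_commute power_divide)
    have "ln x \<ge> ln \<rho>" using assms by simp
    also have "ln \<rho> = - (4 * ln (1 / \<rho>)) * (1 / 4)" using assms by (simp add: ln_div)
    finally have "ln x \<ge> - (4 * ln (1 / \<rho>)) * (1/4)" .
    moreover have "- (4 * ln (1 / \<rho>)) * (1 / 4) \<ge> - (4 * ln (1 / \<rho>)) * (x - 1)\<^sup>2"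
      using l0 sq by (intro mult_left_mono_neg) auto
    moreover have "(x - 1) - 2 * (x - 1)\<^sup>2 \<le> 0" using True zero_le_power2[of "x - 1"] by linarith
    ultimately show ?thesis by (simp add: algebra_simps)
  next
    case False
    have "(x - 1) - 2 * (x - 1)\<^sup>2 \<le> ln x"
    proof (cases "x \<ge> 1")
      case True
      show ?thesis
      proof (cases "x \<le> 2")
        case le2: True
        have "(x - 1) - (x - 1)\<^sup>2 \<le> ln x"
          using ln_one_plus_pos_lower_bound[of "x - 1"] True le2 by simp
        then show ?thesis using zero_le_power2[of "x - 1"] by linarith
      next
        case False
        have "x - 1 \<le> (x - 1)\<^sup>2" unfolding power2_eq_square
          using False mult_left_mono[of 1 "x - 1" "x - 1"] by simp
        moreover have "0 \<le> ln x" using True by simp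
        ultimately show ?thesis using zero_le_power2[of "x - 1"] by linarith
      qed
    next
      case F: False
      then show ?thesis using ln_one_minus_pos_lower_bound[of "1 - x"] False
        by (simp add: power2_commute)
    qed
    moreover have "0 \<le> ln (1 / \<rho>) * (x - 1)\<^sup>2" using l0 by simp
    ultimately show ?thesis by (simp add: algebra_simps)
  qed
qed

text \<open>Summing scalar inequalities for \<open>ln\<close> over the eigenvalues turns them into inequalities
  in \<open>Tr N\<close> and \<open>Tr (N\<^sup>2)\<close>. The quadratic term is \<open>Tr ((N -
  1)\<^sup>2)\<close> written out.\<close>

lemma log_det_bounds:
  fixes N :: "real mat"
  assumes N: "N \<in> carrier_mat n n"
    and ev: "\<And>z. eigenvalue (map_mat complex_of_real N) z \<Longrightarrow> Im z = 0 \<and> 0 < Re z"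
  shows "0 < det N"
    and "ln (det N) \<le> trace N - real n"
    and "\<lbrakk>0 < \<rho>; \<rho> \<le> 1; \<And>z. eigenvalue (map_mat complex_of_real N) z \<Longrightarrow> \<rho> \<le> Re z\<rbrakk> \<Longrightarrow>
      trace N - real n - (2 + 4 * ln (1 / \<rho>)) * (trace (N * N) - 2 * trace N + real n) \<le> ln (det N)"
proof -
  let ?c = "map_mat complex_of_real N"
  have C: "?c \<in> carrier_mat n n" using N by simp
  obtain e where e: "\<And>i. i < n \<Longrightarrow> eigenvalue ?c (e i)" "det ?c = (\<Prod>i<n. e i)"
    "trace ?c = (\<Sum>i<n. e i)" "trace (?c * ?c) = (\<Sum>i<n. e i * e i)"
    using complex_eigenvalue_expansion[OF C] by metis
  define x where "x i = Re (e i)" for i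
  have ex: "e i = complex_of_real (x i)" "0 < x i" if "i < n" for i
    using ev[OF e(1)[OF that]] by (auto simp: x_def complex_eq_iff)
  have tc: "trace (map_mat complex_of_real R) = complex_of_real (trace R)" if "R \<in> carrier_mat n n" for R
    using that by (auto simp: trace_def)
  have "complex_of_real (det N) = (\<Prod>i<n. e i)" using e(2) by (simp add: of_real_hom.hom_det)
  also have "\<dots> = complex_of_real (\<Prod>i<n. x i)" by (simp add: ex)
  finally have det: "det N = (\<Prod>i<n. x i)" using of_real_eq_iff by blast
  have "complex_of_real (trace N) = complex_of_real (\<Sum>i<n. x i)"
    using e(3) tc[OF N] by (simp add: ex)
  then have tr: "trace N = (\<Sum>i<n. x i)" using of_real_eq_iff by blast
  have "complex_of_real (trace (N * N)) = complex_of_real (\<Sum>i<n. x i * x i)"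
    using e(4) tc[of "N * N"] N by (simp add: ex of_real_hom.mat_hom_mult[OF N N])
  then have tr2: "trace (N * N) = (\<Sum>i<n. x i * x i)" using of_real_eq_iff by blast
  show pos: "0 < det N" unfolding det by (rule prod_pos) (simp add: ex)
  have ld: "ln (det N) = (\<Sum>i<n. ln (x i))"
    unfolding det by (subst ln_prod) (auto dest: ex(2))
  show "ln (det N) \<le> trace N - real n"
  proof -
    have "(\<Sum>i<n. ln (x i)) \<le> (\<Sum>i<n. x i - 1)"
      by (rule sum_mono) (auto intro!: ln_le_minus_one dest: ex(2))
    then show ?thesis by (simp add: ld tr sum_subtractf)
  qed
  assume \<rho>: "0 < \<rho>" "\<rho> \<le> 1" "\<And>z. eigenvalue ?c z \<Longrightarrow> \<rho> \<le> Re z"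
  let ?K = "2 + 4 * ln (1 / \<rho>)"
  have "(\<Sum>i<n. (x i - 1) - ?K * (x i - 1)\<^sup>2) \<le> (\<Sum>i<n. ln (x i))"
    by (rule sum_mono, rule ln_lower_quadratic) (use \<rho> e(1) in \<open>auto simp: x_def\<close>)
  also have "(\<Sum>i<n. (x i - 1) - ?K * (x i - 1)\<^sup>2) = trace N - real n - ?K * (trace (N * N) - 2 * trace N + real n)"
    unfolding tr tr2 sum_subtractf sum_distrib_left[symmetric]
    by (simp add: power2_eq_square algebra_simps sum.distrib sum_subtractf sum_distrib_left)
  finally show "trace N - real n - ?K * (trace (N * N) - 2 * trace N + real n) \<le> ln (det N)"
    by (simp add: ld)
qed

section \<open>Products of positive definite matrices\<close>

text \<open>Vectors are functions on the indices here, which makes restriction to a block a multiplication by an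
  indicator.\<close>

definition qform :: "real mat \<Rightarrow> (nat \<Rightarrow> real) \<Rightarrow> real" where
  "qform A v = (\<Sum>i<dim_row A. \<Sum>j<dim_row A. A $$ (i, j) * v i * v j)"

definition sqnorm :: "nat \<Rightarrow> (nat \<Rightarrow> real) \<Rightarrow> real" where
  "sqnorm n v = (\<Sum>i<n. (v i)\<^sup>2)"

lemma sqnorm_nonneg: "0 \<le> sqnorm n v"
  by (simp add: sqnorm_def sum_nonneg)

lemma sqnorm_pos: "i < n \<Longrightarrow> v i \<noteq> 0 \<Longrightarrow> 0 < sqnorm n v"
  unfolding sqnorm_def by (rule sum_pos2[of _ i]) auto

definition sym_mat :: "'a mat \<Rightarrow> bool" where
  "sym_mat A \<longleftrightarrow> (\<forall>i<dim_row A. \<forall>j<dim_row A. A $$ (i, j) = A $$ (j, i))"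

lemma sym_matD: "sym_mat A \<Longrightarrow> A \<in> carrier_mat n n \<Longrightarrow> i < n \<Longrightarrow> j < n \<Longrightarrow> A $$ (i, j) = A $$ (j, i)"
  by (auto simp: sym_mat_def)

text \<open>For symmetric \<open>A\<close> the cross terms cancel, so a Hermitian form is a sum of two real
  quadratic forms. This is how eigenvectors of real matrices that happen to be complex are handled
  below.\<close>

lemma hermitian_form_real:
  fixes w :: "nat \<Rightarrow> complex"
  assumes "sym_mat A" "A \<in> carrier_mat n n"
  shows "(\<Sum>i<n. cnj (w i) * (\<Sum>j<n. complex_of_real (A $$ (i, j)) * w j))
    = complex_of_real (qform A (\<lambda>i. Re (w i)) + qform A (\<lambda>i. Im (w i)))" (is "?L = _")
proof (rule complex_eqI)
  have L: "?L = (\<Sum>i<n. \<Sum>j<n. complex_of_real (A $$ (i, j)) * (cnj (w i) * w j))"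
    by (simp add: sum_distrib_left mult_ac)
  show "Re ?L = Re (complex_of_real (qform A (\<lambda>i. Re (w i)) + qform A (\<lambda>i. Im (w i))))"
    unfolding L qform_def using assms by (simp add: sum.distrib algebra_simps)
  have "Im ?L = (\<Sum>i<n. \<Sum>j<n. A $$ (i, j) * (Re (w i) * Im (w j))) - (\<Sum>i<n. \<Sum>j<n. A $$ (i, j) * (Im (w i) * Re (w j)))"
    unfolding L by (simp add: sum_subtractf algebra_simps)
  also have "(\<Sum>i<n. \<Sum>j<n. A $$ (i, j) * (Im (w i) * Re (w j))) = (\<Sum>j<n. \<Sum>i<n. A $$ (i, j) * (Im (w i) * Re (w j)))"
    by (rule sum.swap)
  also have "\<dots> = (\<Sum>j<n. \<Sum>i<n. A $$ (j, i) * (Re (w j) * Im (w i)))"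
    using assms by (intro sum.cong refl) (auto simp: sym_mat_def)
  finally show "Im ?L = Im (complex_of_real (qform A (\<lambda>i. Re (w i)) + qform A (\<lambda>i. Im (w i))))" by simp
qed

text \<open>Splits the eigenvalue equation of a product, so that each factor can be tested with its own
  quadratic form.\<close>

lemma eigenvalue_product:
  fixes A M :: "real mat"
  assumes A: "A \<in> carrier_mat n n" and M: "M \<in> carrier_mat n n"
    and z: "eigenvalue (map_mat complex_of_real (A * M)) z"
  shows "\<exists>w u :: nat \<Rightarrow> complex. (\<exists>i<n. w i \<noteq> 0) \<and>
    (\<forall>i<n. u i = (\<Sum>j<n. complex_of_real (M $$ (i, j)) * w j)) \<and>
    (\<forall>i<n. (\<Sum>j<n. complex_of_real (A $$ (i, j)) * u j) = z * w i)"
proof -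
  let ?c = "map_mat complex_of_real"
  obtain x where x: "x \<in> carrier_vec n" "x \<noteq> 0\<^sub>v n" "?c (A * M) *\<^sub>v x = z \<cdot>\<^sub>v x"
    using z A M by (auto simp: eigenvalue_def eigenvector_def)
  have e: "?c (A * M) *\<^sub>v x = ?c A *\<^sub>v (?c M *\<^sub>v x)"
    using A M x by (simp add: of_real_hom.mat_hom_mult[OF A M])
  have mv: "(?c R *\<^sub>v y) $ i = (\<Sum>j<n. complex_of_real (R $$ (i, j)) * y $ j)"
    if "R \<in> carrier_mat n n" "y \<in> carrier_vec n" "i < n" for R :: "real mat" and y i
    using that by (auto simp: scalar_prod_def atLeast0LessThan intro!: sum.cong)
  have "\<exists>i<n. x $ i \<noteq> 0"
    using x(1,2) by (metis (no_types) carrier_vecD eq_vecI index_zero_vec(1) index_zero_vec(2))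
  moreover have "(\<Sum>j<n. complex_of_real (A $$ (i, j)) * (?c M *\<^sub>v x) $ j) = z * x $ i" if "i < n" for i
    using mv[OF A _ that, of "?c M *\<^sub>v x"] x M that by (simp add: e)
  ultimately show ?thesis
    using mv[OF M x(1)] by (intro exI[of _ "\<lambda>i. x $ i"] exI[of _ "\<lambda>i. (?c M *\<^sub>v x) $ i"]) auto
qed

definition coercive :: "nat \<Rightarrow> real \<Rightarrow> real mat \<Rightarrow> bool" where
  "coercive n c A \<longleftrightarrow> A \<in> carrier_mat n n \<and> sym_mat A \<and> 0 < c \<and> (\<forall>v. c * sqnorm n v \<le> qform A v)"

lemma coerciveD:
  assumes "coercive n c A"
  shows "A \<in> carrier_mat n n" "sym_mat A" "0 < c" "\<And>v. c * sqnorm n v \<le> qform A v"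
  using assms by (auto simp: coercive_def)

lemma coercive_hermitian:
  fixes w :: "nat \<Rightarrow> complex"
  assumes "coercive n c A" "\<exists>i<n. w i \<noteq> 0"
  shows "0 < qform A (\<lambda>i. Re (w i)) + qform A (\<lambda>i. Im (w i))"
proof -
  obtain i where i: "i < n" "w i \<noteq> 0" using assms(2) by blast
  have "0 < sqnorm n (\<lambda>i. Re (w i)) + sqnorm n (\<lambda>i. Im (w i))"
    using i sqnorm_pos[of i n "\<lambda>i. Re (w i)"] sqnorm_pos[of i n "\<lambda>i. Im (w i)"]
      sqnorm_nonneg[of n "\<lambda>i. Re (w i)"] sqnorm_nonneg[of n "\<lambda>i. Im (w i)"]
    by (cases "Re (w i) = 0") (auto simp: complex_eq_iff add_pos_nonneg add_nonneg_pos)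
  then have "0 < c * (sqnorm n (\<lambda>i. Re (w i)) + sqnorm n (\<lambda>i. Im (w i)))"
    using coerciveD(3)[OF assms(1)] by simp
  also have "\<dots> \<le> qform A (\<lambda>i. Re (w i)) + qform A (\<lambda>i. Im (w i))"
    using coerciveD(4)[OF assms(1)] by (simp add: distrib_left add_mono)
  finally show ?thesis .
qed

text \<open>From \<open>A u = z w\<close> and \<open>u = M w\<close> one gets \<open>u\<^sup>* A u = z
  (w\<^sup>* M w)\<close>, a quotient of two positive reals.\<close>

lemma eigenvalue_product_pos:
  assumes A: "coercive n a A" and M: "coercive n b M"
    and z: "eigenvalue (map_mat complex_of_real (A * M)) z"
  shows "Im z = 0 \<and> 0 < Re z"
proof -
  note Ac = coerciveD(1)[OF A] and Mc = coerciveD(1)[OF M]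
  obtain w u where wu: "\<exists>i<n. w i \<noteq> 0" "\<And>i. i < n \<Longrightarrow> u i = (\<Sum>j<n. complex_of_real (M $$ (i, j)) * w j)"
    "\<And>i. i < n \<Longrightarrow> (\<Sum>j<n. complex_of_real (A $$ (i, j)) * u j) = z * w i"
    using eigenvalue_product[OF Ac Mc z] by blast
  define qm where "qm = qform M (\<lambda>i. Re (w i)) + qform M (\<lambda>i. Im (w i))"
  define qa where "qa = qform A (\<lambda>i. Re (u i)) + qform A (\<lambda>i. Im (u i))"
  have qm: "complex_of_real qm = (\<Sum>i<n. cnj (w i) * u i)"
    unfolding qm_def hermitian_form_real[OF coerciveD(2)[OF M] Mc, symmetric] by (simp add: wu(2))
  have "complex_of_real qa = (\<Sum>i<n. cnj (u i) * (z * w i))"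
    unfolding qa_def hermitian_form_real[OF coerciveD(2)[OF A] Ac, symmetric] by (simp add: wu(3))
  also have "\<dots> = z * cnj (\<Sum>i<n. cnj (w i) * u i)" by (simp add: sum_distrib_left mult_ac)
  finally have eq: "complex_of_real qa = z * complex_of_real qm" by (simp add: qm[symmetric])
  have m0: "0 < qm" unfolding qm_def by (rule coercive_hermitian[OF M wu(1)])
  have "\<exists>i<n. u i \<noteq> 0"
  proof (rule ccontr)
    assume "\<not> (\<exists>i<n. u i \<noteq> 0)"
    then have "complex_of_real qm = 0" unfolding qm by simp
    then show False using m0 by simp
  qed
  then have a0: "0 < qa" unfolding qa_def by (rule coercive_hermitian[OF A])
  have "z = complex_of_real (qa / qm)" using eq m0 by (simp add: field_simps)
  then show ?thesis using a0 m0 by simp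
qed

text \<open>Here \<open>A\<close> is the inverse of \<open>Q\<close>, so \<open>A M w = z w\<close> reads
  \<open>M w = z Q w\<close> and \<open>z\<close> is the quotient of the forms of \<open>M\<close> and
  \<open>Q\<close> at \<open>w\<close>.\<close>

lemma eigenvalue_product_ge:
  assumes Q: "coercive n c Q" and A: "A \<in> carrier_mat n n" and QA: "Q * A = 1\<^sub>m n"
    and M: "M \<in> carrier_mat n n" "sym_mat M" and ge: "\<And>v. \<rho> * qform Q v \<le> qform M v"
    and z: "eigenvalue (map_mat complex_of_real (A * M)) z"
  shows "Im z = 0 \<and> \<rho> \<le> Re z"
proof -
  note Qc = coerciveD(1)[OF Q]
  obtain w u where wu: "\<exists>i<n. w i \<noteq> 0" "\<And>i. i < n \<Longrightarrow> u i = (\<Sum>j<n. complex_of_real (M $$ (i, j)) * w j)"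
    "\<And>i. i < n \<Longrightarrow> (\<Sum>j<n. complex_of_real (A $$ (i, j)) * u j) = z * w i"
    using eigenvalue_product[OF A M(1) z] by blast
  define qm where "qm = qform M (\<lambda>i. Re (w i)) + qform M (\<lambda>i. Im (w i))"
  define qq where "qq = qform Q (\<lambda>i. Re (w i)) + qform Q (\<lambda>i. Im (w i))"
  have qa1: "(\<Sum>j<n. complex_of_real (Q $$ (i, j)) * complex_of_real (A $$ (j, k))) = of_bool (i = k)"
    if "i < n" "k < n" for i k
  proof -
    have "(\<Sum>j<n. Q $$ (i, j) * A $$ (j, k)) = (Q * A) $$ (i, k)"
      using times_mat_entry[OF Qc A that] by simp
    then have "(\<Sum>j<n. Q $$ (i, j) * A $$ (j, k)) = of_bool (i = k)" using that by (simp add: QA)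
    then have "complex_of_real (\<Sum>j<n. Q $$ (i, j) * A $$ (j, k)) = of_bool (i = k)" by simp
    then show ?thesis by simp
  qed
  have Qw: "(\<Sum>j<n. complex_of_real (Q $$ (i, j)) * (z * w j)) = u i" if i: "i < n" for i
  proof -
    have "(\<Sum>j<n. complex_of_real (Q $$ (i, j)) * (z * w j))
      = (\<Sum>j<n. complex_of_real (Q $$ (i, j)) * (\<Sum>k<n. complex_of_real (A $$ (j, k)) * u k))"
      by (simp add: wu(3))
    also have "\<dots> = (\<Sum>k<n. (\<Sum>j<n. complex_of_real (Q $$ (i, j)) * complex_of_real (A $$ (j, k))) * u k)"
      unfolding sum_distrib_left sum_distrib_right by (subst sum.swap) (simp add: mult_ac)
    also have "\<dots> = (\<Sum>k<n. if k = i then u k else 0)" using i by (intro sum.cong) (auto simp: qa1)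
    also have "\<dots> = u i" using i by simp
    finally show ?thesis .
  qed
  have "complex_of_real qm = (\<Sum>i<n. cnj (w i) * u i)"
    unfolding qm_def hermitian_form_real[OF M(2,1), symmetric] by (simp add: wu(2))
  also have "\<dots> = (\<Sum>i<n. cnj (w i) * (\<Sum>j<n. complex_of_real (Q $$ (i, j)) * (z * w j)))"
    by (simp add: Qw)
  also have "\<dots> = z * (\<Sum>i<n. cnj (w i) * (\<Sum>j<n. complex_of_real (Q $$ (i, j)) * w j))"
    by (simp add: sum_distrib_left mult_ac)
  finally have eq: "complex_of_real qm = z * complex_of_real qq"
    unfolding qq_def hermitian_form_real[OF coerciveD(2)[OF Q] Qc] .
  have q0: "0 < qq" unfolding qq_def by (rule coercive_hermitian[OF Q wu(1)])
  have ge': "\<rho> * qq \<le> qm" unfolding qq_def qm_def distrib_left using ge by (intro add_mono) auto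
  have "z = complex_of_real (qm / qq)" using eq q0 by (simp add: field_simps)
  then have "Re z = qm / qq" "Im z = 0" by (simp_all del: of_real_divide)
  then show ?thesis using ge' q0 by (simp add: pos_le_divide_eq)
qed

lemma coercive_one: "coercive n 1 (1\<^sub>m n)"
proof -
  have "qform (1\<^sub>m n) v = sqnorm n v" for v
  proof -
    have "qform (1\<^sub>m n) v = (\<Sum>i<n. \<Sum>j<n. if j = i then (v i)\<^sup>2 else 0)"
      unfolding qform_def by (intro sum.cong) (auto simp: power2_eq_square)
    then show ?thesis by (simp add: sqnorm_def)
  qed
  then show ?thesis by (auto simp: coercive_def sym_mat_def)
qed

lemma coercive_det_pos:
  assumes A: "coercive n a A"
  shows "0 < det A"
  using log_det_bounds(1)[of "A * 1\<^sub>m n" n, OF _ eigenvalue_product_pos[OF A coercive_one]]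
    coerciveD(1)[OF A] by simp

text \<open>The variational inequality \<open>ln det M \<le> Tr (A M) - n - ln det A\<close>, with equality for
  \<open>A = M\<^sup>-\<^sup>1\<close>. A good choice of \<open>A\<close> gives upper bounds for
  \<open>ln det M\<close>.\<close>

lemma log_det_product_le:
  assumes A: "coercive n a A" and M: "coercive n b M"
  shows "ln (det A) + ln (det M) \<le> trace (A * M) - real n"
proof -
  note c = coerciveD(1)[OF A] coerciveD(1)[OF M]
  have "ln (det (A * M)) \<le> trace (A * M) - real n"
    by (rule log_det_bounds(2)[OF _ eigenvalue_product_pos[OF A M]]) (use c in auto)
  then show ?thesis
    using coercive_det_pos[OF A] coercive_det_pos[OF M] by (simp add: det_mult[OF c] ln_mult)
qed

text \<open>The second order counterpart of \<open>log_det_product_le\<close>: the error is the squared distance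
  of \<open>Q\<^sup>-\<^sup>1 M\<close> from the identity, and the lower bound \<open>\<rho>\<close>
  of \<open>M\<close> relative to \<open>Q\<close> enters logarithmically.\<close>

lemma log_det_product_ge:
  assumes Q: "coercive n c Q" and A: "A \<in> carrier_mat n n" and QA: "Q * A = 1\<^sub>m n"
    and M: "M \<in> carrier_mat n n" "sym_mat M" and ge: "\<And>v. \<rho> * qform Q v \<le> qform M v"
    and \<rho>: "0 < \<rho>" "\<rho> \<le> 1"
  shows "trace (A * M) - real n - (2 + 4 * ln (1 / \<rho>)) *
      (trace (A * M * (A * M)) - 2 * trace (A * M) + real n) \<le> ln (det M) - ln (det Q)"
proof -
  note ev = eigenvalue_product_ge[OF Q A QA M ge]
  have c: "A * M \<in> carrier_mat n n" using A M by simp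
  have ev': "\<And>z. eigenvalue (map_mat complex_of_real (A * M)) z \<Longrightarrow> Im z = 0 \<and> 0 < Re z"
    using ev \<rho>(1) by force
  have b: "trace (A * M) - real n - (2 + 4 * ln (1 / \<rho>)) *
      (trace (A * M * (A * M)) - 2 * trace (A * M) + real n) \<le> ln (det (A * M))"
    by (rule log_det_bounds(3)[OF c ev' \<rho>]) (use ev in auto)
  have "det Q * det A = 1" using det_mult[OF coerciveD(1)[OF Q] A] QA by simp
  moreover note dq = coercive_det_pos[OF Q]
  ultimately have da: "det A = 1 / det Q" by (simp add: field_simps)
  have "0 < det (A * M)" by (rule log_det_bounds(1)[OF c ev'])
  then have "0 < det M" using dq by (simp add: det_mult[OF A M(1)] da zero_less_divide_iff)
  then have "ln (det (A * M)) = ln (det M) - ln (det Q)"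
    using dq by (simp add: det_mult[OF A M(1)] da ln_div)
  then show ?thesis using b by simp
qed

section \<open>Partitions and block restrictions\<close>

text \<open>A partition is used through its equivalence relation; blocks themselves are only needed for sizes.\<close>

definition same_block :: "nat set set \<Rightarrow> nat \<Rightarrow> nat \<Rightarrow> bool" where
  "same_block B i j \<longleftrightarrow> (\<exists>D\<in>B. i \<in> D \<and> j \<in> D)"

lemma restrict_blocks_index:
  assumes "S \<in> carrier_mat p p" "i < p" "j < p"
  shows "restrict_blocks S B $$ (i, j) = (if same_block B i j then S $$ (i, j) else 0)"
  using assms by (simp add: restrict_blocks_def same_block_def)

lemma restrict_blocks_carrier [simp]:
  "S \<in> carrier_mat p p \<Longrightarrow> restrict_blocks S B \<in> carrier_mat p p"
  by (auto simp: restrict_blocks_def)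

lemma same_block_sym: "same_block B i j \<Longrightarrow> same_block B j i"
  by (auto simp: same_block_def)

lemma same_block_refl: "partition_on {..<p} B \<Longrightarrow> i < p \<Longrightarrow> same_block B i i"
  by (auto simp: same_block_def partition_on_def)

lemma same_block_less: "partition_on {..<p} B \<Longrightarrow> same_block B i j \<Longrightarrow> i < p \<and> j < p"
  by (auto simp: same_block_def partition_on_def)

lemma same_block_trans:
  assumes "partition_on {..<p} B" "same_block B i j" "same_block B j k"
  shows "same_block B i k"
proof -
  obtain D E where DE: "D \<in> B" "i \<in> D" "j \<in> D" "E \<in> B" "j \<in> E" "k \<in> E"
    using assms(2,3) by (auto simp: same_block_def)
  then have "E = D" using assms(1) disjointD[of B E D] by (auto simp: partition_on_def)
  then show ?thesis using DE by (auto simp: same_block_def)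
qed

lemma partition_nonempty: "partition_on {..<p} B \<Longrightarrow> D \<in> B \<Longrightarrow> \<exists>i. i \<in> D \<and> i < p"
  unfolding partition_on_def by (metis UnionI ex_in_conv lessThan_iff)

lemma partition_covers: "partition_on {..<p} B \<Longrightarrow> i < p \<Longrightarrow> \<exists>D\<in>B. i \<in> D"
  unfolding partition_on_def by (metis UnionE lessThan_iff)

lemma block_eq_same_block:
  assumes "partition_on {..<p} B" "D \<in> B" "i \<in> D"
  shows "D = {j. same_block B i j}"
proof -
  have eq: "E = D" if "E \<in> B" "i \<in> E" for E
    using assms that disjointD[of B E D] by (auto simp: partition_on_def)
  show ?thesis
  proof (intro subset_antisym subsetI)
    fix j assume "j \<in> D"
    then show "j \<in> {j. same_block B i j}" using assms(2,3) unfolding same_block_def by blast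
  next
    fix j assume "j \<in> {j. same_block B i j}"
    then obtain E where "E \<in> B" "i \<in> E" "j \<in> E" unfolding same_block_def by blast
    then show "j \<in> D" using eq by simp
  qed
qed

lemma partition_eq_same_block:
  assumes "partition_on {..<p} B"
  shows "B = (\<lambda>i. {j. same_block B i j}) ` {..<p}"
proof -
  have "D \<in> (\<lambda>i. {j. same_block B i j}) ` {..<p}" if D: "D \<in> B" for D
  proof -
    obtain i where i: "i \<in> D" "i < p" using partition_nonempty[OF assms D] by metis
    then show ?thesis by (intro image_eqI[of _ _ i] block_eq_same_block[OF assms D i(1)]) simp
  qed
  moreover have "{j. same_block B i j} \<in> B" if i: "i < p" for i
  proof -
    obtain D where D: "D \<in> B" "i \<in> D" using partition_covers[OF assms i] by metis
    show ?thesis by (rule back_subst[of "\<lambda>X. X \<in> B", OF D(1) block_eq_same_block[OF assms D]])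
  qed
  ultimately show ?thesis by auto
qed

lemma partition_eqI:
  assumes "partition_on {..<p} B" "partition_on {..<p} B'"
    and "\<And>i j. i < p \<Longrightarrow> j < p \<Longrightarrow> same_block B i j = same_block B' i j"
  shows "B = B'"
proof -
  have "same_block B i j = same_block B' i j" for i j
    using assms same_block_less by blast
  then have "(\<lambda>i. {j. same_block B i j}) ` {..<p} = (\<lambda>i. {j. same_block B' i j}) ` {..<p}"
    by simp
  note * = this
  have "B = (\<lambda>i. {j. same_block B i j}) ` {..<p}" by (rule partition_eq_same_block[OF assms(1)])
  also note *
  also have "(\<lambda>i. {j. same_block B' i j}) ` {..<p} = B'"
    by (rule partition_eq_same_block[OF assms(2), symmetric])
  finally show ?thesis .
qed

lemma refinesI_same_block:
  assumes "partition_on {..<p} B" "partition_on {..<p} B'"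
    and "\<And>i j. same_block B i j \<Longrightarrow> same_block B' i j"
  shows "refines {..<p} B B'"
  unfolding refines_def
proof (intro conjI assms ballI)
  fix D assume D: "D \<in> B"
  obtain i where i: "i \<in> D" "i < p" using partition_nonempty[OF assms(1) D] by metis
  obtain E where E: "E \<in> B'" "i \<in> E" using partition_covers[OF assms(2) i(2)] by metis
  have "D \<subseteq> E"
    unfolding block_eq_same_block[OF assms(1) D i(1)] block_eq_same_block[OF assms(2) E]
    using assms(3) by auto
  with E(1) show "\<exists>Y\<in>B'. D \<subseteq> Y" by auto
qed

lemma same_block_mono: "refines A B B' \<Longrightarrow> same_block B i j \<Longrightarrow> same_block B' i j"
  unfolding refines_def same_block_def by (meson subsetD)

text \<open>Common refinements and merged partitions are both obtained from this, by writing down the relation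
  that they should have.\<close>

lemma partition_of_equivalence:
  assumes refl: "\<And>i. i < p \<Longrightarrow> R i i" and sym: "\<And>i j. R i j \<Longrightarrow> R j i"
    and trans: "\<And>i j k. R i j \<Longrightarrow> R j k \<Longrightarrow> R i k"
  shows "\<exists>B. partition_on {..<p} B \<and> (\<forall>i j. same_block B i j \<longleftrightarrow> i < p \<and> j < p \<and> R i j)"
proof -
  define B where "B = (\<lambda>i. {j. j < p \<and> R i j}) ` {..<p}"
  have eq: "{k. k < p \<and> R i k} = {k. k < p \<and> R j k}" if "R i j" for i j
    using that sym trans by (metis (no_types, lifting))
  have "partition_on {..<p} B"
    unfolding partition_on_def disjoint_def
  proof (intro conjI ballI impI)
    show "\<Union> B = {..<p}" using refl by (auto simp: B_def)
    show "{} \<notin> B" using refl by (auto simp: B_def)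
    fix D D' assume "D \<in> B" "D' \<in> B" "D \<noteq> D'"
    then obtain i j where ij: "D = {k. k < p \<and> R i k}" "D' = {k. k < p \<and> R j k}"
      by (auto simp: B_def)
    have False if "k \<in> D" "k \<in> D'" for k
    proof -
      have "R i k" "R k j" using that ij sym by auto
      then show False using eq[OF trans] \<open>D \<noteq> D'\<close> ij by blast
    qed
    then show "D \<inter> D' = {}" by blast
  qed
  moreover have "same_block B i j \<longleftrightarrow> i < p \<and> j < p \<and> R i j" for i j
  proof
    assume "same_block B i j"
    then obtain l where "l < p" "i < p" "R l i" "j < p" "R l j" by (auto simp: same_block_def B_def)
    then show "i < p \<and> j < p \<and> R i j" using sym trans by meson
  next
    assume "i < p \<and> j < p \<and> R i j"
    then show "same_block B i j" unfolding same_block_def B_def using refl by auto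
  qed
  ultimately show ?thesis by blast
qed

lemma sum_swap3: "(\<Sum>a\<in>A. \<Sum>b\<in>B. \<Sum>c\<in>C. f a b c) = (\<Sum>b\<in>B. \<Sum>c\<in>C. \<Sum>a\<in>A. f a b c)"
  by (subst sum.swap) (intro sum.cong refl sum.swap)

lemma sum_blocks_indicator:
  assumes B: "partition_on {..<p} B"
  shows "(\<Sum>D\<in>B. of_bool (i \<in> D \<and> j \<in> D)) = (of_bool (same_block B i j) :: real)"
proof (cases "same_block B i j")
  case True
  then obtain D where D: "D \<in> B" "i \<in> D" "j \<in> D" by (auto simp: same_block_def)
  have fin: "finite B" using finite_elements[OF _ B] by simp
  have "(\<Sum>E\<in>B. of_bool (i \<in> E \<and> j \<in> E)) = (\<Sum>E\<in>B. if E = D then 1 else (0::real))"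
  proof (rule sum.cong)
    fix E assume "E \<in> B"
    then show "of_bool (i \<in> E \<and> j \<in> E) = (if E = D then 1 else (0::real))"
      using B D unfolding partition_on_def disjoint_def by auto
  qed simp
  then show ?thesis using True D fin by simp
next
  case False
  then show ?thesis by (auto simp: same_block_def intro!: sum.neutral)
qed

text \<open>The penalty counts pairs, so the penalties of nested partitions differ by the number of pairs that
  change status.\<close>

lemma sum_card_squares:
  assumes B: "partition_on {..<p} B"
  shows "(\<Sum>D\<in>B. (real (card D))\<^sup>2) = (\<Sum>i<p. \<Sum>j<p. of_bool (same_block B i j))"
proof -
  have "(real (card D))\<^sup>2 = (\<Sum>i<p. \<Sum>j<p. of_bool (i \<in> D \<and> j \<in> D))" if D: "D \<in> B" for D
  proof -
    have "D \<subseteq> {..<p}" using B D unfolding partition_on_def by blast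
    then have "{..<p} \<inter> {x. x \<in> D} = D" by blast
    then have c: "(\<Sum>i<p. of_bool (i \<in> D)) = real (card D)" by (simp add: sum_of_bool_eq)
    have "(\<Sum>i<p. \<Sum>j<p. of_bool (i \<in> D \<and> j \<in> D)) = (\<Sum>i<p. of_bool (i \<in> D)) * (\<Sum>j<p. of_bool (j \<in> D) :: real)"
      unfolding sum_product by (simp add: of_bool_conj)
    then show ?thesis unfolding c by (simp add: power2_eq_square)
  qed
  then have "(\<Sum>D\<in>B. (real (card D))\<^sup>2) = (\<Sum>D\<in>B. \<Sum>i<p. \<Sum>j<p. of_bool (i \<in> D \<and> j \<in> D))" by simp
  also have "\<dots> = (\<Sum>i<p. \<Sum>j<p. \<Sum>D\<in>B. of_bool (i \<in> D \<and> j \<in> D))"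
    by (rule sum_swap3)
  finally show ?thesis by (simp add: sum_blocks_indicator[OF B])
qed

text \<open>Block restriction splits a form into the forms of the pieces of the vector; two-sided bounds on a
  form therefore pass to every block restriction with the same constants.\<close>

lemma qform_restrict_blocks:
  assumes B: "partition_on {..<p} B" and S: "S \<in> carrier_mat p p"
  shows "qform (restrict_blocks S B) v = (\<Sum>D\<in>B. qform S (\<lambda>i. of_bool (i \<in> D) * v i))"
proof -
  have "(\<Sum>D\<in>B. qform S (\<lambda>i. of_bool (i \<in> D) * v i))
    = (\<Sum>D\<in>B. \<Sum>i<p. \<Sum>j<p. S $$ (i, j) * v i * v j * of_bool (i \<in> D \<and> j \<in> D))"
    using S by (simp add: qform_def of_bool_conj mult_ac)
  also have "\<dots> = (\<Sum>i<p. \<Sum>j<p. \<Sum>D\<in>B. S $$ (i, j) * v i * v j * of_bool (i \<in> D \<and> j \<in> D))"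
    by (rule sum_swap3)
  also have "\<dots> = (\<Sum>i<p. \<Sum>j<p. S $$ (i, j) * v i * v j * of_bool (same_block B i j))"
    by (simp add: sum_distrib_left[symmetric] sum_blocks_indicator[OF B])
  also have "\<dots> = qform (restrict_blocks S B) v"
    unfolding qform_def carrier_matD(1)[OF restrict_blocks_carrier[OF S]]
    by (intro sum.cong refl) (simp add: restrict_blocks_index[OF S])
  finally show ?thesis ..
qed

lemma sqnorm_blocks:
  assumes B: "partition_on {..<p} B"
  shows "sqnorm p v = (\<Sum>D\<in>B. sqnorm p (\<lambda>i. of_bool (i \<in> D) * v i))"
proof -
  have "(\<Sum>D\<in>B. sqnorm p (\<lambda>i. of_bool (i \<in> D) * v i)) = (\<Sum>D\<in>B. \<Sum>i<p. (v i)\<^sup>2 * of_bool (i \<in> D \<and> i \<in> D))"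
    unfolding sqnorm_def by (intro sum.cong refl) (simp add: power_mult_distrib)
  also have "\<dots> = (\<Sum>i<p. (v i)\<^sup>2 * of_bool (same_block B i i))"
    by (subst sum.swap) (simp only: sum_distrib_left[symmetric] sum_blocks_indicator[OF B])
  also have "\<dots> = sqnorm p v" using same_block_refl[OF B] by (simp add: sqnorm_def)
  finally show ?thesis ..
qed

lemma coercive_restrict_blocks:
  assumes B: "partition_on {..<p} B" and S: "coercive p c S"
  shows "coercive p c (restrict_blocks S B)"
proof -
  note Sc = coerciveD(1)[OF S]
  have "sym_mat (restrict_blocks S B)"
    unfolding sym_mat_def carrier_matD(1)[OF restrict_blocks_carrier[OF Sc]]
    using sym_matD[OF coerciveD(2)[OF S] Sc] same_block_sym
    by (auto simp: restrict_blocks_index[OF Sc])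
  moreover have "c * sqnorm p v \<le> qform (restrict_blocks S B) v" for v
    unfolding qform_restrict_blocks[OF B Sc] sqnorm_blocks[OF B, of v] sum_distrib_left
    by (intro sum_mono coerciveD(4)[OF S])
  ultimately show ?thesis using Sc coerciveD(3)[OF S] by (simp add: coercive_def)
qed

lemma qform_restrict_blocks_le:
  assumes B: "partition_on {..<p} B" and S: "S \<in> carrier_mat p p"
    and le: "\<And>v. qform S v \<le> c * sqnorm p v"
  shows "qform (restrict_blocks S B) v \<le> c * sqnorm p v"
  unfolding qform_restrict_blocks[OF B S] sqnorm_blocks[OF B, of v] sum_distrib_left
  by (intro sum_mono le)

text \<open>Deleting the entries of the inverse \<open>G\<close> outside the blocks leaves a right inverse,
  which must be \<open>G\<close> itself.\<close>

lemma inverse_restrict_blocks: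
  assumes B: "partition_on {..<p} B" and S: "S \<in> carrier_mat p p" and G: "G \<in> carrier_mat p p"
    and QG: "restrict_blocks S B * G = 1\<^sub>m p" and GQ: "G * restrict_blocks S B = 1\<^sub>m p"
    and ij: "i < p" "j < p" "\<not> same_block B i j"
  shows "G $$ (i, j) = 0"
proof -
  let ?Q = "restrict_blocks S B" and ?G = "restrict_blocks G B"
  have c: "?Q \<in> carrier_mat p p" "?G \<in> carrier_mat p p" using S G by auto
  have "?Q * ?G = 1\<^sub>m p"
  proof (rule eq_matI)
    fix i j assume "i < dim_row (1\<^sub>m p :: real mat)" "j < dim_col (1\<^sub>m p :: real mat)"
    then have ij: "i < p" "j < p" by auto
    have e: "(?Q * ?G) $$ (i, j) = (\<Sum>k<p. ?Q $$ (i, k) * ?G $$ (k, j))"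
      by (rule times_mat_entry[OF c ij])
    show "(?Q * ?G) $$ (i, j) = 1\<^sub>m p $$ (i, j)"
    proof (cases "same_block B i j")
      case True
      have "(\<Sum>k<p. ?Q $$ (i, k) * ?G $$ (k, j)) = (\<Sum>k<p. ?Q $$ (i, k) * G $$ (k, j))"
      proof (rule sum.cong)
        fix k assume "k \<in> {..<p}"
        moreover have "same_block B k j" if "same_block B i k"
          by (rule same_block_trans[OF B same_block_sym[OF that] True])
        ultimately show "?Q $$ (i, k) * ?G $$ (k, j) = ?Q $$ (i, k) * G $$ (k, j)"
          using ij by (simp add: restrict_blocks_index[OF S] restrict_blocks_index[OF G])
      qed simp
      also have "\<dots> = (?Q * G) $$ (i, j)" by (rule times_mat_entry[OF c(1) G ij, symmetric])
      finally show ?thesis by (simp only: e QG)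
    next
      case False
      have "(\<Sum>k<p. ?Q $$ (i, k) * ?G $$ (k, j)) = 0"
      proof (rule sum.neutral, rule ballI)
        fix k assume "k \<in> {..<p}"
        moreover have "\<not> same_block B k j" if "same_block B i k"
          using same_block_trans[OF B that] False by metis
        ultimately show "?Q $$ (i, k) * ?G $$ (k, j) = 0"
          using ij by (simp add: restrict_blocks_index[OF S] restrict_blocks_index[OF G])
      qed
      moreover have "i \<noteq> j" using False same_block_refl[OF B ij(1)] by auto
      ultimately show ?thesis using ij e by simp
    qed
  qed (use S G in \<open>auto simp: restrict_blocks_def\<close>)
  then have "G * (?Q * ?G) = G" using G by simp
  moreover have "G * (?Q * ?G) = ?G"
    using assoc_mult_mat[OF G c] c by (simp add: GQ)
  ultimately have "G = ?G" by simp
  then show ?thesis using restrict_blocks_index[OF G ij(1,2), of B] ij(3) by simp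
qed

section \<open>Inverses of block restrictions and the value of the criterion\<close>

definition mv :: "real mat \<Rightarrow> (nat \<Rightarrow> real) \<Rightarrow> nat \<Rightarrow> real" where
  "mv A v i = (\<Sum>j<dim_row A. A $$ (i, j) * v j)"

lemma qform_eq_mv: "qform A v = (\<Sum>i<dim_row A. v i * mv A v i)"
  by (simp add: qform_def mv_def sum_distrib_left mult_ac)

lemma mv_mult:
  assumes "A \<in> carrier_mat n n" "B \<in> carrier_mat n n" "A * B = 1\<^sub>m n" "i < n"
  shows "mv A (mv B v) i = v i"
proof -
  have "mv A (mv B v) i = (\<Sum>j<n. \<Sum>k<n. A $$ (i, j) * B $$ (j, k) * v k)"
    using assms by (simp add: mv_def sum_distrib_left mult_ac)
  also have "\<dots> = (\<Sum>k<n. (\<Sum>j<n. A $$ (i, j) * B $$ (j, k)) * v k)"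
    by (subst sum.swap) (simp add: sum_distrib_right)
  also have "\<dots> = (\<Sum>k<n. if k = i then v k else 0)"
  proof (rule sum.cong)
    fix k assume "k \<in> {..<n}"
    then have k: "k < n" by simp
    show "(\<Sum>j<n. A $$ (i, j) * B $$ (j, k)) * v k = (if k = i then v k else 0)"
      using times_mat_entry[OF assms(1,2,4) k] assms(3,4) k by auto
  qed simp
  also have "\<dots> = v i" using assms(4) by simp
  finally show ?thesis .
qed

text \<open>The expansion of a square; it yields Cauchy-Schwarz type bounds below by choosing \<open>t\<close>.\<close>

lemma qform_diff:
  assumes A: "A \<in> carrier_mat n n" "sym_mat A"
  shows "qform A (\<lambda>i. w i - t * v i) = qform A w - 2 * t * (\<Sum>i<n. v i * mv A w i) + t\<^sup>2 * qform A v"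
proof -
  have d: "dim_row A = n" using A by simp
  have sw: "(\<Sum>i<n. \<Sum>j<n. A $$ (i, j) * w i * v j) = (\<Sum>i<n. \<Sum>j<n. A $$ (i, j) * v i * w j)"
    by (subst sum.swap) (intro sum.cong refl, simp add: sym_matD[OF A(2,1)])
  have "qform A (\<lambda>i. w i - t * v i) = (\<Sum>i<n. \<Sum>j<n. (A $$ (i, j) * w i * w j
     - t * (A $$ (i, j) * w i * v j)) - (t * (A $$ (i, j) * v i * w j) - t\<^sup>2 * (A $$ (i, j) * v i * v j)))"
    unfolding qform_def d by (intro sum.cong refl) (simp add: algebra_simps power2_eq_square)
  also have "\<dots> = qform A w - t * (\<Sum>i<n. \<Sum>j<n. A $$ (i, j) * w i * v j)
      - (t * (\<Sum>i<n. \<Sum>j<n. A $$ (i, j) * v i * w j) - t\<^sup>2 * qform A v)"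
    unfolding qform_def d sum_subtractf sum_distrib_left[symmetric] ..
  also have "\<dots> = qform A w - 2 * t * (\<Sum>i<n. \<Sum>j<n. A $$ (i, j) * v i * w j) + t\<^sup>2 * qform A v"
    unfolding sw by simp
  also have "(\<Sum>i<n. \<Sum>j<n. A $$ (i, j) * v i * w j) = (\<Sum>i<n. v i * mv A w i)"
    unfolding mv_def d sum_distrib_left by (intro sum.cong refl) simp
  finally show ?thesis .
qed

lemma adjugate_inverse:
  assumes A: "A \<in> carrier_mat n n" and d: "det (A :: real mat) \<noteq> 0"
  shows "(1 / det A) \<cdot>\<^sub>m adj_mat A \<in> carrier_mat n n"
    "A * ((1 / det A) \<cdot>\<^sub>m adj_mat A) = 1\<^sub>m n" "(1 / det A) \<cdot>\<^sub>m adj_mat A * A = 1\<^sub>m n"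
proof -
  show "(1 / det A) \<cdot>\<^sub>m adj_mat A \<in> carrier_mat n n" using adj_mat(1)[OF A] by simp
  show "A * ((1 / det A) \<cdot>\<^sub>m adj_mat A) = 1\<^sub>m n"
    unfolding mult_smult_distrib[OF A adj_mat(1)[OF A]] adj_mat(2)[OF A] using d by (intro eq_matI) auto
  show "(1 / det A) \<cdot>\<^sub>m adj_mat A * A = 1\<^sub>m n"
    unfolding mult_smult_assoc_mat[OF adj_mat(1)[OF A] A] adj_mat(3)[OF A] using d by (intro eq_matI) auto
qed

text \<open>The bound on the form of the inverse is the nonnegativity of the form of \<open>Q\<close> at
  \<open>G v - v / C\<close>. The bound on the entries comes from evaluating the form of
  \<open>Q\<close> at the columns of \<open>G\<close>.\<close>

lemma coercive_inverse:
  assumes Q: "coercive n c Q" and le: "\<And>v. qform Q v \<le> C * sqnorm n v" and C: "0 < C"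
  shows "\<exists>G. Q * G = 1\<^sub>m n \<and> G * Q = 1\<^sub>m n \<and> coercive n (1 / C) G \<and>
    (\<forall>i<n. \<forall>j<n. \<bar>G $$ (i, j)\<bar> \<le> 1 / c)"
proof -
  note Qc = coerciveD(1)[OF Q] and c0 = coerciveD(3)[OF Q]
  define G where "G = (1 / det Q) \<cdot>\<^sub>m adj_mat Q"
  have "det Q \<noteq> 0" using coercive_det_pos[OF Q] by simp
  note G = adjugate_inverse[OF Qc this, folded G_def]
  note Gc = G(1) and QG = G(2) and GQ = G(3)
  have Gt: "transpose_mat G \<in> carrier_mat n n" using Gc by simp
  have Qt: "transpose_mat Q = Q"
    using coerciveD(2)[OF Q] Qc by (intro eq_matI) (auto simp: sym_mat_def)
  have "Q * transpose_mat G = transpose_mat (G * Q)"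
    using transpose_mult[OF Gc Qc] Qt by simp
  then have QGt: "Q * transpose_mat G = 1\<^sub>m n" by (simp add: GQ)
  have "G = G * (Q * transpose_mat G)" using Gc by (simp add: QGt)
  also have "\<dots> = transpose_mat G" using assoc_mult_mat[OF Gc Qc Gt] Gt by (simp add: GQ)
  finally have "G = transpose_mat G" .
  then have sym: "sym_mat G" unfolding sym_mat_def using Gc by (metis carrier_matD index_transpose_mat(1))
  have qG: "qform G v = qform Q (mv G v)" for v
  proof -
    have "qform Q (mv G v) = (\<Sum>i<n. mv G v i * mv Q (mv G v) i)" using Qc by (simp add: qform_eq_mv)
    also have "\<dots> = (\<Sum>i<n. mv G v i * v i)" by (simp add: mv_mult[OF Qc Gc QG])
    finally show ?thesis using Gc by (simp add: qform_eq_mv mult.commute)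
  qed
  have "1 / C * sqnorm n v \<le> qform G v" for v
  proof -
    have "0 \<le> qform Q (\<lambda>i. mv G v i - 1 / C * v i)"
      using coerciveD(4)[OF Q] c0 sqnorm_nonneg by (meson less_eq_real_def mult_nonneg_nonneg order_trans)
    also have "\<dots> = qform G v - 2 * (1 / C) * (\<Sum>i<n. v i * v i) + (1 / C)\<^sup>2 * qform Q v"
      unfolding qform_diff[OF Qc coerciveD(2)[OF Q]] qG by (simp add: mv_mult[OF Qc Gc QG])
    also have "\<dots> \<le> qform G v - 2 * (1 / C) * sqnorm n v + (1 / C)\<^sup>2 * (C * sqnorm n v)"
      using mult_left_mono[OF le[of v], of "(1 / C)\<^sup>2"]
      by (simp add: sqnorm_def power2_eq_square[of "v _"])
    also have "\<dots> = qform G v - 1 / C * sqnorm n v" using C by (simp add: power2_eq_square field_simps)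
    finally show ?thesis by simp
  qed
  then have cG: "coercive n (1 / C) G" using Gc sym C by (simp add: coercive_def)
  have "\<bar>G $$ (i, j)\<bar> \<le> 1 / c" if ij: "i < n" "j < n" for i j
  proof -
    define e where "e k = (if k = j then 1 else 0 :: real)" for k
    have me: "mv G e k = G $$ (k, j)" for k
    proof -
      have "mv G e k = (\<Sum>l<n. if l = j then G $$ (k, j) else 0)"
        unfolding mv_def using Gc by (intro sum.cong) (auto simp: e_def)
      then show ?thesis using ij by simp
    qed
    have "qform G e = (\<Sum>k<n. if k = j then G $$ (j, j) else 0)"
      unfolding qform_eq_mv me using Gc by (intro sum.cong) (auto simp: e_def)
    then have qe: "qform G e = G $$ (j, j)" using ij by simp
    have le: "c * (G $$ (k, j))\<^sup>2 \<le> G $$ (j, j)" if "k < n" for k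
    proof -
      have "(G $$ (k, j))\<^sup>2 \<le> sqnorm n (mv G e)"
        unfolding sqnorm_def me by (rule member_le_sum) (use that in auto)
      then have "c * (G $$ (k, j))\<^sup>2 \<le> c * sqnorm n (mv G e)" using c0 by simp
      also have "\<dots> \<le> qform Q (mv G e)" by (rule coerciveD(4)[OF Q])
      finally show ?thesis using qe qG by simp
    qed
    have g0: "0 \<le> G $$ (j, j)" using le[OF ij(2)] c0 by (meson mult_nonneg_nonneg less_eq_real_def order_trans zero_le_power2)
    have "G $$ (j, j) \<le> 1 / c"
    proof (cases "G $$ (j, j) = 0")
      case False
      then have "c * G $$ (j, j) \<le> 1" using le[OF ij(2)] g0 by (simp add: power2_eq_square mult.assoc[symmetric])
      then show ?thesis using c0 by (simp add: field_simps)
    qed (use c0 in simp)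
    then have "c * (G $$ (i, j))\<^sup>2 \<le> 1 / c" using le[OF ij(1)] by simp
    then have "(G $$ (i, j))\<^sup>2 \<le> (1 / c)\<^sup>2" using c0 by (simp add: field_simps power2_eq_square)
    then show ?thesis using c0 by (simp add: abs_le_square_iff[symmetric])
  qed
  then show ?thesis using QG GQ cG by auto
qed

lemma mat_inv_eqI:
  assumes "A \<in> carrier_mat n n" "G \<in> carrier_mat n n" "A * G = 1\<^sub>m n" "G * A = 1\<^sub>m n"
  shows "mat_inv A = G"
proof -
  have "A \<in> Units (ring_mat TYPE(real) n n)"
    using assms by (auto simp: Units_def ring_mat_def)
  then obtain B where B: "mat_inverse A = Some B"
    using mat_inverse(1)[OF assms(1), of n] by (cases "mat_inverse A") auto
  have *: "A * B = 1\<^sub>m n" "B \<in> carrier_mat n n" using mat_inverse(2)[OF assms(1) B] by auto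
  have "B = G * A * B" using * by (simp add: assms)
  also have "\<dots> = G" using assoc_mult_mat[OF assms(2,1) *(2)] * assms(2) by simp
  finally show ?thesis using B by (simp add: mat_inv_def)
qed

text \<open>Without zeros off the diagonal every pair in a common block of \<open>B\<close> is visible in
  \<open>S\<^sub>B\<close>, so no finer partition describes it.\<close>

lemma block_decomp_restrict_blocks:
  assumes B: "partition_on {..<p} B" and S: "S \<in> carrier_mat p p"
    and nz: "\<And>i j. i < p \<Longrightarrow> j < p \<Longrightarrow> i \<noteq> j \<Longrightarrow> S $$ (i, j) \<noteq> 0"
  shows "block_decomp (restrict_blocks S B) = B"
proof -
  let ?S = "restrict_blocks S B"
  have c: "?S \<in> carrier_mat p p" using S by simp
  have "is_finest_decomp ?S B"
    unfolding is_finest_decomp_def carrier_matD(1)[OF c]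
  proof (intro conjI allI impI notI)
    show "partition_on {..<p} B" by (rule B)
    show "?S = restrict_blocks ?S B"
      using c restrict_blocks_carrier[OF c, of B]
      by (intro eq_matI) (auto simp: restrict_blocks_index[OF c] restrict_blocks_index[OF S] simp del: restrict_blocks_carrier)
    fix B' assume B': "finer_than p B' B" and eq: "?S = restrict_blocks ?S B'"
    have part: "partition_on {..<p} B'" and ref: "refines {..<p} B' B" and ne: "B' \<noteq> B"
      using B' by (auto simp: finer_than_def refines_def)
    have "same_block B' i j = same_block B i j" if ij: "i < p" "j < p" for i j
    proof (rule ccontr)
      assume "same_block B' i j \<noteq> same_block B i j"
      then have *: "same_block B i j" "\<not> same_block B' i j" using same_block_mono[OF ref] by auto
      then have "i \<noteq> j" using same_block_refl[OF part ij(1)] by auto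
      then have "?S $$ (i, j) \<noteq> 0" using nz[OF ij] * ij by (simp add: restrict_blocks_index[OF S])
      moreover have "restrict_blocks ?S B' $$ (i, j) = 0"
        using * ij by (simp add: restrict_blocks_index[OF c])
      ultimately show False using eq by simp
    qed
    then show False using ne partition_eqI[OF part B] by metis
  qed
  moreover have "\<exists>!B. is_finest_decomp ?S B" using c by (intro is_finest_decomp_ex1) simp
  ultimately show ?thesis unfolding block_decomp_def by (rule the1_equality[rotated])
qed

text \<open>Only entries within blocks meet a nonzero factor. Applied to the inverse of \<open>S\<^sub>B\<close>
  this evaluates the trace term of the criterion as \<open>p\<close>.\<close>

lemma trace_inverse_restrict_blocks:
  assumes B: "partition_on {..<p} B" and S: "S \<in> carrier_mat p p" and G: "G \<in> carrier_mat p p"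
    and G0: "\<And>i j. i < p \<Longrightarrow> j < p \<Longrightarrow> \<not> same_block B i j \<Longrightarrow> G $$ (i, j) = 0"
  shows "trace (G * S) = trace (G * restrict_blocks S B)"
proof -
  have c: "restrict_blocks S B \<in> carrier_mat p p" using S by simp
  have "(\<Sum>k<p. G $$ (i, k) * S $$ (k, i)) = (\<Sum>k<p. G $$ (i, k) * restrict_blocks S B $$ (k, i))" if "i < p" for i
  proof (rule sum.cong)
    fix k assume "k \<in> {..<p}"
    then show "G $$ (i, k) * S $$ (k, i) = G $$ (i, k) * restrict_blocks S B $$ (k, i)"
      using that G0[of i k] same_block_sym[of B i k] by (auto simp: restrict_blocks_index[OF S])
  qed simp
  then show ?thesis
    using G by (auto simp: trace_def times_mat_entry[OF G S] times_mat_entry[OF G c]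
        simp del: index_mult_mat(1) intro!: sum.cong)
qed

text \<open>Supplies the upper bound that \<open>coercive_inverse\<close> asks for where its size is irrelevant.\<close>

lemma qform_le_exists: "\<exists>C>0. \<forall>v. qform A v \<le> C * sqnorm (dim_row A) v"
proof -
  let ?n = "dim_row A"
  define C where "C = (\<Sum>i<?n. \<Sum>j<?n. \<bar>A $$ (i, j)\<bar>) + 1"
  have "qform A v \<le> C * sqnorm ?n v" for v
  proof -
    have "A $$ (i, j) * v i * v j \<le> \<bar>A $$ (i, j)\<bar> * sqnorm ?n v" if ij: "i < ?n" "j < ?n" for i j
    proof -
      have "v i * v i \<le> sqnorm ?n v" "v j * v j \<le> sqnorm ?n v" unfolding sqnorm_def power2_eq_square
        by (rule member_le_sum[of _ _ "\<lambda>i. v i * v i"], use ij in auto)+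
      moreover have "\<bar>v i * v j\<bar> \<le> (v i * v i + v j * v j) / 2"
        using sum_squares_bound[of "\<bar>v i\<bar>" "\<bar>v j\<bar>"] by (simp add: abs_mult power2_eq_square)
      moreover have "(v i * v i + v j * v j) / 2 \<le> sqnorm ?n v" using calculation(1,2) by simp
      ultimately have "\<bar>v i * v j\<bar> \<le> sqnorm ?n v" by (meson order_trans)
      then have "\<bar>A $$ (i, j)\<bar> * \<bar>v i * v j\<bar> \<le> \<bar>A $$ (i, j)\<bar> * sqnorm ?n v" by (rule mult_left_mono) simp
      moreover have "A $$ (i, j) * v i * v j \<le> \<bar>A $$ (i, j)\<bar> * \<bar>v i * v j\<bar>"
        by (metis abs_ge_self abs_mult mult.assoc)
      ultimately show ?thesis by linarith
    qed
    then have "qform A v \<le> (\<Sum>i<?n. \<Sum>j<?n. \<bar>A $$ (i, j)\<bar> * sqnorm ?n v)"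
      unfolding qform_def by (intro sum_mono) auto
    also have "\<dots> \<le> C * sqnorm ?n v"
      unfolding C_def by (simp add: sum_distrib_right distrib_right sqnorm_nonneg)
    finally show ?thesis .
  qed
  moreover have "0 < C" unfolding C_def by (intro add_nonneg_pos sum_nonneg) auto
  ultimately show ?thesis by auto
qed

text \<open>The trace term is constant in \<open>B\<close>, so that only the log-determinant and the penalty
  distinguish partitions.\<close>

lemma Psi_eq:
  assumes p: "0 < p" and B: "partition_on {..<p} B" and S: "coercive p c S"
    and nz: "\<And>i j. i < p \<Longrightarrow> j < p \<Longrightarrow> i \<noteq> j \<Longrightarrow> S $$ (i, j) \<noteq> 0"
  shows "Psi \<kappa> S B = (ln (det (restrict_blocks S B)) + real p) / real p
    + \<kappa> * (\<Sum>i<p. \<Sum>j<p. of_bool (same_block B i j))"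
proof -
  let ?Q = "restrict_blocks S B"
  note Sc = coerciveD(1)[OF S]
  have c: "?Q \<in> carrier_mat p p" using Sc by simp
  have Q: "coercive p c ?Q" by (rule coercive_restrict_blocks[OF B S])
  obtain C where C: "0 < C" "\<And>v. qform ?Q v \<le> C * sqnorm p v"
    using qform_le_exists[of ?Q] c by auto
  obtain G where G: "?Q * G = 1\<^sub>m p" "G * ?Q = 1\<^sub>m p" "coercive p (1 / C) G"
    using coercive_inverse[OF Q C(2,1)] by auto
  note Gc = coerciveD(1)[OF G(3)]
  have "mat_trace (mat_inv ?Q * S) = trace (G * S)"
    unfolding mat_trace_eq_trace mat_inv_eqI[OF c Gc G(1,2)] ..
  also have "\<dots> = trace (G * ?Q)"
    by (rule trace_inverse_restrict_blocks[OF B Sc Gc inverse_restrict_blocks[OF B Sc Gc G(1,2)]])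
  also have "\<dots> = real p" unfolding G(2) by (simp add: trace_def)
  finally show ?thesis
    using c by (simp add: Psi_def Phi_def neg_loglik_def pen_def sum_card_squares[OF B]
        block_decomp_restrict_blocks[OF B Sc nz])
qed

section \<open>Changing the partition changes the log-determinant\<close>

text \<open>The error term of \<open>log_det_product_ge\<close> in coordinates.\<close>

lemma trace_quadratic_excess:
  fixes N :: "real mat"
  assumes N: "N \<in> carrier_mat n n"
  shows "trace (N * N) - 2 * trace N + real n
    = (\<Sum>i<n. \<Sum>k<n. (N $$ (i, k) - of_bool (i = k)) * (N $$ (k, i) - of_bool (i = k)))"
proof -
  have "(\<Sum>i<n. \<Sum>k<n. (N $$ (i, k) - of_bool (i = k)) * (N $$ (k, i) - of_bool (i = k)))
    = (\<Sum>i<n. \<Sum>k<n. N $$ (i, k) * N $$ (k, i) - (if k = i then 2 * N $$ (i, i) - 1 else 0))"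
    by (intro sum.cong refl) (auto simp: algebra_simps)
  also have "\<dots> = (\<Sum>i<n. (\<Sum>k<n. N $$ (i, k) * N $$ (k, i)) - (2 * N $$ (i, i) - 1))"
    by (simp add: sum_subtractf)
  also have "\<dots> = trace (N * N) - 2 * trace N + real n"
    using N by (simp add: trace_def times_mat_entry[OF N N] sum_subtractf sum_distrib_left del: index_mult_mat(1))
  finally show ?thesis ..
qed

lemma restrict_blocks_restrict:
  assumes S: "S \<in> carrier_mat p p"
    and "\<And>i j. i < p \<Longrightarrow> j < p \<Longrightarrow> same_block C i j \<Longrightarrow> same_block B i j"
  shows "restrict_blocks (restrict_blocks S B) C = restrict_blocks S C"
proof -
  have c: "restrict_blocks S B \<in> carrier_mat p p" using S by simp
  show ?thesis
    using assms(2) restrict_blocks_carrier[OF c, of C] restrict_blocks_carrier[OF S, of C]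
    by (intro eq_matI) (auto simp: restrict_blocks_index[OF c] restrict_blocks_index[OF S] simp del: restrict_blocks_carrier)
qed

text \<open>What the likelihood can gain by the extra pairs of a coarser partition \<open>B\<close>. With
  \<open>G\<close> the inverse of \<open>Q = S\<^sub>C\<close> and \<open>E = S\<^sub>B -
  S\<^sub>C\<close> the first order term \<open>Tr (G E)\<close> vanishes, because \<open>G\<close>
  lives on the blocks of \<open>C\<close> and \<open>E\<close> off them. In the second order term
  \<open>Tr (G E G E)\<close> each row of \<open>G\<close> has at most \<open>m\<close> nonzero
  entries of size at most \<open>1 / q\<close>, so it is bounded by \<open>(m / q)\<^sup>2\<close>
  times the sum of squares of \<open>E\<close>. The form of \<open>S\<close> itself is used only
  through \<open>ln l\<close>.\<close>

lemma log_det_cost_of_coarsening: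
  assumes C: "partition_on {..<p} C" and B: "partition_on {..<p} B"
    and sub: "\<And>i j. i < p \<Longrightarrow> j < p \<Longrightarrow> same_block C i j \<Longrightarrow> same_block B i j"
    and S: "coercive p l S"
    and Q: "coercive p q (restrict_blocks S C)"
    and le: "\<And>v. qform (restrict_blocks S C) v \<le> q1 * sqnorm p v" and lq: "l \<le> q1"
    and rows: "\<And>i. i < p \<Longrightarrow> (\<Sum>j<p. of_bool (same_block C i j)) \<le> m"
    and small: "\<And>i j. i < p \<Longrightarrow> j < p \<Longrightarrow> same_block B i j \<Longrightarrow> \<not> same_block C i j \<Longrightarrow> \<bar>S $$ (i, j)\<bar> \<le> t"
  shows "ln (det (restrict_blocks S C)) - ln (det (restrict_blocks S B))
    \<le> (2 + 4 * ln (q1 / l)) * ((m * t / q)\<^sup>2 *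
        (\<Sum>i<p. \<Sum>j<p. of_bool (same_block B i j \<and> \<not> same_block C i j)))"
proof -
  note Sc = coerciveD(1)[OF S] and l0 = coerciveD(3)[OF S] and q0 = coerciveD(3)[OF Q]
  have q1: "0 < q1" using l0 lq by simp
  define Q where "Q = restrict_blocks S C"
  define M where "M = restrict_blocks S B"
  have Qc: "Q \<in> carrier_mat p p" and Mc: "M \<in> carrier_mat p p" using Sc by (auto simp: Q_def M_def)
  have Q: "coercive p q Q" and le: "\<And>v. qform Q v \<le> q1 * sqnorm p v" using assms(5,6) by (auto simp: Q_def)
  have M: "coercive p l M" unfolding M_def by (rule coercive_restrict_blocks[OF B S])
  obtain G where QG: "Q * G = 1\<^sub>m p" and GQ: "G * Q = 1\<^sub>m p" and cG: "coercive p (1 / q1) G"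
    and Gb: "\<And>i j. i < p \<Longrightarrow> j < p \<Longrightarrow> \<bar>G $$ (i, j)\<bar> \<le> 1 / q"
    using coercive_inverse[OF Q le q1] by auto
  note Gc = coerciveD(1)[OF cG]
  have G0: "G $$ (i, j) = 0" if "i < p" "j < p" "\<not> same_block C i j" for i j
    using inverse_restrict_blocks[OF C Sc Gc _ _ that] QG GQ by (simp add: Q_def)
  have Mr: "restrict_blocks M C = Q" unfolding M_def Q_def by (rule restrict_blocks_restrict[OF Sc sub])
  have "trace (G * M) = trace (G * restrict_blocks M C)"
    by (rule trace_inverse_restrict_blocks[OF C Mc Gc G0])
  then have tr: "trace (G * M) = real p" by (simp add: Mr GQ trace_def)
  have "l / q1 * qform Q v \<le> qform M v" for v
  proof -
    have "l / q1 * qform Q v \<le> l / q1 * (q1 * sqnorm p v)"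
      by (rule mult_left_mono[OF le]) (use l0 q1 in simp)
    also have "\<dots> \<le> qform M v" using coerciveD(4)[OF M] q1 by simp
    finally show ?thesis .
  qed
  from log_det_product_ge[OF Q Gc QG Mc coerciveD(2)[OF M] this] l0 q1 lq
  have main: "- ((2 + 4 * ln (q1 / l)) * (trace (G * M * (G * M)) - 2 * trace (G * M) + real p)) \<le> ln (det M) - ln (det Q)"
    by (simp add: tr)
  define E where "E j k = M $$ (j, k) - Q $$ (j, k)" for j k
  define H where "H i k = (\<Sum>j<p. G $$ (i, j) * E j k)" for i k
  have GM: "G * M \<in> carrier_mat p p" using Gc Mc by simp
  have H: "(G * M) $$ (i, k) - of_bool (i = k) = H i k" if "i < p" "k < p" for i k
  proof -
    have "of_bool (i = k) = (G * Q) $$ (i, k)" using that by (simp add: GQ)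
    then show ?thesis
      unfolding times_mat_entry[OF Gc Qc that] times_mat_entry[OF Gc Mc that] H_def E_def
      by (simp add: sum_subtractf right_diff_distrib)
  qed
  have m0: "0 \<le> m" if "p > 0" 
    by (rule order_trans[OF _ rows[OF that]]) (simp add: sum_nonneg)
  have Eb: "(E j k)\<^sup>2 \<le> t\<^sup>2 * of_bool (same_block B j k \<and> \<not> same_block C j k)" if jk: "j < p" "k < p" for j k
  proof (cases "same_block B j k \<and> \<not> same_block C j k")
    case True
    then have "E j k = S $$ (j, k)" unfolding E_def M_def Q_def using jk by (simp add: restrict_blocks_index[OF Sc])
    then show ?thesis using True small[OF jk] by (simp add: abs_le_square_iff[symmetric])
  next
    case False
    then have "E j k = 0" unfolding E_def M_def Q_def using jk sub by (auto simp: restrict_blocks_index[OF Sc])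
    then show ?thesis by simp
  qed
  have Gsq: "(\<Sum>j<p. (G $$ (i, j))\<^sup>2) \<le> m / q\<^sup>2" if i: "i < p" for i
  proof -
    have "(\<Sum>j<p. (G $$ (i, j))\<^sup>2) \<le> (\<Sum>j<p. (1 / q)\<^sup>2 * of_bool (same_block C i j))"
    proof (rule sum_mono)
      fix j assume "j \<in> {..<p}"
      then have j: "j < p" by simp
      show "(G $$ (i, j))\<^sup>2 \<le> (1 / q)\<^sup>2 * of_bool (same_block C i j)"
      proof (cases "same_block C i j")
        case True
        have "\<bar>G $$ (i, j)\<bar> \<le> \<bar>1 / q\<bar>" using Gb[OF i j] q0 by simp
        then have "(G $$ (i, j))\<^sup>2 \<le> (1 / q)\<^sup>2" by (simp only: abs_le_square_iff)
        then show ?thesis using True by simp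
      qed (use G0[OF i j] in simp)
    qed
    also have "\<dots> = (\<Sum>j<p. of_bool (same_block C i j)) / q\<^sup>2"
      by (simp only: sum_distrib_left[symmetric] power_one_over) (simp add: divide_inverse mult.commute)
    also have "\<dots> \<le> m / q\<^sup>2" by (rule divide_right_mono[OF rows[OF i]]) simp
    finally show ?thesis .
  qed
  have Hsq: "(H i k)\<^sup>2 \<le> m / q\<^sup>2 * (\<Sum>j<p. of_bool (same_block C i j) * (E j k)\<^sup>2)" if i: "i < p" for i k
  proof -
    have "H i k = (\<Sum>j<p. G $$ (i, j) * (of_bool (same_block C i j) * E j k))"
      unfolding H_def using G0[OF i] by (intro sum.cong) auto
    then have "(H i k)\<^sup>2 \<le> (\<Sum>j<p. (G $$ (i, j))\<^sup>2) * (\<Sum>j<p. (of_bool (same_block C i j) * E j k)\<^sup>2)"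
      using Cauchy_Schwarz_ineq_sum[of "\<lambda>j. G $$ (i, j)" "\<lambda>j. of_bool (same_block C i j) * E j k" "{..<p}"] by simp
    also have "\<dots> \<le> m / q\<^sup>2 * (\<Sum>j<p. (of_bool (same_block C i j) * E j k)\<^sup>2)"
      by (rule mult_right_mono[OF Gsq[OF i]]) (simp add: sum_nonneg)
    also have "(\<Sum>j<p. (of_bool (same_block C i j) * E j k)\<^sup>2) = (\<Sum>j<p. of_bool (same_block C i j) * (E j k)\<^sup>2)"
      by (intro sum.cong refl) (auto simp: of_bool_def)
    finally show ?thesis .
  qed
  have cross: "H i k * H k i \<le> ((H i k)\<^sup>2 + (H k i)\<^sup>2) / 2" for i k
    using sum_squares_bound[of "H i k" "H k i"] by simp
  have "trace (G * M * (G * M)) - 2 * trace (G * M) + real p = (\<Sum>i<p. \<Sum>k<p. H i k * H k i)"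
    unfolding trace_quadratic_excess[OF GM]
  proof (intro sum.cong refl)
    fix i k assume "i \<in> {..<p}" "k \<in> {..<p}"
    then have ik: "i < p" "k < p" by auto
    have e: "of_bool (i = k) = (of_bool (k = i) :: real)" by auto
    show "((G * M) $$ (i, k) - of_bool (i = k)) * ((G * M) $$ (k, i) - of_bool (i = k)) = H i k * H k i"
      unfolding H[OF ik] unfolding e H[OF ik(2,1)] ..
  qed
  also have "\<dots> \<le> (\<Sum>i<p. \<Sum>k<p. ((H i k)\<^sup>2 + (H k i)\<^sup>2) / 2)"
    by (intro sum_mono cross)
  also have "\<dots> = ((\<Sum>i<p. \<Sum>k<p. (H i k)\<^sup>2) + (\<Sum>i<p. \<Sum>k<p. (H k i)\<^sup>2)) / 2"
    by (simp only: sum.distrib sum_divide_distrib[symmetric])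
  also have "(\<Sum>i<p. \<Sum>k<p. (H k i)\<^sup>2) = (\<Sum>i<p. \<Sum>k<p. (H i k)\<^sup>2)" by (rule sum.swap)
  also have "((\<Sum>i<p. \<Sum>k<p. (H i k)\<^sup>2) + (\<Sum>i<p. \<Sum>k<p. (H i k)\<^sup>2)) / 2 = (\<Sum>i<p. \<Sum>k<p. (H i k)\<^sup>2)" by simp
  also have "\<dots> \<le> (\<Sum>i<p. \<Sum>k<p. m / q\<^sup>2 * (\<Sum>j<p. of_bool (same_block C i j) * (E j k)\<^sup>2))"
    by (intro sum_mono Hsq) simp
  also have "\<dots> = m / q\<^sup>2 * (\<Sum>i<p. \<Sum>k<p. \<Sum>j<p. of_bool (same_block C i j) * (E j k)\<^sup>2)"
    by (simp only: sum_distrib_left)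
  also have "(\<Sum>i<p. \<Sum>k<p. \<Sum>j<p. of_bool (same_block C i j) * (E j k)\<^sup>2)
      = (\<Sum>k<p. \<Sum>j<p. \<Sum>i<p. of_bool (same_block C i j) * (E j k)\<^sup>2)" by (rule sum_swap3)
  also have "\<dots> = (\<Sum>k<p. \<Sum>j<p. (\<Sum>i<p. of_bool (same_block C j i)) * (E j k)\<^sup>2)"
    unfolding sum_distrib_right
  proof (intro sum.cong refl)
    fix i j k
    have "same_block C i j = same_block C j i" using same_block_sym by metis
    then show "of_bool (same_block C i j) * (E j k)\<^sup>2 = of_bool (same_block C j i) * (E j k)\<^sup>2" by simp
  qed
  also have "m / q\<^sup>2 * \<dots> \<le> m / q\<^sup>2 * (\<Sum>k<p. \<Sum>j<p. m * (t\<^sup>2 * of_bool (same_block B j k \<and> \<not> same_block C j k)))"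
  proof (cases "p = 0")
    case False
    then have m: "0 \<le> m" using m0 by simp
    show ?thesis
      by (intro mult_left_mono sum_mono mult_mono rows Eb) (use m q0 in auto)
  qed simp
  also have "(\<Sum>k<p. \<Sum>j<p. m * (t\<^sup>2 * of_bool (same_block B j k \<and> \<not> same_block C j k)))
    = m * t\<^sup>2 * (\<Sum>k<p. \<Sum>j<p. of_bool (same_block B j k \<and> \<not> same_block C j k))"
    by (simp only: sum_distrib_left mult.assoc)
  also have "(\<Sum>k<p. \<Sum>j<p. of_bool (same_block B j k \<and> \<not> same_block C j k))
    = (\<Sum>i<p. \<Sum>j<p. of_bool (same_block B i j \<and> \<not> same_block C i j) :: real)" by (rule sum.swap)
  also have "m / q\<^sup>2 * (m * t\<^sup>2 * \<dots>) = (m * t / q)\<^sup>2 * \<dots>"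
    by (simp add: power2_eq_square)
  finally have "trace (G * M * (G * M)) - 2 * trace (G * M) + real p
     \<le> (m * t / q)\<^sup>2 * (\<Sum>i<p. \<Sum>j<p. of_bool (same_block B i j \<and> \<not> same_block C i j))" .
  then have "(2 + 4 * ln (q1 / l)) * (trace (G * M * (G * M)) - 2 * trace (G * M) + real p)
     \<le> (2 + 4 * ln (q1 / l)) * ((m * t / q)\<^sup>2 * (\<Sum>i<p. \<Sum>j<p. of_bool (same_block B i j \<and> \<not> same_block C i j)))"
    by (rule mult_left_mono) (use l0 lq q1 in simp)
  then show ?thesis using main unfolding Q_def M_def by linarith
qed

text \<open>Sums against the symmetric matrix unit of the pair \<open>{i, j}\<close>.\<close>

lemma sum_pair_indicator:
  fixes f :: "nat \<Rightarrow> nat \<Rightarrow> real"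
  assumes "i < n" "j < n" "i \<noteq> j"
  shows "(\<Sum>k<n. \<Sum>l<n. f k l * of_bool ((k = i \<and> l = j) \<or> (k = j \<and> l = i))) = f i j + f j i"
proof -
  have "(\<Sum>k<n. \<Sum>l<n. f k l * of_bool ((k = i \<and> l = j) \<or> (k = j \<and> l = i)))
    = (\<Sum>k<n. \<Sum>l<n. (if l = j then (if k = i then f i j else 0) else 0) + (if l = i then (if k = j then f j i else 0) else 0))"
    using assms by (intro sum.cong refl) auto
  also have "\<dots> = f i j + f j i" using assms by (simp add: sum.distrib)
  finally show ?thesis .
qed

text \<open>Uses \<open>log_det_product_le\<close> with \<open>V = G - s (e\<^sub>i e\<^sub>j\<^sup>T +
  e\<^sub>j e\<^sub>i\<^sup>T)\<close>, where \<open>G\<close> is the inverse of \<open>Q =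
  S\<^sub>C\<close>. Towards \<open>M = S\<^sub>C'\<close>, which contains the entry \<open>e =
  S\<^sub>i\<^sub>j\<close>, the trace drops by \<open>2 s e\<close>; towards \<open>Q\<close>, which
  does not, the trace is unchanged and \<open>ln det V\<close> differs from \<open>ln det G\<close>
  only by order \<open>s\<^sup>2\<close>. Choosing \<open>s\<close> proportional to \<open>e\<close>
  leaves a gain of order \<open>e\<^sup>2\<close>.\<close>

lemma log_det_gain_of_merging:
  assumes C: "partition_on {..<p} C" and C': "partition_on {..<p} C'"
    and sub: "\<And>i j. i < p \<Longrightarrow> j < p \<Longrightarrow> same_block C i j \<Longrightarrow> same_block C' i j"
    and S: "coercive p l S"
    and le: "\<And>v. qform (restrict_blocks S C) v \<le> q1 * sqnorm p v" and q1: "0 < q1"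
    and ij: "i < p" "j < p" "same_block C' i j" "\<not> same_block C i j"
    and e5: "\<bar>S $$ (i, j)\<bar> \<le> 5 * q1"
  shows "ln (det (restrict_blocks S C')) \<le> ln (det (restrict_blocks S C)) - (S $$ (i, j))\<^sup>2 / (10 * q1\<^sup>2)"
proof -
  note Sc = coerciveD(1)[OF S] and l0 = coerciveD(3)[OF S]
  define Q where "Q = restrict_blocks S C"
  define M where "M = restrict_blocks S C'"
  define e where "e = S $$ (i, j)"
  (* The maximizer of 2 s e - 10 s^2 q1^2, which bounds the gain from below. *)
  define s where "s = e / (10 * q1\<^sup>2)"
  have Qc: "Q \<in> carrier_mat p p" and Mc: "M \<in> carrier_mat p p" using Sc by (auto simp: Q_def M_def)
  have Q: "coercive p l Q" unfolding Q_def by (rule coercive_restrict_blocks[OF C S])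
  have M: "coercive p l M" unfolding M_def by (rule coercive_restrict_blocks[OF C' S])
  have le: "\<And>v. qform Q v \<le> q1 * sqnorm p v" using assms(5) by (auto simp: Q_def)
  have nij: "i \<noteq> j" using ij same_block_refl[OF C] by auto
  obtain G where QG: "Q * G = 1\<^sub>m p" and GQ: "G * Q = 1\<^sub>m p" and cG: "coercive p (1 / q1) G"
    using coercive_inverse[OF Q le q1] by auto
  note Gc = coerciveD(1)[OF cG]
  have G0: "G $$ (i, j) = 0" if "i < p" "j < p" "\<not> same_block C i j" for i j
    using inverse_restrict_blocks[OF C Sc Gc _ _ that] QG GQ by (simp add: Q_def)
  have Mr: "restrict_blocks M C = Q" unfolding M_def Q_def by (rule restrict_blocks_restrict[OF Sc sub])
  have "trace (G * M) = trace (G * restrict_blocks M C)"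
    by (rule trace_inverse_restrict_blocks[OF C Mc Gc G0])
  then have trGM: "trace (G * M) = real p" by (simp add: Mr GQ trace_def)
  define P where "P k l \<longleftrightarrow> (k = i \<and> l = j) \<or> (k = j \<and> l = i)" for k l
  have Psym: "P k l = P l k" for k l by (auto simp: P_def)
  define V where "V = mat p p (\<lambda>(k, l). G $$ (k, l) - s * of_bool (P k l))"
  have Vc: "V \<in> carrier_mat p p" by (simp add: V_def)
  have Vi: "V $$ (k, l) = G $$ (k, l) - s * of_bool (P k l)" if "k < p" "l < p" for k l
    using that by (simp add: V_def)
  have Vs: "sym_mat V" unfolding sym_mat_def carrier_matD(1)[OF Vc]
    using sym_matD[OF coerciveD(2)[OF cG] Gc] by (simp add: Vi) (metis Psym)
  have qV: "qform V v = qform G v - 2 * s * (v i * v j)" for v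
  proof -
    have "qform V v = (\<Sum>k<p. \<Sum>l<p. G $$ (k, l) * v k * v l - s * (v k * v l * of_bool (P k l)))"
      unfolding qform_def carrier_matD(1)[OF Vc] by (intro sum.cong refl) (simp add: Vi algebra_simps)
    also have "\<dots> = qform G v - s * (\<Sum>k<p. \<Sum>l<p. v k * v l * of_bool (P k l))"
      unfolding qform_def carrier_matD(1)[OF Gc] sum_subtractf sum_distrib_left ..
    also have "(\<Sum>k<p. \<Sum>l<p. v k * v l * of_bool (P k l)) = v i * v j + v j * v i"
      unfolding P_def by (rule sum_pair_indicator[OF ij(1,2) nij])
    finally show ?thesis by simp
  qed
  have s2: "\<bar>s\<bar> \<le> 1 / (2 * q1)"
  proof -
    have "\<bar>s\<bar> = \<bar>e\<bar> / (10 * q1\<^sup>2)" by (simp add: s_def)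
    also have "\<dots> \<le> 5 * q1 / (10 * q1\<^sup>2)" by (rule divide_right_mono) (use e5 in \<open>simp_all add: e_def\<close>)
    also have "\<dots> = 1 / (2 * q1)" using q1 by (simp add: power2_eq_square)
    finally show ?thesis .
  qed
  (* V stays comparable to G, so the second order bound applies with the fixed constant 2 + 4 ln 2 <= 5. *)
  have half: "1 / 2 * qform G v \<le> qform V v" for v
  proof -
    have a: "(v i)\<^sup>2 + (v j)\<^sup>2 \<le> sqnorm p v"
    proof -
      have "(\<Sum>k\<in>{i, j}. (v k)\<^sup>2) \<le> (\<Sum>k<p. (v k)\<^sup>2)" by (rule sum_mono2) (use ij in auto)
      then show ?thesis using nij by (simp add: sqnorm_def)
    qed
    have "2 * s * (v i * v j) \<le> \<bar>s\<bar> * (2 * (\<bar>v i\<bar> * \<bar>v j\<bar>))"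
      using abs_ge_self[of "2 * s * (v i * v j)"] by (simp add: abs_mult mult.left_commute)
    also have "\<dots> \<le> \<bar>s\<bar> * sqnorm p v"
      using a sum_squares_bound[of "\<bar>v i\<bar>" "\<bar>v j\<bar>"] by (intro mult_left_mono) auto
    also have "\<dots> \<le> 1 / (2 * q1) * sqnorm p v" by (rule mult_right_mono[OF s2 sqnorm_nonneg])
    also have "\<dots> = 1 / 2 * (1 / q1 * sqnorm p v)" by simp
    also have "\<dots> \<le> 1 / 2 * qform G v" by (intro mult_left_mono coerciveD(4)[OF cG]) simp
    finally show ?thesis unfolding qV by simp
  qed
  have V: "coercive p (1 / 2 * (1 / q1)) V"
    unfolding coercive_def
  proof (intro conjI allI Vc Vs)
    fix v
    have "1 / 2 * (1 / q1 * sqnorm p v) \<le> 1 / 2 * qform G v" by (intro mult_left_mono coerciveD(4)[OF cG]) simp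
    then show "1 / 2 * (1 / q1) * sqnorm p v \<le> qform V v" using half[of v] by simp
  qed (use q1 in simp)
  have trp: "trace (V * R) = trace (G * R) - s * (R $$ (j, i) + R $$ (i, j))" if R: "R \<in> carrier_mat p p" for R
  proof -
    have "trace (V * R) = (\<Sum>k<p. \<Sum>l<p. G $$ (k, l) * R $$ (l, k) - s * (R $$ (l, k) * of_bool (P k l)))"
      unfolding trace_def using Vc
      by (simp add: times_mat_entry[OF Vc R] Vi algebra_simps del: index_mult_mat(1))
    also have "\<dots> = trace (G * R) - s * (\<Sum>k<p. \<Sum>l<p. R $$ (l, k) * of_bool (P k l))"
      unfolding trace_def sum_subtractf sum_distrib_left using Gc
      by (simp add: times_mat_entry[OF Gc R] del: index_mult_mat(1) sum_mult_of_bool_eq)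
    also have "(\<Sum>k<p. \<Sum>l<p. R $$ (l, k) * of_bool (P k l)) = R $$ (j, i) + R $$ (i, j)"
      unfolding P_def by (rule sum_pair_indicator[OF ij(1,2) nij])
    finally show ?thesis .
  qed
  have Mij: "M $$ (i, j) = e" "M $$ (j, i) = e"
    using ij same_block_sym[OF ij(3)] sym_matD[OF coerciveD(2)[OF S] Sc]
    by (simp_all add: M_def e_def restrict_blocks_index[OF Sc])
  have nji: "\<not> same_block C j i" using ij(4) same_block_sym by metis
  have Qij: "Q $$ (i, j) = 0" "Q $$ (j, i) = 0"
    using ij nji by (simp_all add: Q_def restrict_blocks_index[OF Sc])
  have up: "ln (det V) + ln (det M) \<le> - 2 * s * e"
    using log_det_product_le[OF V M] by (simp add: trp[OF Mc] trGM Mij)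
  have QV: "Q * V \<in> carrier_mat p p" using Qc Vc by simp
  have trQV: "trace (Q * V) = real p"
    unfolding trace_mult_comm[OF Qc Vc] by (simp add: trp[OF Qc] GQ Qij) (simp add: trace_def)
  define W where "W k l = Q $$ (k, i) * of_bool (l = j) + Q $$ (k, j) * of_bool (l = i)" for k l
  have QVi: "(Q * V) $$ (k, l) - of_bool (k = l) = - s * W k l" if kl: "k < p" "l < p" for k l
  proof -
    have "(Q * V) $$ (k, l) = (\<Sum>h<p. Q $$ (k, h) * G $$ (h, l) - s * (Q $$ (k, h) * of_bool (P h l)))"
      unfolding times_mat_entry[OF Qc Vc kl] using kl by (intro sum.cong) (auto simp: Vi algebra_simps)
    also have "\<dots> = (Q * G) $$ (k, l) - s * (\<Sum>h<p. Q $$ (k, h) * of_bool (P h l))"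
      unfolding times_mat_entry[OF Qc Gc kl] sum_subtractf sum_distrib_left ..
    also have "(\<Sum>h<p. Q $$ (k, h) * of_bool (P h l)) =
      (\<Sum>h<p. (if h = i then Q $$ (k, i) * of_bool (l = j) else 0) + (if h = j then Q $$ (k, j) * of_bool (l = i) else 0))"
      using nij by (intro sum.cong refl) (auto simp: P_def)
    also have "\<dots> = W k l" using ij by (simp add: W_def sum.distrib)
    finally show ?thesis using kl by (simp add: QG)
  qed
  have qd: "\<bar>Q $$ (k, k)\<bar> \<le> q1" if k: "k < p" for k
  proof -
    define u where "u h = (if h = k then 1 else 0 :: real)" for h
    have "qform Q u = (\<Sum>h<p. \<Sum>g<p. if g = k then (if h = k then Q $$ (k, k) else 0) else 0)"
      unfolding qform_def carrier_matD(1)[OF Qc] by (intro sum.cong refl) (auto simp: u_def)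
    then have "qform Q u = Q $$ (k, k)" using k by simp
    moreover have "sqnorm p u = (\<Sum>h<p. if h = k then 1 else 0)"
      unfolding sqnorm_def by (intro sum.cong refl) (auto simp: u_def)
    then have "sqnorm p u = 1" using k by simp
    ultimately show ?thesis using le[of u] coerciveD(4)[OF Q, of u] l0 by simp
  qed
  have "trace (Q * V * (Q * V)) - 2 * trace (Q * V) + real p = (\<Sum>k<p. \<Sum>l<p. s\<^sup>2 * (W k l * W l k))"
    unfolding trace_quadratic_excess[OF QV]
  proof (intro sum.cong refl)
    fix k l assume "k \<in> {..<p}" "l \<in> {..<p}"
    then have kl: "k < p" "l < p" by auto
    have e: "of_bool (k = l) = (of_bool (l = k) :: real)" by auto
    show "((Q * V) $$ (k, l) - of_bool (k = l)) * ((Q * V) $$ (l, k) - of_bool (k = l)) = s\<^sup>2 * (W k l * W l k)"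
      unfolding QVi[OF kl] unfolding e QVi[OF kl(2,1)] by (simp add: power2_eq_square)
  qed
  also have "\<dots> = s\<^sup>2 * (\<Sum>k<p. \<Sum>l<p. W k l * W l k)" by (simp only: sum_distrib_left)
  also have "(\<Sum>k<p. \<Sum>l<p. W k l * W l k)
    = (\<Sum>k<p. \<Sum>l<p. (Q $$ (i, i) * Q $$ (j, j)) * of_bool (P k l))"
    using nij Qij by (intro sum.cong refl) (auto simp: W_def P_def)
  also have "\<dots> = 2 * (Q $$ (i, i) * Q $$ (j, j))"
    unfolding P_def by (subst sum_pair_indicator[OF ij(1,2) nij]) simp
  finally have ex: "trace (Q * V * (Q * V)) - 2 * trace (Q * V) + real p = s\<^sup>2 * (2 * (Q $$ (i, i) * Q $$ (j, j)))" .
  have "ln (det Q * det G) = ln (det Q) + ln (det G)"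
    using coercive_det_pos[OF Q] coercive_det_pos[OF cG] by (simp add: ln_mult)
  then have "ln (det Q) + ln (det G) = 0" using det_mult[OF Qc Gc] QG by simp
  moreover have "- ((2 + 4 * ln 2) * (s\<^sup>2 * (2 * (Q $$ (i, i) * Q $$ (j, j))))) \<le> ln (det V) - ln (det G)"
    using log_det_product_ge[OF cG Qc GQ Vc Vs half] unfolding ex by (simp add: trQV)
  moreover have "(2 + 4 * ln 2) * (s\<^sup>2 * (2 * (Q $$ (i, i) * Q $$ (j, j)))) \<le> 5 * (s\<^sup>2 * (2 * q1\<^sup>2))"
  proof -
    have "Q $$ (i, i) * Q $$ (j, j) \<le> \<bar>Q $$ (i, i)\<bar> * \<bar>Q $$ (j, j)\<bar>" unfolding abs_mult[symmetric] by (rule abs_ge_self)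
    also have "\<dots> \<le> q1 * q1" by (intro mult_mono qd ij) (use q1 in auto)
    finally have "s\<^sup>2 * (2 * (Q $$ (i, i) * Q $$ (j, j))) \<le> s\<^sup>2 * (2 * q1\<^sup>2)"
      by (intro mult_left_mono) (auto simp: power2_eq_square)
    then have "(2 + 4 * ln 2) * (s\<^sup>2 * (2 * (Q $$ (i, i) * Q $$ (j, j)))) \<le> (2 + 4 * ln 2) * (s\<^sup>2 * (2 * q1\<^sup>2))"
      by (rule mult_left_mono) (simp add: add_nonneg_nonneg)
    also have "\<dots> \<le> 5 * (s\<^sup>2 * (2 * q1\<^sup>2))" using ln2_le_25_over_36 by (intro mult_right_mono) auto
    finally show ?thesis .
  qed
  ultimately have "ln (det M) \<le> ln (det Q) - 2 * s * e + 5 * (s\<^sup>2 * (2 * q1\<^sup>2))" using up by linarith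
  also have "\<dots> = ln (det Q) - e\<^sup>2 / (10 * q1\<^sup>2)"
    using q1 by (simp add: s_def power2_eq_square field_simps)
  finally show ?thesis by (simp add: Q_def M_def e_def)
qed

section \<open>The true partition is the unique minimizer\<close>

lemma row_count_le:
  assumes B: "partition_on {..<p} B" and m: "\<And>D. D \<in> B \<Longrightarrow> card D \<le> m" and i: "i < p"
  shows "card {j. same_block B i j} \<le> m"
proof -
  obtain D where D: "D \<in> B" "i \<in> D" using partition_covers[OF B i] by metis
  have "card D \<le> m" by (rule m[OF D(1)])
  then show ?thesis unfolding block_eq_same_block[OF B D] .
qed

lemma finite_same_block: "partition_on {..<p} B \<Longrightarrow> finite {j. same_block B i j}"
  by (rule finite_subset[of _ "{..<p}"]) (auto dest: same_block_less)

lemma sum_same_block: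
  assumes "partition_on {..<p} B"
  shows "(\<Sum>j<p. of_bool (same_block B i j)) = real (card {j. same_block B i j})"
proof -
  have "{..<p} \<inter> {j. same_block B i j} = {j. same_block B i j}"
    using same_block_less[OF assms] by auto
  then show ?thesis by (simp add: sum_of_bool_eq)
qed

text \<open>Blocks of size at most \<open>m\<close> turn an entrywise error \<open>t\<close> into an error
  \<open>m t\<close> of the form, independently of the dimension.\<close>

lemma qform_block_perturbation:
  assumes C: "partition_on {..<p} C" and A: "A \<in> carrier_mat p p" and S: "S \<in> carrier_mat p p"
    and close: "\<And>i j. i < p \<Longrightarrow> j < p \<Longrightarrow> \<bar>S $$ (i, j) - A $$ (i, j)\<bar> \<le> t"
    and rows: "\<And>i. i < p \<Longrightarrow> (\<Sum>j<p. of_bool (same_block C i j)) \<le> m" and t: "0 \<le> t"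
  shows "\<bar>qform (restrict_blocks S C) v - qform (restrict_blocks A C) v\<bar> \<le> m * t * sqnorm p v"
proof -
  have c: "restrict_blocks S C \<in> carrier_mat p p" "restrict_blocks A C \<in> carrier_mat p p" using S A by auto
  have "qform (restrict_blocks S C) v - qform (restrict_blocks A C) v
    = (\<Sum>i<p. \<Sum>j<p. of_bool (same_block C i j) * (S $$ (i, j) - A $$ (i, j)) * v i * v j)"
    unfolding qform_def carrier_matD(1)[OF c(1)] carrier_matD(1)[OF c(2)] sum_subtractf[symmetric]
    by (intro sum.cong refl) (auto simp: restrict_blocks_index[OF S] restrict_blocks_index[OF A] algebra_simps)
  also have "\<bar>\<dots>\<bar> \<le> (\<Sum>i<p. \<bar>\<Sum>j<p. of_bool (same_block C i j) * (S $$ (i, j) - A $$ (i, j)) * v i * v j\<bar>)"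
    by (rule sum_abs)
  also have "\<dots> \<le> (\<Sum>i<p. \<Sum>j<p. \<bar>of_bool (same_block C i j) * (S $$ (i, j) - A $$ (i, j)) * v i * v j\<bar>)"
    by (intro sum_mono sum_abs)
  also have "\<dots> \<le> (\<Sum>i<p. \<Sum>j<p. t / 2 * (of_bool (same_block C i j) * (v i)\<^sup>2 + of_bool (same_block C i j) * (v j)\<^sup>2))"
  proof (intro sum_mono)
    fix i j assume "i \<in> {..<p}" "j \<in> {..<p}"
    then have ij: "i < p" "j < p" by auto
    show "\<bar>of_bool (same_block C i j) * (S $$ (i, j) - A $$ (i, j)) * v i * v j\<bar>
      \<le> t / 2 * (of_bool (same_block C i j) * (v i)\<^sup>2 + of_bool (same_block C i j) * (v j)\<^sup>2)"
    proof (cases "same_block C i j")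
      case True
      have "\<bar>S $$ (i, j) - A $$ (i, j)\<bar> * (\<bar>v i\<bar> * \<bar>v j\<bar>) \<le> t * (((v i)\<^sup>2 + (v j)\<^sup>2) / 2)"
        using sum_squares_bound[of "\<bar>v i\<bar>" "\<bar>v j\<bar>"] t by (intro mult_mono close ij) auto
      then show ?thesis using True by (simp add: abs_mult mult.assoc)
    qed simp
  qed
  also have "\<dots> = t / 2 * ((\<Sum>i<p. \<Sum>j<p. of_bool (same_block C i j) * (v i)\<^sup>2) + (\<Sum>i<p. \<Sum>j<p. of_bool (same_block C i j) * (v j)\<^sup>2))"
    by (simp only: sum.distrib sum_distrib_left[symmetric])
  also have "(\<Sum>i<p. \<Sum>j<p. of_bool (same_block C i j) * (v j)\<^sup>2) = (\<Sum>j<p. \<Sum>i<p. of_bool (same_block C i j) * (v j)\<^sup>2)"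
    by (rule sum.swap)
  also have "\<dots> = (\<Sum>i<p. \<Sum>j<p. of_bool (same_block C i j) * (v i)\<^sup>2)"
  proof (intro sum.cong refl)
    fix i j
    have "same_block C i j = same_block C j i" using same_block_sym by metis
    then show "of_bool (same_block C i j) * (v j)\<^sup>2 = of_bool (same_block C j i) * (v j)\<^sup>2" by simp
  qed
  also have "(\<Sum>i<p. \<Sum>j<p. of_bool (same_block C i j) * (v i)\<^sup>2) = (\<Sum>i<p. (\<Sum>j<p. of_bool (same_block C i j)) * (v i)\<^sup>2)"
    by (simp only: sum_distrib_right)
  also have "t / 2 * (\<dots> + \<dots>) = t * \<dots>" by simp
  also have "\<dots> \<le> t * (\<Sum>i<p. m * (v i)\<^sup>2)"
    using t by (intro mult_left_mono sum_mono mult_right_mono rows) auto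
  also have "\<dots> = m * t * sqnorm p v" by (simp add: sqnorm_def sum_distrib_left mult_ac)
  finally show ?thesis .
qed

text \<open>The deterministic core. It suffices to improve every partition other than \<open>Bs\<close>
  strictly, since a minimizer exists among the finitely many partitions. In the application
  \<open>t\<close> is the entrywise error of \<open>S\<close>, \<open>2 b\<close> the separation,
  \<open>l\<close> a very weak lower bound for the spectrum of \<open>S\<close>, and \<open>\<beta> =
  n\<^sup>-\<^sup>\<delta>\<close>.\<close>

theorem true_partition_is_unique_minimizer:
  fixes S \<Sigma> :: "real mat" and m :: nat and t b l lam Lam \<beta> :: real
  assumes p: "0 < p" and Bs: "partition_on {..<p} Bs" and size: "\<And>D. D \<in> Bs \<Longrightarrow> card D \<le> m"
    and Sig: "coercive p lam \<Sigma>" and Sig_le: "\<And>v. qform \<Sigma> v \<le> Lam * sqnorm p v"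
    and Sig0: "\<And>i j. i < p \<Longrightarrow> j < p \<Longrightarrow> \<not> same_block Bs i j \<Longrightarrow> \<Sigma> $$ (i, j) = 0"
    and Sig_max: "\<And>i j. i < p \<Longrightarrow> j < p \<Longrightarrow> \<bar>\<Sigma> $$ (i, j)\<bar> \<le> 2 * Lam"
    and sep: "\<And>B. finer_than p B Bs \<Longrightarrow> \<exists>i<p. \<exists>j<p. \<not> same_block B i j \<and> same_block Bs i j \<and> 2 * b \<le> \<bar>\<Sigma> $$ (i, j)\<bar>"
    and S: "coercive p l S"
    and nz: "\<And>i j. i < p \<Longrightarrow> j < p \<Longrightarrow> i \<noteq> j \<Longrightarrow> S $$ (i, j) \<noteq> 0"
    and close: "\<And>i j. i < p \<Longrightarrow> j < p \<Longrightarrow> \<bar>S $$ (i, j) - \<Sigma> $$ (i, j)\<bar> \<le> t"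
    and lL: "lam \<le> Lam" and lam1: "l \<le> 2 * Lam" and mt: "real m * t \<le> lam / 2" and m: "1 \<le> m" and tb: "t \<le> b" and b: "0 < b"
    and small_split: "(2 + 4 * ln (2 * Lam / l)) * (real m * t / (lam / 2))\<^sup>2 < \<beta>"
    and small_merge: "\<beta> * (real m)\<^sup>2 < b\<^sup>2 / (10 * (2 * Lam)\<^sup>2)"
  shows "B_tot (\<beta> / real p) S = {Bs}"
proof -
  note Sc = coerciveD(1)[OF S] and l0 = coerciveD(3)[OF S]
  note Gc = coerciveD(1)[OF Sig] and lam0 = coerciveD(3)[OF Sig]
  have t0: "0 \<le> t" using close[OF p p] by (meson abs_ge_zero order_trans)
  have Lam0: "0 < Lam" using lam0 lL by simp
  have tl: "t \<le> lam / 2"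
  proof -
    have "1 * t \<le> real m * t" using m t0 by (intro mult_right_mono) auto
    then show ?thesis using mt by simp
  qed
  define pen where "pen B = (\<Sum>i<p. \<Sum>j<p. of_bool (same_block B i j) :: real)" for B
  define F where "F B = ln (det (restrict_blocks S B)) + \<beta> * pen B" for B
  have PsiF: "Psi (\<beta> / real p) S B = (F B + real p) / real p" if "partition_on {..<p} B" for B
  proof -
    have "Psi (\<beta> / real p) S B = (ln (det (restrict_blocks S B)) + real p) / real p + \<beta> / real p * pen B"
      unfolding pen_def by (rule Psi_eq[OF p that S nz])
    then show ?thesis using p by (simp add: F_def add_divide_distrib)
  qed
  have rows: "(\<Sum>j<p. of_bool (same_block C i j)) \<le> real m"
    if C: "partition_on {..<p} C" and sub: "\<forall>i j. same_block C i j \<longrightarrow> same_block Bs i j" and i: "i < p" for C i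
  proof -
    have "card {j. same_block C i j} \<le> card {j. same_block Bs i j}"
      by (rule card_mono[OF finite_same_block[OF Bs]]) (use sub in auto)
    also have "\<dots> \<le> m" by (rule row_count_le[OF Bs size i])
    finally show ?thesis by (simp add: sum_same_block[OF C])
  qed
  have form_C: "lam / 2 * sqnorm p v \<le> qform (restrict_blocks S C) v"
      "qform (restrict_blocks S C) v \<le> 2 * Lam * sqnorm p v"
    if C: "partition_on {..<p} C" and sub: "\<forall>i j. same_block C i j \<longrightarrow> same_block Bs i j" for C v
  proof -
    have d: "\<bar>qform (restrict_blocks S C) v - qform (restrict_blocks \<Sigma> C) v\<bar> \<le> real m * t * sqnorm p v"
      by (intro qform_block_perturbation[OF C Gc Sc _ _ t0] close rows[OF C sub])
    also have "\<dots> \<le> lam / 2 * sqnorm p v" by (rule mult_right_mono[OF mt sqnorm_nonneg])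
    finally have d: "\<bar>qform (restrict_blocks S C) v - qform (restrict_blocks \<Sigma> C) v\<bar> \<le> lam / 2 * sqnorm p v" .
    have lo: "lam * sqnorm p v \<le> qform (restrict_blocks \<Sigma> C) v"
      by (rule coerciveD(4)[OF coercive_restrict_blocks[OF C Sig]])
    have hi: "qform (restrict_blocks \<Sigma> C) v \<le> Lam * sqnorm p v"
      by (rule qform_restrict_blocks_le[OF C Gc Sig_le])
    have "lam * sqnorm p v \<le> Lam * sqnorm p v" "0 \<le> lam * sqnorm p v"
      using lL lam0 sqnorm_nonneg by (auto intro: mult_right_mono)
    then show "lam / 2 * sqnorm p v \<le> qform (restrict_blocks S C) v"
      "qform (restrict_blocks S C) v \<le> 2 * Lam * sqnorm p v"
      using d lo hi by (auto simp only: abs_le_iff)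
  qed
  have improve: "\<exists>C. partition_on {..<p} C \<and> F C < F B" if B: "partition_on {..<p} B" and ne: "B \<noteq> Bs" for B
  proof (cases "\<forall>i j. same_block B i j \<longrightarrow> same_block Bs i j")
    case False
    define R where "R i j \<longleftrightarrow> same_block B i j \<and> same_block Bs i j" for i j
    have "\<exists>C. partition_on {..<p} C \<and> (\<forall>i j. same_block C i j \<longleftrightarrow> i < p \<and> j < p \<and> R i j)"
    proof (rule partition_of_equivalence)
      show "R i i" if "i < p" for i using same_block_refl[OF B that] same_block_refl[OF Bs that] by (simp add: R_def)
      show "R j i" if "R i j" for i j using that same_block_sym by (simp add: R_def)
      show "R i k" if "R i j" "R j k" for i j k
        using that same_block_trans[OF B] same_block_trans[OF Bs] unfolding R_def by metis
    qed
    then obtain C where C: "partition_on {..<p} C" and sC: "\<And>i j. same_block C i j \<longleftrightarrow> i < p \<and> j < p \<and> R i j" by auto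
    have sub: "\<forall>i j. same_block C i j \<longrightarrow> same_block Bs i j" by (simp add: sC R_def)
    have subB: "same_block C i j \<Longrightarrow> same_block B i j" for i j by (simp add: sC R_def)
    define N where "N = (\<Sum>i<p. \<Sum>j<p. of_bool (same_block B i j \<and> \<not> same_block C i j) :: real)"
    have cQ: "coercive p (lam / 2) (restrict_blocks S C)"
      using coerciveD(2)[OF coercive_restrict_blocks[OF C S]] Sc form_C(1)[OF C sub] lam0
      by (simp add: coercive_def)
    have "ln (det (restrict_blocks S C)) - ln (det (restrict_blocks S B))
      \<le> (2 + 4 * ln (2 * Lam / l)) * ((real m * t / (lam / 2))\<^sup>2 * N)"
      unfolding N_def
    proof (rule log_det_cost_of_coarsening[OF C B _ S cQ form_C(2)[OF C sub] lam1])
      show "\<bar>S $$ (i, j)\<bar> \<le> t" if "i < p" "j < p" "same_block B i j" "\<not> same_block C i j" for i j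
        using close[OF that(1,2)] Sig0[OF that(1,2)] that by (simp add: sC R_def)
    qed (use subB rows[OF C sub] in auto)
    also have "\<dots> = ((2 + 4 * ln (2 * Lam / l)) * (real m * t / (lam / 2))\<^sup>2) * N" by simp
    also have "\<dots> < \<beta> * N"
    proof (rule mult_strict_right_mono[OF small_split])
      obtain i j where ij: "same_block B i j" "\<not> same_block Bs i j" using False by auto
      then have l: "i < p" "j < p" using same_block_less[OF B] by auto
      have "0 < (\<Sum>j<p. of_bool (same_block B i j \<and> \<not> same_block C i j) :: real)"
        by (rule sum_pos2[of _ j]) (use ij l sub in auto)
      then show "0 < N" unfolding N_def by (rule sum_pos2[of _ i, rotated 2]) (use l in \<open>auto intro: sum_nonneg\<close>)
    qed
    also have "N = pen B - pen C"
      unfolding N_def pen_def sum_subtractf[symmetric] by (intro sum.cong refl) (use subB in auto)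
    finally have "F C < F B" by (simp add: F_def algebra_simps)
    then show ?thesis using C by auto
  next
    case True
    have "refines {..<p} B Bs" by (rule refinesI_same_block[OF B Bs]) (use True in auto)
    then have "finer_than p B Bs" using ne by (simp add: finer_than_def)
    then obtain i j where ij: "i < p" "j < p" "\<not> same_block B i j" "same_block Bs i j" "2 * b \<le> \<bar>\<Sigma> $$ (i, j)\<bar>"
      using sep by blast
    (* Both blocks lie in one block of Bs, so at most m^2 pairs are added. *)
    define U where "U = {k. same_block B i k} \<union> {k. same_block B j k}"
    have UB: "same_block Bs i k" if "k \<in> U" for k
      using that True same_block_trans[OF Bs ij(4)] unfolding U_def by blast
    have Ucl: "l \<in> U" if "k \<in> U" "same_block B k l" for k l
      using that same_block_trans[OF B] unfolding U_def by blast
    define R where "R k l \<longleftrightarrow> same_block B k l \<or> (k \<in> U \<and> l \<in> U)" for k l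
    have "\<exists>C. partition_on {..<p} C \<and> (\<forall>i j. same_block C i j \<longleftrightarrow> i < p \<and> j < p \<and> R i j)"
    proof (rule partition_of_equivalence)
      show "R i i" if "i < p" for i using same_block_refl[OF B that] by (simp add: R_def)
      show "R j i" if "R i j" for i j using that same_block_sym by (auto simp: R_def)
      show "R i k" if "R i j" "R j k" for i j k
        using that same_block_trans[OF B] Ucl same_block_sym unfolding R_def by metis
    qed
    then obtain C where C: "partition_on {..<p} C" and sC: "\<And>i j. same_block C i j \<longleftrightarrow> i < p \<and> j < p \<and> R i j" by auto
    define e where "e = \<bar>S $$ (i, j)\<bar>"
    have cl: "\<bar>S $$ (i, j) - \<Sigma> $$ (i, j)\<bar> \<le> t" by (rule close[OF ij(1,2)])
    have e1: "b \<le> e" using cl ij(5) tb unfolding e_def by linarith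
    have e2: "e \<le> 5 * (2 * Lam)" using cl Sig_max[OF ij(1,2)] tl lL Lam0 unfolding e_def by linarith
    have "ln (det (restrict_blocks S C)) \<le> ln (det (restrict_blocks S B)) - (S $$ (i, j))\<^sup>2 / (10 * (2 * Lam)\<^sup>2)"
    proof (rule log_det_gain_of_merging[OF B C _ S form_C(2)[OF B True]])
      have "i \<in> U" "j \<in> U" using same_block_refl[OF B] ij by (auto simp: U_def)
      then show "same_block C i j" using ij by (simp add: sC R_def)
      show "\<bar>S $$ (i, j)\<bar> \<le> 5 * (2 * Lam)" using e2 by (simp add: e_def)
    qed (use ij True Lam0 in \<open>auto simp: sC R_def\<close>)
    moreover have "b\<^sup>2 / (10 * (2 * Lam)\<^sup>2) \<le> (S $$ (i, j))\<^sup>2 / (10 * (2 * Lam)\<^sup>2)"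
    proof (rule divide_right_mono)
      have "b\<^sup>2 \<le> e\<^sup>2" using e1 b by (intro power_mono) auto
      then show "b\<^sup>2 \<le> (S $$ (i, j))\<^sup>2" by (simp add: e_def)
    qed simp
    moreover have "pen C - pen B \<le> (real m)\<^sup>2"
    proof -
      have "card U \<le> card {k. same_block Bs i k}"
        by (rule card_mono[OF finite_same_block[OF Bs]]) (use UB in auto)
      also have "\<dots> \<le> m" by (rule row_count_le[OF Bs size ij(1)])
      finally have cU: "card U \<le> m" .
      have Up: "U \<subseteq> {..<p}" using same_block_less[OF B] unfolding U_def by auto
      have "pen C - pen B \<le> (\<Sum>k<p. \<Sum>l<p. of_bool (k \<in> U) * of_bool (l \<in> U))"
        unfolding pen_def sum_subtractf[symmetric] by (intro sum_mono) (auto simp: sC R_def)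
      also have "\<dots> = (\<Sum>k<p. of_bool (k \<in> U)) * (\<Sum>l<p. of_bool (l \<in> U))" by (simp only: sum_product)
      also have "\<dots> = (real (card U))\<^sup>2"
      proof -
        have "{..<p} \<inter> {x. x \<in> U} = U" using Up by auto
        then show ?thesis by (simp add: sum_of_bool_eq power2_eq_square)
      qed
      also have "\<dots> \<le> (real m)\<^sup>2" using cU by (intro power_mono) auto
      finally show ?thesis .
    qed
    moreover have b0: "0 \<le> \<beta>"
    proof -
      have "0 \<le> (2 + 4 * ln (2 * Lam / l)) * (real m * t / (lam / 2))\<^sup>2" using l0 lam1 by (intro mult_nonneg_nonneg) auto
      then show ?thesis using small_split by simp
    qed
    ultimately have "\<beta> * (pen C - pen B) \<le> \<beta> * (real m)\<^sup>2" by (intro mult_left_mono)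
    then have "F C < F B"
      using small_merge \<open>ln (det (restrict_blocks S C)) \<le> _\<close> \<open>b\<^sup>2 / (10 * (2 * Lam)\<^sup>2) \<le> _\<close>
      by (simp add: F_def right_diff_distrib)
    then show ?thesis using C by auto
  qed
  define Ps where "Ps = {B. partition_on {..<p} B}"
  have fin: "finite Ps" unfolding Ps_def by (rule finitely_many_partition_on) simp
  have argmin: "\<exists>B\<in>Ps. \<forall>C\<in>Ps. F B \<le> F C"
    using ex_min_if_finite[of "F ` Ps"] fin Bs unfolding Ps_def by (auto simp: not_less)
  then obtain B0 where B0: "B0 \<in> Ps" "\<And>C. C \<in> Ps \<Longrightarrow> F B0 \<le> F C" by auto
  have B0s: "B0 = Bs"
  proof (rule ccontr)
    assume "B0 \<noteq> Bs"
    then obtain C where "partition_on {..<p} C" "F C < F B0" using improve[of B0] B0(1) by (auto simp: Ps_def)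
    then show False using B0(2)[of C] by (simp add: Ps_def)
  qed
  have lt: "F Bs < F B" if B: "partition_on {..<p} B" "B \<noteq> Bs" for B
  proof -
    obtain C where "partition_on {..<p} C" "F C < F B" using improve[OF B] by auto
    then show ?thesis using B0(2)[of C] by (simp add: Ps_def B0s)
  qed
  have Psi_less: "Psi (\<beta> / real p) S B < Psi (\<beta> / real p) S C \<longleftrightarrow> F B < F C"
    if "partition_on {..<p} B" "partition_on {..<p} C" for B C
    using p that by (simp add: PsiF divide_less_cancel)
  show ?thesis
    unfolding B_tot_def is_arg_min_def carrier_matD(1)[OF Sc]
  proof (intro subset_antisym subsetI)
    fix B assume "B \<in> {B. partition_on {..<p} B \<and> (\<nexists>C. partition_on {..<p} C \<and> Psi (\<beta> / real p) S C < Psi (\<beta> / real p) S B)}"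
    then show "B \<in> {Bs}" using lt[of B] Psi_less[OF Bs] Bs by auto
  next
    fix B assume "B \<in> {Bs}"
    then show "B \<in> {B. partition_on {..<p} B \<and> (\<nexists>C. partition_on {..<p} C \<and> Psi (\<beta> / real p) S C < Psi (\<beta> / real p) S B)}"
      using Bs Psi_less lt by (auto, metis less_asym)
  qed
qed

section \<open>Spectral bounds for quadratic forms\<close>

lemma sqnorm_mv_le:
  assumes A: "A \<in> carrier_mat n n"
  shows "sqnorm n (mv A u) \<le> (\<Sum>i<n. \<Sum>j<n. (A $$ (i, j))\<^sup>2) * sqnorm n u"
proof -
  have "(mv A u i)\<^sup>2 \<le> (\<Sum>j<n. (A $$ (i, j))\<^sup>2) * sqnorm n u" for i
    unfolding mv_def carrier_matD(1)[OF A] sqnorm_def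
    using Cauchy_Schwarz_ineq_sum[of "\<lambda>j. A $$ (i, j)" u "{..<n}"] .
  then have "sqnorm n (mv A u) \<le> (\<Sum>i<n. (\<Sum>j<n. (A $$ (i, j))\<^sup>2) * sqnorm n u)"
    unfolding sqnorm_def[of n "mv A u"] by (intro sum_mono)
  then show ?thesis by (simp add: sum_distrib_right)
qed

text \<open>Positivity of the form at \<open>v - R v / C\<close> bounds \<open>|R v|\<^sup>2\<close> by a
  multiple of the form, and invertibility bounds \<open>|v|\<close> by a multiple of \<open>|R
  v|\<close>.\<close>

lemma invertible_psd_coercive:
  assumes R: "R \<in> carrier_mat n n" and sym: "sym_mat R" and psd: "\<And>v. 0 \<le> qform R v"
    and d: "det R \<noteq> 0"
  shows "\<exists>c>0. coercive n c R"
proof -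
  obtain C where C: "0 < C" "\<And>v. qform R v \<le> C * sqnorm n v"
    using qform_le_exists[of R] R by auto
  define G where "G = (1 / det R) \<cdot>\<^sub>m adj_mat R"
  note G = adjugate_inverse[OF R d, folded G_def]
  note Gc = G(1) and GR = G(3)
  define K where "K = (\<Sum>i<n. \<Sum>j<n. (G $$ (i, j))\<^sup>2) + 1"
  have K: "0 < K" unfolding K_def by (intro add_nonneg_pos sum_nonneg) auto
  have "1 / (C * K) * sqnorm n v \<le> qform R v" for v
  proof -
    have "0 \<le> qform R (\<lambda>i. v i - 1 / C * mv R v i)" by (rule psd)
    also have "\<dots> = qform R v - 2 * (1 / C) * (\<Sum>i<n. mv R v i * mv R v i) + (1 / C)\<^sup>2 * qform R (mv R v)"
      by (rule qform_diff[OF R sym])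
    also have "\<dots> \<le> qform R v - 2 * (1 / C) * sqnorm n (mv R v) + (1 / C)\<^sup>2 * (C * sqnorm n (mv R v))"
      using mult_left_mono[OF C(2)[of "mv R v"], of "(1 / C)\<^sup>2"]
      by (simp add: sqnorm_def power2_eq_square[of "mv R v _"])
    also have "\<dots> = qform R v - 1 / C * sqnorm n (mv R v)" using C by (simp add: power2_eq_square field_simps)
    finally have a: "1 / C * sqnorm n (mv R v) \<le> qform R v" by simp
    have "sqnorm n v = sqnorm n (mv G (mv R v))"
      unfolding sqnorm_def by (intro sum.cong) (simp_all add: mv_mult[OF Gc R GR])
    also have "\<dots> \<le> (\<Sum>i<n. \<Sum>j<n. (G $$ (i, j))\<^sup>2) * sqnorm n (mv R v)" by (rule sqnorm_mv_le[OF Gc])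
    also have "\<dots> \<le> K * sqnorm n (mv R v)"
      unfolding K_def by (intro mult_right_mono sqnorm_nonneg) simp
    finally have "1 / (C * K) * sqnorm n v \<le> 1 / (C * K) * (K * sqnorm n (mv R v))"
      using C K by (intro mult_left_mono) auto
    also have "\<dots> = 1 / C * sqnorm n (mv R v)" using K by simp
    finally show ?thesis using a by linarith
  qed
  then show ?thesis using R sym C K by (intro exI[of _ "1 / (C * K)"]) (simp add: coercive_def)
qed

lemma qform_char_matrix:
  assumes A: "A \<in> carrier_mat n n"
  shows "qform (char_matrix A s) v = qform A v - s * sqnorm n v"
proof -
  have c: "char_matrix A s \<in> carrier_mat n n" using A by simp
  have "qform (char_matrix A s) v = (\<Sum>i<n. \<Sum>j<n. A $$ (i, j) * v i * v j - (if j = i then s * (v i)\<^sup>2 else 0))"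
    unfolding qform_def carrier_matD(1)[OF c] using A
    by (intro sum.cong refl) (auto simp: char_matrix_def algebra_simps power2_eq_square)
  then show ?thesis using A by (simp add: qform_def sqnorm_def sum_subtractf sum_distrib_left)
qed

text \<open>The largest \<open>s\<close> with \<open>A - s \<ge> 0\<close> is an eigenvalue: otherwise \<open>A
  - s\<close> would be invertible, hence coercive, and \<open>s\<close> could be increased. Thus the
  variational characterization of the smallest eigenvalue holds without diagonalizing
  \<open>A\<close>.\<close>

lemma eigenvalues_bound_qform:
  assumes A: "A \<in> carrier_mat n n" and sym: "sym_mat A" and n: "0 < n"
    and ev: "\<And>k. eigenvalue A k \<Longrightarrow> lam \<le> k"
  shows "lam * sqnorm n v \<le> qform A v"
proof -
  define T where "T = {s. \<forall>v. s * sqnorm n v \<le> qform A v}"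
  define e where "e i = (if i = 0 then 1 else 0 :: real)" for i :: nat
  have "sqnorm n e = (\<Sum>i<n. if i = 0 then 1 else 0)"
    unfolding sqnorm_def by (intro sum.cong refl) (auto simp: e_def)
  then have e1: "sqnorm n e = 1" using n by simp
  have ub: "s \<le> qform A e" if "s \<in> T" for s
    using that e1 by (auto simp: T_def dest: spec[of _ e])
  obtain C where C: "\<And>v. qform (- A) v \<le> C * sqnorm n v"
    using qform_le_exists[of "- A"] A by auto
  have neg: "qform (- A) v = - qform A v" for v
    using A by (simp add: qform_def sum_negf)
  have "- C \<in> T" unfolding T_def using C neg by (auto simp: minus_le_iff)
  then have ne: "T \<noteq> {}" by auto
  have bdd: "bdd_above T" using ub by (auto simp: bdd_above_def)
  define s where "s = Sup T"
  have sT: "s \<in> T"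
    unfolding T_def
  proof (intro CollectI allI)
    fix v
    show "s * sqnorm n v \<le> qform A v"
    proof (cases "sqnorm n v = 0")
      case True
      then show ?thesis using \<open>- C \<in> T\<close> by (auto simp: T_def dest: spec[of _ v])
    next
      case False
      then have p: "0 < sqnorm n v" using sqnorm_nonneg[of n v] by simp
      have "s \<le> qform A v / sqnorm n v"
        unfolding s_def by (rule cSup_least[OF ne]) (use p in \<open>auto simp: T_def pos_le_divide_eq\<close>)
      then show ?thesis using p by (simp add: pos_le_divide_eq)
    qed
  qed
  have "eigenvalue A s"
  proof (rule ccontr)
    assume "\<not> eigenvalue A s"
    then have d: "det (char_matrix A s) \<noteq> 0" by (simp add: eigenvalue_det[OF A])
    have c: "char_matrix A s \<in> carrier_mat n n" using A by simp
    have sy: "sym_mat (char_matrix A s)"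
      unfolding sym_mat_def carrier_matD(1)[OF c] using sym_matD[OF sym A] A by (auto simp: char_matrix_def)
    have "0 \<le> qform (char_matrix A s) v" for v
      using sT by (simp add: qform_char_matrix[OF A] T_def)
    then obtain c where "0 < c" "coercive n c (char_matrix A s)"
      using invertible_psd_coercive[OF c sy _ d] by auto
    then have "s + c \<in> T"
      using coerciveD(4) unfolding T_def by (fastforce simp: qform_char_matrix[OF A] algebra_simps)
    then have "s + c \<le> s" unfolding s_def by (rule cSup_upper[OF _ bdd])
    then show False using \<open>0 < c\<close> by simp
  qed
  then have "lam * sqnorm n v \<le> s * sqnorm n v" by (intro mult_right_mono ev sqnorm_nonneg)
  also have "\<dots> \<le> qform A v" using sT by (simp add: T_def)
  finally show ?thesis .
qed

lemma eigenvalue_uminus: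
  assumes A: "(A :: real mat) \<in> carrier_mat n n" and k: "eigenvalue (- A) k"
  shows "eigenvalue A (- k)"
proof -
  obtain v where v: "v \<in> carrier_vec n" "v \<noteq> 0\<^sub>v n" "- A *\<^sub>v v = k \<cdot>\<^sub>v v"
    using k A by (auto simp: eigenvalue_def eigenvector_def)
  have "A *\<^sub>v v = - k \<cdot>\<^sub>v v"
  proof (rule eq_vecI)
    fix i assume "i < dim_vec (- k \<cdot>\<^sub>v v)"
    then have i: "i < n" using v by simp
    have "- (A *\<^sub>v v) = k \<cdot>\<^sub>v v" using v A by simp
    then have "(- (A *\<^sub>v v)) $ i = (k \<cdot>\<^sub>v v) $ i" by simp
    then have "- ((A *\<^sub>v v) $ i) = k * v $ i" using A v i by (simp del: index_mult_mat_vec)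
    then show "(A *\<^sub>v v) $ i = (- k \<cdot>\<^sub>v v) $ i" using v i by (simp del: index_mult_mat_vec)
  qed (use A v in auto)
  then show ?thesis using v A by (auto simp: eigenvalue_def eigenvector_def intro!: exI[of _ v])
qed

text \<open>The upper bound is the lower bound for \<open>- A\<close>.\<close>

lemma spectrum_coercive:
  assumes A: "A \<in> carrier_mat n n" and pd: "sym_pos_def A" and n: "0 < n"
    and ev: "\<And>k. eigenvalue A k \<Longrightarrow> lam \<le> k \<and> k \<le> Lam" and lam: "0 < lam"
  shows "coercive n lam A" and "qform A v \<le> Lam * sqnorm n v"
proof -
  have "transpose_mat A = A" using pd by (simp add: sym_pos_def_def)
  then have sym: "sym_mat A" unfolding sym_mat_def using A by (metis carrier_matD index_transpose_mat(1))
  show "coercive n lam A"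
    using eigenvalues_bound_qform[OF A sym n] ev A sym lam by (auto simp: coercive_def)
  have mA: "- A \<in> carrier_mat n n" and ms: "sym_mat (- A)"
    using A sym by (auto simp: sym_mat_def)
  have "- Lam * sqnorm n v \<le> qform (- A) v"
    by (rule eigenvalues_bound_qform[OF mA ms n]) (use eigenvalue_uminus[OF A] ev in force)
  moreover have "qform (- A) v = - qform A v"
    using A by (simp add: qform_def sum_negf)
  ultimately show "qform A v \<le> Lam * sqnorm n v" by simp
qed

section \<open>Linear forms of a multivariate normal vector\<close>

context prob_space
begin

lemma exp_abs_integrable:
  fixes W :: "'a \<Rightarrow> real"
  assumes [measurable]: "W \<in> borel_measurable M" and int: "\<And>s. integrable M (\<lambda>\<omega>. exp (s * W \<omega>))"
  shows "integrable M (\<lambda>\<omega>. exp (r * \<bar>W \<omega>\<bar>))"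
proof (rule Bochner_Integration.integrable_bound)
  show "integrable M (\<lambda>\<omega>. exp (r * W \<omega>) + exp (- r * W \<omega>))"
    by (intro Bochner_Integration.integrable_add int)
  show "AE \<omega> in M. norm (exp (r * \<bar>W \<omega>\<bar>)) \<le> norm (exp (r * W \<omega>) + exp (- r * W \<omega>))"
  proof (intro AE_I2)
    fix \<omega>
    have "exp (r * \<bar>W \<omega>\<bar>) \<le> exp (r * W \<omega>) + exp (- r * W \<omega>)" by (simp add: abs_if)
    then show "norm (exp (r * \<bar>W \<omega>\<bar>)) \<le> norm (exp (r * W \<omega>) + exp (- r * W \<omega>))" by simp
  qed
qed simp

text \<open>Expanding the exponential under the integral is justified by the integrability of \<open>exp (|z|
  |W|)\<close>. The resulting power series makes the generating function entire.\<close>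

lemma complex_mgf_power_series:
  fixes W :: "'a \<Rightarrow> real" and z :: complex
  assumes W[measurable]: "W \<in> borel_measurable M" and int: "\<And>s. integrable M (\<lambda>\<omega>. exp (s * W \<omega>))"
  shows "(\<lambda>k. (CLINT \<omega>|M. complex_of_real (W \<omega>) ^ k /\<^sub>R fact k) * z ^ k)
    sums (CLINT \<omega>|M. exp (z * complex_of_real (W \<omega>)))"
proof -
  define g where "g k \<omega> = (z * complex_of_real (W \<omega>)) ^ k /\<^sub>R fact k" for k \<omega>
  define b where "b \<omega> = exp (norm z * \<bar>W \<omega>\<bar>)" for \<omega>
  have b: "integrable M b" unfolding b_def by (rule exp_abs_integrable[OF W int])
  have ng: "norm (g k \<omega>) = (norm z * \<bar>W \<omega>\<bar>) ^ k /\<^sub>R fact k" for k \<omega>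
    by (simp add: g_def norm_power norm_mult)
  have part: "(\<Sum>k<n. norm (g k \<omega>)) \<le> b \<omega>" for n \<omega>
    unfolding ng b_def exp_def
    by (rule sum_le_suminf[OF summable_exp_generic]) auto
  have ng_le: "norm (g k \<omega>) \<le> b \<omega>" for k \<omega>
    using part[of \<omega> "Suc k"] by (simp add: sum_nonneg add_increasing) (smt (verit) norm_ge_zero sum_nonneg)
  have gm: "g k \<in> borel_measurable M" for k unfolding g_def by measurable
  have gi: "integrable M (g k)" for k
    by (rule Bochner_Integration.integrable_bound[OF b gm]) (use ng_le in \<open>auto simp: b_def\<close>)
  have "(\<lambda>k. integral\<^sup>L M (g k)) sums (CLINT \<omega>|M. (\<Sum>k. g k \<omega>))"
  proof (rule sums_integral[OF gi])
    show "AE \<omega> in M. summable (\<lambda>k. norm (g k \<omega>))"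
      unfolding g_def by (intro AE_I2 summable_norm_exp)
    show "summable (\<lambda>k. \<integral>\<omega>. norm (g k \<omega>) \<partial>M)"
    proof (rule bounded_imp_summable)
      fix n
      have "(\<Sum>k\<le>n. \<integral>\<omega>. norm (g k \<omega>) \<partial>M) = (\<integral>\<omega>. (\<Sum>k\<le>n. norm (g k \<omega>)) \<partial>M)"
        by (rule Bochner_Integration.integral_sum[symmetric]) (intro integrable_norm gi)
      also have "\<dots> \<le> (\<integral>\<omega>. b \<omega> \<partial>M)"
        using part[of _ "Suc n"]
        by (intro integral_mono b Bochner_Integration.integrable_sum integrable_norm gi) (auto simp: lessThan_Suc_atMost)
      finally show "(\<Sum>k\<le>n. \<integral>\<omega>. norm (g k \<omega>) \<partial>M) \<le> (\<integral>\<omega>. b \<omega> \<partial>M)" .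
    qed simp
  qed
  also have "(CLINT \<omega>|M. (\<Sum>k. g k \<omega>)) = (CLINT \<omega>|M. exp (z * complex_of_real (W \<omega>)))"
    by (simp add: g_def exp_def)
  also have "(\<lambda>k. integral\<^sup>L M (g k)) = (\<lambda>k. (CLINT \<omega>|M. complex_of_real (W \<omega>) ^ k /\<^sub>R fact k) * z ^ k)"
  proof
    fix k
    have "g k = (\<lambda>\<omega>. complex_of_real (W \<omega>) ^ k /\<^sub>R fact k * z ^ k)"
      by (simp add: g_def[abs_def] power_mult_distrib mult.commute)
    then show "integral\<^sup>L M (g k) = (CLINT \<omega>|M. complex_of_real (W \<omega>) ^ k /\<^sub>R fact k) * z ^ k"
      by (simp only: integral_mult_left_zero)
  qed
  finally show ?thesis .
qed

text \<open>The moment generating function, extended to the complex plane, is an entire function that agrees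
  with \<open>exp (z\<^sup>2 / 2)\<close> on the real axis, hence on the imaginary axis, where it is
  the characteristic function.\<close>

lemma std_normal_of_mgf:
  fixes W :: "'a \<Rightarrow> real"
  assumes W[measurable]: "W \<in> borel_measurable M" and int: "\<And>s. integrable M (\<lambda>\<omega>. exp (s * W \<omega>))"
    and mgf: "\<And>s. expectation (\<lambda>\<omega>. exp (s * W \<omega>)) = exp (s\<^sup>2 / 2)"
  shows "distributed M lborel W std_normal_density"
proof -
  define f where "f z = (CLINT \<omega>|M. exp (z * complex_of_real (W \<omega>)))" for z
  define a where "a k = (CLINT \<omega>|M. complex_of_real (W \<omega>) ^ k /\<^sub>R fact k)" for k
  have sums: "(\<lambda>k. a k * (z - 0) ^ k) sums f z" for z
    using complex_mgf_power_series[OF W int, of z] by (simp add: a_def f_def)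
  have real: "f (complex_of_real s) = exp ((complex_of_real s)\<^sup>2 / 2)" for s
  proof -
    have "f (complex_of_real s) = (CLINT \<omega>|M. complex_of_real (exp (s * W \<omega>)))"
      by (simp add: f_def exp_of_real[symmetric])
    also have "\<dots> = complex_of_real (exp (s\<^sup>2 / 2))" by (simp only: integral_complex_of_real mgf)
    also have "\<dots> = exp ((complex_of_real s)\<^sup>2 / 2)" by (simp add: exp_of_real[symmetric])
    finally show ?thesis .
  qed
  have char: "f (\<i> * complex_of_real t) - exp ((\<i> * complex_of_real t)\<^sup>2 / 2) = 0" for t
  proof -
    (* A disc containing the point i t and the interval (-1, 1) of the real axis. *)
    define S where "S = ball (0::complex) (\<bar>t\<bar> + 1)"
    have h: "f holomorphic_on S"
      unfolding S_def by (rule power_series_holomorphic[OF sums])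
    show ?thesis
    proof (rule analytic_continuation[where S = S and U = "complex_of_real ` {-1<..<1}" and \<xi> = 0
          and f = "\<lambda>z. f z - exp (z\<^sup>2 / 2)"])
      show "(\<lambda>z. f z - exp (z\<^sup>2 / 2)) holomorphic_on S" by (intro holomorphic_intros h) auto
      show "0 islimpt complex_of_real ` {-1<..<1}"
        unfolding islimpt_approachable
      proof (intro allI impI)
        fix e :: real assume "0 < e"
        then show "\<exists>x'\<in>complex_of_real ` {-1<..<1}. x' \<noteq> 0 \<and> dist x' 0 < e"
          by (intro bexI[of _ "complex_of_real (min (e / 2) (1 / 2))"]) auto
      qed
    qed (auto simp: S_def norm_mult real)
  qed
  interpret D: real_distribution "distr M borel W" by (rule real_distribution_distr[OF W])
  have "distr M borel W = std_normal_distribution"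
  proof (rule Levy_uniqueness[OF D.real_distribution_axioms real_dist_normal_dist], rule ext)
    fix t
    have "char (distr M borel W) t = f (\<i> * complex_of_real t)"
      unfolding char_def f_def by (subst integral_distr) (auto simp: mult.assoc)
    also have "\<dots> = exp ((\<i> * complex_of_real t)\<^sup>2 / 2)" using char[of t] by simp
    also have "\<dots> = complex_of_real (exp (- (t\<^sup>2) / 2))"
      by (simp add: power_mult_distrib exp_of_real[symmetric])
    finally show "char (distr M borel W) t = char std_normal_distribution t"
      by (simp add: char_std_normal_distribution)
  qed
  moreover have "distr M lborel W = distr M borel W" by (rule distr_cong) auto
  ultimately show ?thesis by (simp add: distributed_def)
qed

end

lemma sets_vec_lborel: "sets (vec_lborel p) = sets (vimage_algebra (carrier_vec p) (\<lambda>v. \<lambda>i\<in>{..<p}. v $ i) (\<Pi>\<^sub>M i\<in>{..<p}. (lborel :: real measure)))"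
  by (simp add: vec_lborel_def)

lemma space_vec_lborel: "space (vec_lborel p) = carrier_vec p"
  by (simp add: vec_lborel_def)

lemma measurable_vec_index [measurable]:
  assumes "i < p"
  shows "(\<lambda>v. v $ i) \<in> borel_measurable (vec_lborel p)"
proof -
  have "(\<lambda>v. \<lambda>i\<in>{..<p}. v $ i) \<in> vec_lborel p \<rightarrow>\<^sub>M (\<Pi>\<^sub>M i\<in>{..<p}. (lborel :: real measure))"
    unfolding measurable_cong_sets[OF sets_vec_lborel refl]
    by (rule measurable_vimage_algebra1) (auto simp: space_PiM)
  from measurable_compose[OF this measurable_component_singleton[of i]] assms
  show ?thesis by (simp add: measurable_cong_sets[OF refl sets_lborel])
qed

text \<open>The measure on vectors is the image of the product measure on coordinate functions.\<close>

lemma nn_integral_vec_lborel: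
  assumes "g \<in> borel_measurable (vec_lborel p)"
  shows "(\<integral>\<^sup>+x. g x \<partial>vec_lborel p) = (\<integral>\<^sup>+x. g (vec p x) \<partial>(\<Pi>\<^sub>M i\<in>{..<p}. lborel))"
  using assms measurable_vec_of_coords[of p] unfolding vec_lborel_def
  by (subst nn_integral_distr) (auto simp: vec_lborel_def)

text \<open>Boxes are translated to boxes, coordinate by coordinate, and boxes determine the product measure.\<close>

lemma PiM_lborel_translate:
  fixes h :: "nat \<Rightarrow> real"
  assumes I: "finite I"
  shows "distr (\<Pi>\<^sub>M i\<in>I. lborel) (\<Pi>\<^sub>M i\<in>I. lborel) (\<lambda>x. \<lambda>i\<in>I. x i + h i) = (\<Pi>\<^sub>M i\<in>I. (lborel :: real measure))"
proof -
  interpret product_sigma_finite "\<lambda>_::nat. lborel :: real measure" by standard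
  show ?thesis
  proof (rule PiM_eqI[OF I])
    have m[measurable]: "(\<lambda>x. \<lambda>i\<in>I. x i + h i) \<in> (\<Pi>\<^sub>M i\<in>I. lborel) \<rightarrow>\<^sub>M (\<Pi>\<^sub>M i\<in>I. (lborel :: real measure))"
      by (rule measurable_restrict) simp
    fix A :: "nat \<Rightarrow> real set" assume A: "\<And>i. i \<in> I \<Longrightarrow> A i \<in> sets lborel"
    have "emeasure (distr (\<Pi>\<^sub>M i\<in>I. lborel) (\<Pi>\<^sub>M i\<in>I. lborel) (\<lambda>x. \<lambda>i\<in>I. x i + h i)) (Pi\<^sub>E I A)
      = emeasure (\<Pi>\<^sub>M i\<in>I. lborel) ((\<lambda>x. \<lambda>i\<in>I. x i + h i) -` Pi\<^sub>E I A \<inter> space (\<Pi>\<^sub>M i\<in>I. lborel))"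
      by (rule emeasure_distr[OF m]) (intro sets_PiM_I_finite I A)
    also have "(\<lambda>x. \<lambda>i\<in>I. x i + h i) -` Pi\<^sub>E I A \<inter> space (\<Pi>\<^sub>M i\<in>I. lborel) = (\<Pi>\<^sub>E i\<in>I. (\<lambda>x. x + h i) -` A i)"
      by (auto simp: space_PiM PiE_iff extensional_def)
    also have "emeasure (\<Pi>\<^sub>M i\<in>I. lborel) \<dots> = (\<Prod>i\<in>I. emeasure lborel ((\<lambda>x. x + h i) -` A i))"
      by (rule emeasure_PiM[OF I]) (use A in \<open>auto intro!: measurable_sets_borel[of "\<lambda>x. x + _" borel]\<close>)
    also have "\<dots> = (\<Prod>i\<in>I. emeasure lborel (A i))"
    proof (intro prod.cong refl)
      fix i assume "i \<in> I"
      have "(\<lambda>x. h i + x) = (\<lambda>x. x + h i)" by (simp add: add.commute)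
      then have "emeasure lborel (A i) = emeasure (distr lborel borel (\<lambda>x. x + h i)) (A i)"
        using lborel_distr_plus[of "h i"] by simp
      also have "\<dots> = emeasure lborel ((\<lambda>x. x + h i) -` A i)"
        using A[OF \<open>i \<in> I\<close>] by (subst emeasure_distr) auto
      finally show "emeasure lborel ((\<lambda>x. x + h i) -` A i) = emeasure lborel (A i)" ..
    qed
    finally show "emeasure (distr (\<Pi>\<^sub>M i\<in>I. lborel) (\<Pi>\<^sub>M i\<in>I. lborel) (\<lambda>x. \<lambda>i\<in>I. x i + h i)) (Pi\<^sub>E I A)
      = (\<Prod>i\<in>I. emeasure lborel (A i))" .
  qed simp
qed

lemma qform_scale: "qform A (\<lambda>i. k * v i) = k\<^sup>2 * qform A v"
  unfolding qform_def sum_distrib_left by (intro sum.cong refl) (simp add: power2_eq_square)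

lemma mvn_density_eq_qform:
  assumes G: "G \<in> carrier_mat p p" and G_eq: "mat_inv \<Sigma> = G" and mu: "\<mu> \<in> carrier_vec p" and x: "x \<in> carrier_vec p"
  shows "mvn_density \<mu> \<Sigma> x = exp (- (1 / 2) * qform G (\<lambda>i. x $ i - \<mu> $ i)) / sqrt ((2 * pi) ^ p * det \<Sigma>)"
proof -
  have "scalar_prod (x - \<mu>) (G *\<^sub>v (x - \<mu>)) = qform G (\<lambda>i. x $ i - \<mu> $ i)"
    using G mu x by (auto simp: qform_eq_mv mv_def scalar_prod_def atLeast0LessThan intro!: sum.cong)
  then show ?thesis using mu by (simp add: mvn_density_def G_eq)
qed

text \<open>Completing the square: the exponential weight moves the centre from \<open>\<mu>\<close> to
  \<open>\<mu> + \<Sigma> v\<close>.\<close>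

lemma mvn_density_tilt:
  assumes S: "coercive p c \<Sigma>" and mu: "\<mu> \<in> carrier_vec p" and x: "x \<in> carrier_vec p"
  shows "exp (\<Sum>i<p. v i * (x $ i - \<mu> $ i)) * mvn_density \<mu> \<Sigma> x
    = exp (qform \<Sigma> v / 2) * mvn_density \<mu> \<Sigma> (vec p (\<lambda>i. x $ i + - mv \<Sigma> v i))"
proof -
  note Sc = coerciveD(1)[OF S]
  obtain C where C: "0 < C" "\<And>v. qform \<Sigma> v \<le> C * sqnorm p v"
    using qform_le_exists[of \<Sigma>] Sc by auto
  obtain G where G: "\<Sigma> * G = 1\<^sub>m p" "G * \<Sigma> = 1\<^sub>m p" "coercive p (1 / C) G"
    using coercive_inverse[OF S C(2,1)] by auto
  note Gc = coerciveD(1)[OF G(3)]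
  have inv: "mat_inv \<Sigma> = G" by (rule mat_inv_eqI[OF Sc Gc G(1,2)])
  define u where "u i = x $ i - \<mu> $ i" for i
  have "qform G (\<lambda>i. u i - 1 * mv \<Sigma> v i) = qform G u - 2 * 1 * (\<Sum>i<p. mv \<Sigma> v i * mv G u i) + 1\<^sup>2 * qform G (mv \<Sigma> v)"
    by (rule qform_diff[OF Gc coerciveD(2)[OF G(3)]])
  also have "qform G (mv \<Sigma> v) = (\<Sum>i<p. mv \<Sigma> v i * v i)"
    unfolding qform_eq_mv using Gc by (simp add: mv_mult[OF Gc Sc G(2)])
  also have "\<dots> = qform \<Sigma> v" unfolding qform_eq_mv using Sc by (simp add: mult.commute)
  also have "(\<Sum>i<p. mv \<Sigma> v i * mv G u i) = (\<Sum>i<p. \<Sum>j<p. \<Sigma> $$ (i, j) * v j * mv G u i)"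
    using Sc by (simp add: mv_def[of \<Sigma>] sum_distrib_right)
  also have "\<dots> = (\<Sum>j<p. \<Sum>i<p. \<Sigma> $$ (i, j) * v j * mv G u i)" by (rule sum.swap)
  also have "\<dots> = (\<Sum>j<p. v j * mv \<Sigma> (mv G u) j)"
    unfolding mv_def[of \<Sigma>] carrier_matD(1)[OF Sc] sum_distrib_left
    by (intro sum.cong refl) (simp add: sym_matD[OF coerciveD(2)[OF S] Sc])
  also have "\<dots> = (\<Sum>j<p. v j * u j)" by (simp add: mv_mult[OF Sc Gc G(1)])
  finally have q: "qform G (\<lambda>i. u i - mv \<Sigma> v i) = qform G u - 2 * (\<Sum>j<p. v j * u j) + qform \<Sigma> v" by simp
  have "qform G (\<lambda>i. vec p (\<lambda>i. x $ i + - mv \<Sigma> v i) $ i - \<mu> $ i) = qform G (\<lambda>i. u i - mv \<Sigma> v i)"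
    unfolding qform_def using Gc by (intro sum.cong) (auto simp: u_def algebra_simps)
  then have r: "mvn_density \<mu> \<Sigma> (vec p (\<lambda>i. x $ i + - mv \<Sigma> v i))
    = exp (- (1 / 2) * (qform G u - 2 * (\<Sum>j<p. v j * u j) + qform \<Sigma> v)) / sqrt ((2 * pi) ^ p * det \<Sigma>)"
    by (simp add: mvn_density_eq_qform[OF Gc inv mu] q)
  show ?thesis
    unfolding r mvn_density_eq_qform[OF Gc inv mu x] u_def[symmetric]
    by (simp add: exp_add[symmetric] algebra_simps)
qed

context prob_space
begin

text \<open>The tilted density is a translate of the density, so its integral is known: no Gaussian integral and
  no change of variables with a determinant is computed.\<close>

lemma mvn_mgf:
  assumes S: "coercive p c \<Sigma>" and mu: "\<mu> \<in> carrier_vec p"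
    and X: "distributed M (vec_lborel p) X (\<lambda>x. ennreal (mvn_density \<mu> \<Sigma> x))"
  shows "integrable M (\<lambda>\<omega>. exp (\<Sum>i<p. v i * (X \<omega> $ i - \<mu> $ i)))"
    and "expectation (\<lambda>\<omega>. exp (\<Sum>i<p. v i * (X \<omega> $ i - \<mu> $ i))) = exp (qform \<Sigma> v / 2)"
proof -
  define d where "d x = ennreal (mvn_density \<mu> \<Sigma> x)" for x
  have dm: "d \<in> borel_measurable (vec_lborel p)" using distributed_borel_measurable[OF X] by (simp add: d_def[abs_def])
  have Xm: "X \<in> M \<rightarrow>\<^sub>M vec_lborel p" by (rule distributed_measurable[OF X])
  have one: "(\<integral>\<^sup>+x. d x \<partial>vec_lborel p) = 1"
  proof -
    have "(\<integral>\<^sup>+x. d x \<partial>vec_lborel p) = emeasure (density (vec_lborel p) d) (space (vec_lborel p))"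
      using dm by (subst emeasure_density) (auto intro!: nn_integral_cong)
    also have "\<dots> = emeasure (distr M (vec_lborel p) X) (space (vec_lborel p))"
      using distributed_distr_eq_density[OF X] by (simp add: d_def[abs_def])
    also have "\<dots> = emeasure M (space M)"
      using Xm by (subst emeasure_distr) (auto dest: measurable_space simp: vimage_def intro!: arg_cong[of _ _ "emeasure M"])
    finally show ?thesis by (simp add: emeasure_space_1)
  qed
  define E where "E x = ennreal (exp (\<Sum>i<p. v i * (x $ i - \<mu> $ i)))" for x
  have Em[measurable]: "E \<in> borel_measurable (vec_lborel p)" unfolding E_def by measurable
  let ?P = "\<Pi>\<^sub>M i\<in>{..<p}. (lborel :: real measure)"
  let ?T = "\<lambda>x. \<lambda>i\<in>{..<p}. x i + - mv \<Sigma> v i"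
  have Tm: "?T \<in> ?P \<rightarrow>\<^sub>M ?P" by (rule measurable_restrict) simp
  have dv: "(\<lambda>x. d (vec p x)) \<in> borel_measurable ?P"
    using measurable_compose[OF measurable_vec_of_coords[of p], of d borel] dm
    by (simp add: measurable_cong_sets[OF sets_vec_lborel refl])
  have tilt: "d (vec p x) * E (vec p x) = ennreal (exp (qform \<Sigma> v / 2)) * d (vec p (?T x))" for x
  proof -
    have nn: "0 \<le> mvn_density \<mu> \<Sigma> y" for y
      using coercive_det_pos[OF S] by (simp add: mvn_density_def)
    have e: "vec p (\<lambda>i. vec p x $ i + - mv \<Sigma> v i) = vec p (?T x)" by (intro eq_vecI) auto
    show ?thesis
      using mvn_density_tilt[OF S mu, of "vec p x" v]
      unfolding d_def E_def e by (simp add: ennreal_mult'[symmetric] nn ennreal_mult[symmetric] mult.commute)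
  qed
  have "(\<integral>\<^sup>+\<omega>. E (X \<omega>) \<partial>M) = (\<integral>\<^sup>+x. E x \<partial>distr M (vec_lborel p) X)"
    by (subst nn_integral_distr[OF Xm]) (simp_all add: Em)
  also have "\<dots> = (\<integral>\<^sup>+x. d x * E x \<partial>vec_lborel p)"
    using distributed_distr_eq_density[OF X] nn_integral_density[OF dm Em] by (simp add: d_def[abs_def])
  also have "\<dots> = (\<integral>\<^sup>+x. d (vec p x) * E (vec p x) \<partial>?P)"
    by (rule nn_integral_vec_lborel) (use dm in measurable)
  also have "\<dots> = ennreal (exp (qform \<Sigma> v / 2)) * (\<integral>\<^sup>+x. d (vec p (?T x)) \<partial>?P)"
    unfolding tilt by (rule nn_integral_cmult) (rule measurable_compose[OF Tm dv])
  also have "(\<integral>\<^sup>+x. d (vec p (?T x)) \<partial>?P) = (\<integral>\<^sup>+x. d (vec p x) \<partial>distr ?P ?P ?T)"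
    by (subst nn_integral_distr[OF Tm]) (simp_all add: dv)
  also have "distr ?P ?P ?T = ?P" by (rule PiM_lborel_translate) simp
  also have "(\<integral>\<^sup>+x. d (vec p x) \<partial>?P) = 1" using nn_integral_vec_lborel[OF dm] one by simp
  finally have fin: "(\<integral>\<^sup>+\<omega>. E (X \<omega>) \<partial>M) = ennreal (exp (qform \<Sigma> v / 2))" by simp
  have "(\<lambda>\<omega>. X \<omega> $ i) \<in> borel_measurable M" if "i < p" for i
    using measurable_compose[OF Xm measurable_vec_index[OF that]] .
  then have "(\<lambda>\<omega>. exp (\<Sum>i<p. v i * (X \<omega> $ i - \<mu> $ i))) \<in> borel_measurable M" by measurable
  then show "integrable M (\<lambda>\<omega>. exp (\<Sum>i<p. v i * (X \<omega> $ i - \<mu> $ i)))"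
    and "expectation (\<lambda>\<omega>. exp (\<Sum>i<p. v i * (X \<omega> $ i - \<mu> $ i))) = exp (qform \<Sigma> v / 2)"
    using fin nn_integral_eq_integrable[of "\<lambda>\<omega>. exp (\<Sum>i<p. v i * (X \<omega> $ i - \<mu> $ i))" M "exp (qform \<Sigma> v / 2)"]
    by (auto simp: E_def)
qed

lemma mvn_linear_form:
  assumes S: "coercive p c \<Sigma>" and mu: "\<mu> \<in> carrier_vec p"
    and X: "distributed M (vec_lborel p) X (\<lambda>x. ennreal (mvn_density \<mu> \<Sigma> x))"
    and v: "0 < qform \<Sigma> v"
  shows "distributed M lborel (\<lambda>\<omega>. (\<Sum>i<p. v i * (X \<omega> $ i - \<mu> $ i)) / sqrt (qform \<Sigma> v)) std_normal_density"
proof (rule std_normal_of_mgf)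
  have Xm: "X \<in> M \<rightarrow>\<^sub>M vec_lborel p" by (rule distributed_measurable[OF X])
  have "(\<lambda>\<omega>. X \<omega> $ i) \<in> borel_measurable M" if "i < p" for i
    using measurable_compose[OF Xm measurable_vec_index[OF that]] .
  then show "(\<lambda>\<omega>. (\<Sum>i<p. v i * (X \<omega> $ i - \<mu> $ i)) / sqrt (qform \<Sigma> v)) \<in> borel_measurable M" by measurable
  fix s :: real
  define w where "w i = s / sqrt (qform \<Sigma> v) * v i" for i
  have e: "s * ((\<Sum>i<p. v i * (x $ i - \<mu> $ i)) / sqrt (qform \<Sigma> v)) = (\<Sum>i<p. w i * (x $ i - \<mu> $ i))" for x
    by (simp add: w_def sum_distrib_left sum_divide_distrib mult.assoc)
  have "qform \<Sigma> w = (s / sqrt (qform \<Sigma> v))\<^sup>2 * qform \<Sigma> v"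
    unfolding w_def by (rule qform_scale)
  then have q: "qform \<Sigma> w = s\<^sup>2" using v by (simp add: power_divide)
  show "integrable M (\<lambda>\<omega>. exp (s * ((\<Sum>i<p. v i * (X \<omega> $ i - \<mu> $ i)) / sqrt (qform \<Sigma> v))))"
    unfolding e by (rule mvn_mgf(1)[OF S mu X])
  show "expectation (\<lambda>\<omega>. exp (s * ((\<Sum>i<p. v i * (X \<omega> $ i - \<mu> $ i)) / sqrt (qform \<Sigma> v)))) = exp (s\<^sup>2 / 2)"
    unfolding e mvn_mgf(2)[OF S mu X] q ..
qed

end

section \<open>Tail bounds and the empirical covariance matrix\<close>

lemma (in prob_space) std_normal_nn_integral:
  assumes W: "distributed M lborel W std_normal_density" and g: "g \<in> borel_measurable borel"
  shows "(\<integral>\<^sup>+\<omega>. g (W \<omega>) \<partial>M) = (\<integral>\<^sup>+x. ennreal (std_normal_density x) * g x \<partial>lborel)"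
proof -
  have Wm: "W \<in> M \<rightarrow>\<^sub>M lborel" by (rule distributed_measurable[OF W])
  have "(\<integral>\<^sup>+\<omega>. g (W \<omega>) \<partial>M) = (\<integral>\<^sup>+x. g x \<partial>distr M lborel W)"
    by (subst nn_integral_distr[OF Wm]) (use g in auto)
  also have "\<dots> = (\<integral>\<^sup>+x. ennreal (std_normal_density x) * g x \<partial>lborel)"
    unfolding distributed_distr_eq_density[OF W] by (rule nn_integral_density) (use g in auto)
  finally show ?thesis .
qed

lemma nn_integral_normal_density: "0 < \<sigma> \<Longrightarrow> (\<integral>\<^sup>+x. ennreal (normal_density \<mu> \<sigma> x) \<partial>lborel) = 1"
  by (subst nn_integral_eq_integral) (auto intro: AE_I2)

lemma (in prob_space) std_normal_mgf:
  assumes W: "distributed M lborel W std_normal_density"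
  shows "(\<integral>\<^sup>+\<omega>. ennreal (exp (\<theta> * W \<omega>)) \<partial>M) = ennreal (exp (\<theta>\<^sup>2 / 2))"
proof -
  have "std_normal_density x * exp (\<theta> * x) = exp (\<theta>\<^sup>2 / 2) * normal_density \<theta> 1 x" for x
    by (simp add: normal_density_def exp_add[symmetric] power2_eq_square field_simps)
  then have "(\<integral>\<^sup>+\<omega>. ennreal (exp (\<theta> * W \<omega>)) \<partial>M) = (\<integral>\<^sup>+x. ennreal (exp (\<theta>\<^sup>2 / 2)) * ennreal (normal_density \<theta> 1 x) \<partial>lborel)"
    by (subst std_normal_nn_integral[OF W]) (simp_all add: ennreal_mult[symmetric])
  also have "\<dots> = ennreal (exp (\<theta>\<^sup>2 / 2)) * (\<integral>\<^sup>+x. ennreal (normal_density \<theta> 1 x) \<partial>lborel)"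
    by (rule nn_integral_cmult) simp
  finally show ?thesis by (simp add: nn_integral_normal_density)
qed

text \<open>The weight \<open>exp (\<theta> x\<^sup>2)\<close> turns the standard normal density into a multiple
  of a normal density of variance \<open>1 / (1 - 2 \<theta>)\<close>.\<close>

lemma (in prob_space) std_normal_square_mgf:
  assumes W: "distributed M lborel W std_normal_density" and \<theta>: "\<bar>\<theta>\<bar> \<le> 1 / 4"
  shows "(\<integral>\<^sup>+\<omega>. ennreal (exp (\<theta> * ((W \<omega>)\<^sup>2 - 1))) \<partial>M) \<le> ennreal (exp (4 * \<theta>\<^sup>2))"
proof -
  define s where "s = 1 / sqrt (1 - 2 * \<theta>)"
  have p: "0 < 1 - 2 * \<theta>" using \<theta> by linarith
  have s: "0 < s" using p by (simp add: s_def)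
  have s2: "1 / s\<^sup>2 = 1 - 2 * \<theta>" using p by (simp add: s_def power_divide)
  have "std_normal_density x * exp (\<theta> * (x\<^sup>2 - 1)) = exp (- \<theta>) * s * normal_density 0 s x" for x
  proof -
    have "normal_density 0 s x = 1 / (sqrt (2 * pi) * s) * exp (- (x\<^sup>2 * (1 / s\<^sup>2)) / 2)"
      using s by (simp add: normal_density_def real_sqrt_mult field_simps)
    also have "\<dots> = 1 / (sqrt (2 * pi) * s) * exp (- (x\<^sup>2 * (1 - 2 * \<theta>)) / 2)" by (simp only: s2)
    finally show ?thesis using s
      by (simp add: std_normal_density_def exp_add[symmetric] algebra_simps add_divide_distrib diff_divide_distrib)
  qed
  then have "(\<integral>\<^sup>+\<omega>. ennreal (exp (\<theta> * ((W \<omega>)\<^sup>2 - 1))) \<partial>M) = (\<integral>\<^sup>+x. ennreal (exp (- \<theta>) * s) * ennreal (normal_density 0 s x) \<partial>lborel)"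
    using s by (subst std_normal_nn_integral[OF W]) (simp_all add: ennreal_mult[symmetric])
  also have "\<dots> = ennreal (exp (- \<theta>) * s) * (\<integral>\<^sup>+x. ennreal (normal_density 0 s x) \<partial>lborel)"
    by (rule nn_integral_cmult) simp
  also have "\<dots> = ennreal (exp (- \<theta>) * s)" using s by (simp add: nn_integral_normal_density)
  also have "\<dots> \<le> ennreal (exp (4 * \<theta>\<^sup>2))"
  proof (rule ennreal_leI)
    have l: "- (2 * \<theta>) - 2 * (2 * \<theta>)\<^sup>2 \<le> ln (1 - 2 * \<theta>)"
    proof (cases "0 \<le> \<theta>")
      case True
      then show ?thesis using ln_one_minus_pos_lower_bound[of "2 * \<theta>"] \<theta> by simp
    next
      case False
      then have "- (2 * \<theta>) - (2 * \<theta>)\<^sup>2 \<le> ln (1 - 2 * \<theta>)"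
        using ln_one_plus_pos_lower_bound[of "- 2 * \<theta>"] \<theta> by simp
      then show ?thesis using zero_le_power2[of "2 * \<theta>"] by linarith
    qed
    have "s = exp (- (ln (1 - 2 * \<theta>) / 2))"
      using p by (simp add: s_def exp_minus ln_sqrt[symmetric] inverse_eq_divide)
    then have "exp (- \<theta>) * s = exp (- \<theta> - ln (1 - 2 * \<theta>) / 2)" by (simp add: exp_add[symmetric])
    also have "\<dots> \<le> exp (4 * \<theta>\<^sup>2)" using l by (simp add: power2_eq_square)
    finally show "exp (- \<theta>) * s \<le> exp (4 * \<theta>\<^sup>2)" .
  qed
  finally show ?thesis .
qed

text \<open>The density is at most \<open>1 / sqrt (2 \<pi>) \<le> 1 / 2\<close>.\<close>

lemma (in prob_space) std_normal_interval:
  assumes W: "distributed M lborel W std_normal_density" and r: "0 \<le> r"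
  shows "prob {\<omega> \<in> space M. \<bar>W \<omega> - c\<bar> \<le> r} \<le> r"
proof -
  have Wm: "W \<in> borel_measurable M" using distributed_measurable[OF W] by simp
  have "emeasure M {\<omega> \<in> space M. \<bar>W \<omega> - c\<bar> \<le> r} = (\<integral>\<^sup>+\<omega>. indicator {\<omega> \<in> space M. \<bar>W \<omega> - c\<bar> \<le> r} \<omega> \<partial>M)"
    by (rule nn_integral_indicator[symmetric]) (use Wm in measurable)
  also have "\<dots> = (\<integral>\<^sup>+\<omega>. indicator {c - r..c + r} (W \<omega>) \<partial>M)"
    by (intro nn_integral_cong) (auto simp: indicator_def abs_le_iff)
  also have "\<dots> = (\<integral>\<^sup>+x. ennreal (std_normal_density x) * indicator {c - r..c + r} x \<partial>lborel)"
    by (rule std_normal_nn_integral[OF W]) simp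
  also have "\<dots> \<le> (\<integral>\<^sup>+x. ennreal (1 / 2) * indicator {c - r..c + r} x \<partial>lborel)"
  proof (intro nn_integral_mono mult_right_mono ennreal_leI)
    fix x :: real
    have "sqrt 4 \<le> sqrt (2 * pi)" using pi_ge_two by (intro real_sqrt_le_mono) simp
    then have "1 / sqrt (2 * pi) \<le> 1 / 2" by (intro divide_left_mono) auto
    then have "1 / sqrt (2 * pi) * exp (- x\<^sup>2 / 2) \<le> 1 / 2 * 1" by (intro mult_mono) auto
    then show "std_normal_density x \<le> 1 / 2" by (simp add: std_normal_density_def)
  qed simp
  also have "\<dots> = ennreal (1 / 2) * emeasure lborel {c - r..c + r}"
    by (rule nn_integral_cmult_indicator) simp
  also have "emeasure lborel {c - r..c + r} = ennreal (2 * r)" using r by simp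
  also have "ennreal (1 / 2) * ennreal (2 * r) = ennreal r"
    by (subst ennreal_mult[symmetric]) (use r in auto)
  finally show ?thesis using r by (simp add: emeasure_eq_measure)
qed

lemma (in prob_space) chernoff_bound:
  fixes W :: "nat \<Rightarrow> 'a \<Rightarrow> real"
  assumes I: "finite I" and ind: "indep_vars (\<lambda>_. borel) W I" and \<theta>: "0 \<le> \<theta>"
    and mgf: "\<And>l. l \<in> I \<Longrightarrow> (\<integral>\<^sup>+\<omega>. ennreal (exp (\<theta> * W l \<omega>)) \<partial>M) \<le> ennreal (exp c)"
  shows "prob {\<omega> \<in> space M. u \<le> (\<Sum>l\<in>I. W l \<omega>)} \<le> exp (real (card I) * c - \<theta> * u)"
proof -
  have Wm[measurable]: "\<And>l. l \<in> I \<Longrightarrow> W l \<in> borel_measurable M" using ind by (simp add: indep_vars_def)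
  have ind': "indep_vars (\<lambda>_. borel) (\<lambda>l \<omega>. ennreal (exp (\<theta> * W l \<omega>))) I"
    by (rule indep_vars_compose2[OF ind]) simp
  have "emeasure M {\<omega> \<in> space M. u \<le> (\<Sum>l\<in>I. W l \<omega>)} \<le> (\<integral>\<^sup>+\<omega>. ennreal (exp (- \<theta> * u)) * (\<Prod>l\<in>I. ennreal (exp (\<theta> * W l \<omega>))) \<partial>M)"
  proof (subst nn_integral_indicator[symmetric])
    show "(\<integral>\<^sup>+\<omega>. indicator {\<omega> \<in> space M. u \<le> (\<Sum>l\<in>I. W l \<omega>)} \<omega> \<partial>M)
      \<le> (\<integral>\<^sup>+\<omega>. ennreal (exp (- \<theta> * u)) * (\<Prod>l\<in>I. ennreal (exp (\<theta> * W l \<omega>))) \<partial>M)"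
    proof (rule nn_integral_mono)
      fix \<omega>
      have e: "ennreal (exp (- \<theta> * u)) * (\<Prod>l\<in>I. ennreal (exp (\<theta> * W l \<omega>))) = ennreal (exp (\<theta> * ((\<Sum>l\<in>I. W l \<omega>) - u)))"
        by (simp add: prod_ennreal ennreal_mult[symmetric] exp_sum[OF I, symmetric] exp_add[symmetric] sum_distrib_left algebra_simps)
      show "indicator {\<omega> \<in> space M. u \<le> (\<Sum>l\<in>I. W l \<omega>)} \<omega>
        \<le> ennreal (exp (- \<theta> * u)) * (\<Prod>l\<in>I. ennreal (exp (\<theta> * W l \<omega>)))"
        unfolding e using \<theta> by (auto simp: indicator_def intro!: mult_nonneg_nonneg)
    qed
  qed measurable
  also have "\<dots> = ennreal (exp (- \<theta> * u)) * (\<integral>\<^sup>+\<omega>. (\<Prod>l\<in>I. ennreal (exp (\<theta> * W l \<omega>))) \<partial>M)"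
    by (rule nn_integral_cmult) measurable
  also have "(\<integral>\<^sup>+\<omega>. (\<Prod>l\<in>I. ennreal (exp (\<theta> * W l \<omega>))) \<partial>M) = (\<Prod>l\<in>I. \<integral>\<^sup>+\<omega>. ennreal (exp (\<theta> * W l \<omega>)) \<partial>M)"
    by (rule indep_vars_nn_integral[OF I ind']) simp
  also have "ennreal (exp (- \<theta> * u)) * \<dots> \<le> ennreal (exp (- \<theta> * u)) * (\<Prod>l\<in>I. ennreal (exp c))"
  proof (rule mult_left_mono)
    show "(\<Prod>l\<in>I. \<integral>\<^sup>+\<omega>. ennreal (exp (\<theta> * W l \<omega>)) \<partial>M) \<le> (\<Prod>l\<in>I. ennreal (exp c))"
      by (rule prod_mono_ennreal[OF mgf])
  qed simp
  also have "\<dots> = ennreal (exp (real (card I) * c - \<theta> * u))"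
    by (simp add: ennreal_power ennreal_mult[symmetric] exp_of_nat_mult[symmetric] exp_add[symmetric])
  finally show ?thesis by (simp add: emeasure_eq_measure)
qed

lemma (in prob_space) chernoff_two_sided:
  fixes W :: "nat \<Rightarrow> 'a \<Rightarrow> real"
  assumes I: "finite I" and ind: "indep_vars (\<lambda>_. borel) W I" and \<theta>: "0 \<le> \<theta>"
    and mgf: "\<And>l. l \<in> I \<Longrightarrow> (\<integral>\<^sup>+\<omega>. ennreal (exp (\<theta> * W l \<omega>)) \<partial>M) \<le> ennreal (exp c)"
    and mgf': "\<And>l. l \<in> I \<Longrightarrow> (\<integral>\<^sup>+\<omega>. ennreal (exp (- \<theta> * W l \<omega>)) \<partial>M) \<le> ennreal (exp c)"
  shows "prob {\<omega> \<in> space M. u \<le> \<bar>\<Sum>l\<in>I. W l \<omega>\<bar>} \<le> 2 * exp (real (card I) * c - \<theta> * u)"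
proof -
  have Wm[measurable]: "\<And>l. l \<in> I \<Longrightarrow> W l \<in> borel_measurable M" using ind by (simp add: indep_vars_def)
  have ind': "indep_vars (\<lambda>_. borel) (\<lambda>l \<omega>. - W l \<omega>) I"
    by (rule indep_vars_compose2[OF ind]) simp
  have "prob {\<omega> \<in> space M. u \<le> \<bar>\<Sum>l\<in>I. W l \<omega>\<bar>}
    \<le> prob ({\<omega> \<in> space M. u \<le> (\<Sum>l\<in>I. W l \<omega>)} \<union> {\<omega> \<in> space M. u \<le> (\<Sum>l\<in>I. - W l \<omega>)})"
    by (rule finite_measure_mono) (auto simp: sum_negf abs_if split: if_splits)
  also have "\<dots> \<le> prob {\<omega> \<in> space M. u \<le> (\<Sum>l\<in>I. W l \<omega>)} + prob {\<omega> \<in> space M. u \<le> (\<Sum>l\<in>I. - W l \<omega>)}"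
    by (rule measure_Un_le) measurable
  also have "\<dots> \<le> exp (real (card I) * c - \<theta> * u) + exp (real (card I) * c - \<theta> * u)"
    by (intro add_mono chernoff_bound[OF I ind \<theta> mgf] chernoff_bound[OF I ind' \<theta>]) (use mgf' in auto)
  finally show ?thesis by simp
qed

lemma emp_cov_carrier [simp]: "emp_cov p n x \<in> carrier_mat p p"
  by (simp add: emp_cov_def)

text \<open>Centring the observations by an arbitrary vector does not change the empirical covariance. Used with
  the true mean, with no centring, and with the empirical mean.\<close>

lemma emp_cov_index:
  assumes "i < p" "j < p" and n: "0 < n"
  shows "emp_cov p n x $$ (i, j) =
    (\<Sum>l=1..n. (x l $ i - a i) * (x l $ j - a j)) / real n
    - ((\<Sum>l=1..n. x l $ i - a i) / real n) * ((\<Sum>l=1..n. x l $ j - a j) / real n)"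
proof -
  define A where "A k = (\<Sum>l=1..n. x l $ k - a k) / real n" for k
  have m: "emp_mean p n x $ k = A k + a k" if "k < p" for k
    using that n by (simp add: emp_mean_def A_def sum_subtractf diff_divide_distrib)
  have nA: "(\<Sum>l=1..n. x l $ k - a k) = real n * A k" for k using n by (simp add: A_def)
  have "emp_cov p n x $$ (i, j) = (\<Sum>l=1..n. ((x l $ i - a i) - A i) * ((x l $ j - a j) - A j)) / real n"
  proof -
    have c: "(x l - emp_mean p n x) $ k = (x l $ k - a k) - A k" if "k < p" for l k
    proof -
      have "k < dim_vec (emp_mean p n x)" using that by (simp add: emp_mean_def)
      then show ?thesis by (simp add: m[OF that])
    qed
    show ?thesis using assms(1,2) by (simp add: emp_cov_def c)
  qed
  also have "(\<Sum>l=1..n. ((x l $ i - a i) - A i) * ((x l $ j - a j) - A j))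
    = (\<Sum>l=1..n. (x l $ i - a i) * (x l $ j - a j) - A j * (x l $ i - a i) - A i * (x l $ j - a j) + A i * A j)"
    by (intro sum.cong refl) (simp add: algebra_simps)
  also have "\<dots> = (\<Sum>l=1..n. (x l $ i - a i) * (x l $ j - a j)) - A j * (\<Sum>l=1..n. x l $ i - a i)
     - A i * (\<Sum>l=1..n. x l $ j - a j) + real n * (A i * A j)"
    by (simp only: sum.distrib sum_subtractf sum_distrib_left[symmetric]) simp
  also have "\<dots> = (\<Sum>l=1..n. (x l $ i - a i) * (x l $ j - a j)) - real n * (A i * A j)"
    unfolding nA by simp
  finally show ?thesis using n unfolding A_def[symmetric] by (simp add: diff_divide_distrib)
qed

section \<open>Uniform concentration of the empirical covariances\<close>

text \<open>One sample size at a time; the spectral hypothesis is already translated into bounds on the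
  quadratic form of \<open>\<Sigma>\<close>.\<close>

locale gaussian_sample = prob_space M for M :: "'a measure" +
  fixes n p :: nat and X :: "nat \<Rightarrow> 'a \<Rightarrow> real vec" and \<mu> :: "real vec" and \<Sigma> :: "real mat"
    and lam Lam :: real
  assumes n_pos: "0 < n" and p_pos: "0 < p" and mu: "\<mu> \<in> carrier_vec p"
    and Sigma: "coercive p lam \<Sigma>" and Sigma_le: "\<And>v. qform \<Sigma> v \<le> Lam * sqnorm p v"
    and indep: "indep_vars (\<lambda>_. vec_lborel p) X {1..n}"
    and normal: "\<And>l. l \<in> {1..n} \<Longrightarrow> distributed M (vec_lborel p) (X l) (\<lambda>x. ennreal (mvn_density \<mu> \<Sigma> x))"
begin

definition S :: "'a \<Rightarrow> real mat" where "S \<omega> = emp_cov p n (\<lambda>l. X l \<omega>)"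

definition proj :: "(nat \<Rightarrow> real) \<Rightarrow> nat \<Rightarrow> 'a \<Rightarrow> real" where
  "proj v l \<omega> = (\<Sum>i<p. v i * (X l \<omega> $ i - \<mu> $ i))"

lemma X_index_measurable [measurable]: "l \<in> {1..n} \<Longrightarrow> i < p \<Longrightarrow> (\<lambda>\<omega>. X l \<omega> $ i) \<in> borel_measurable M"
  using measurable_compose[OF distributed_measurable[OF normal] measurable_vec_index] .

lemma proj_measurable [measurable]: "l \<in> {1..n} \<Longrightarrow> proj v l \<in> borel_measurable M"
  unfolding proj_def by measurable

lemma indep_proj: "indep_vars (\<lambda>_. borel) (\<lambda>l \<omega>. proj v l \<omega> / c) {1..n}"
  unfolding proj_def by (rule indep_vars_compose2[OF indep]) measurable

lemma lam_pos: "0 < lam"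
  by (rule coerciveD(3)[OF Sigma])

lemma proj_std:
  assumes l: "l \<in> {1..n}" and v: "0 < sqnorm p v"
  shows "distributed M lborel (\<lambda>\<omega>. proj v l \<omega> / sqrt (qform \<Sigma> v)) std_normal_density"
  unfolding proj_def
proof (rule mvn_linear_form[OF Sigma mu normal[OF l]])
  have "0 < lam * sqnorm p v" using v lam_pos by simp
  then show "0 < qform \<Sigma> v" using coerciveD(4)[OF Sigma, of v] by linarith
qed

lemma qform_Sigma_pos: "0 < sqnorm p v \<Longrightarrow> 0 < qform \<Sigma> v"
  using coerciveD(4)[OF Sigma, of v] lam_pos by (meson mult_pos_pos less_le_trans)

lemma prob_square_deviation:
  assumes v: "0 < sqnorm p v" and t: "0 \<le> t" "t \<le> 2"
  shows "prob {\<omega> \<in> space M. real n * t \<le> \<bar>\<Sum>l=1..n. (proj v l \<omega> / sqrt (qform \<Sigma> v))\<^sup>2 - 1\<bar>} \<le> 2 * exp (- real n * t\<^sup>2 / 16)"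
proof -
  have ind: "indep_vars (\<lambda>_. borel) (\<lambda>l \<omega>. (proj v l \<omega> / sqrt (qform \<Sigma> v))\<^sup>2 - 1) {1..n}"
    by (rule indep_vars_compose2[OF indep_proj]) measurable
  have "prob {\<omega> \<in> space M. real n * t \<le> \<bar>\<Sum>l=1..n. (proj v l \<omega> / sqrt (qform \<Sigma> v))\<^sup>2 - 1\<bar>}
    \<le> 2 * exp (real (card {1..n}) * (4 * (t / 8)\<^sup>2) - (t / 8) * (real n * t))"
  proof (rule chernoff_two_sided[OF _ ind])
    fix l assume l: "l \<in> {1..n}"
    show "(\<integral>\<^sup>+\<omega>. ennreal (exp (t / 8 * ((proj v l \<omega> / sqrt (qform \<Sigma> v))\<^sup>2 - 1))) \<partial>M) \<le> ennreal (exp (4 * (t / 8)\<^sup>2))"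
      by (rule std_normal_square_mgf[OF proj_std[OF l v]]) (use t in auto)
    show "(\<integral>\<^sup>+\<omega>. ennreal (exp (- (t / 8) * ((proj v l \<omega> / sqrt (qform \<Sigma> v))\<^sup>2 - 1))) \<partial>M) \<le> ennreal (exp (4 * (t / 8)\<^sup>2))"
      using std_normal_square_mgf[OF proj_std[OF l v], of "- (t / 8)"] t by simp
  qed (use t in auto)
  also have "real (card {1..n}) * (4 * (t / 8)\<^sup>2) - (t / 8) * (real n * t) = - real n * t\<^sup>2 / 16"
    by (simp add: power2_eq_square field_simps)
  finally show ?thesis .
qed

lemma prob_mean_deviation:
  assumes v: "0 < sqnorm p v" and u: "0 \<le> u"
  shows "prob {\<omega> \<in> space M. real n * u \<le> \<bar>\<Sum>l=1..n. proj v l \<omega> / sqrt (qform \<Sigma> v)\<bar>} \<le> 2 * exp (- real n * u\<^sup>2 / 2)"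
proof -
  have "prob {\<omega> \<in> space M. real n * u \<le> \<bar>\<Sum>l=1..n. proj v l \<omega> / sqrt (qform \<Sigma> v)\<bar>}
    \<le> 2 * exp (real (card {1..n}) * (u\<^sup>2 / 2) - u * (real n * u))"
  proof (rule chernoff_two_sided[OF _ indep_proj])
    fix l assume l: "l \<in> {1..n}"
    show "(\<integral>\<^sup>+\<omega>. ennreal (exp (u * (proj v l \<omega> / sqrt (qform \<Sigma> v)))) \<partial>M) \<le> ennreal (exp (u\<^sup>2 / 2))"
      using std_normal_mgf[OF proj_std[OF l v], of u] by simp
    show "(\<integral>\<^sup>+\<omega>. ennreal (exp (- u * (proj v l \<omega> / sqrt (qform \<Sigma> v)))) \<partial>M) \<le> ennreal (exp (u\<^sup>2 / 2))"
      using std_normal_mgf[OF proj_std[OF l v], of "- u"] by simp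
  qed (use u in auto)
  also have "real (card {1..n}) * (u\<^sup>2 / 2) - u * (real n * u) = - real n * u\<^sup>2 / 2"
    by (simp add: power2_eq_square field_simps)
  finally show ?thesis .
qed

text \<open>By independence, confining all \<open>n\<close> observations to a slab costs the \<open>n\<close>-th
  power of its width.\<close>

lemma prob_confined:
  assumes v: "1 \<le> sqnorm p v" and r: "0 \<le> r"
  shows "prob {\<omega> \<in> space M. \<forall>l\<in>{1..n}. \<bar>proj v l \<omega> - c\<bar> \<le> r} \<le> (r / sqrt lam) ^ n"
proof -
  have v0: "0 < sqnorm p v" using v by simp
  define q where "q = sqrt (qform \<Sigma> v)"
  have q: "sqrt lam \<le> q"
  proof -
    have "lam * 1 \<le> lam * sqnorm p v" using v lam_pos by (intro mult_left_mono) auto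
    then show ?thesis unfolding q_def using coerciveD(4)[OF Sigma, of v] by (intro real_sqrt_le_mono) linarith
  qed
  have q0: "0 < q" using q lam_pos by (meson less_le_trans real_sqrt_gt_zero)
  let ?A = "{x. \<bar>x - c / q\<bar> \<le> r / q}"
  have eq: "\<bar>proj v l \<omega> - c\<bar> \<le> r \<longleftrightarrow> proj v l \<omega> / q \<in> ?A" for l \<omega>
    using q0 by (simp add: diff_divide_distrib[symmetric] divide_le_cancel abs_divide)
  have "{\<omega> \<in> space M. \<forall>l\<in>{1..n}. \<bar>proj v l \<omega> - c\<bar> \<le> r} = (\<Inter>l\<in>{1..n}. (\<lambda>\<omega>. proj v l \<omega> / q) -` ?A \<inter> space M)"
    using n_pos unfolding eq by fastforce
  then have "prob {\<omega> \<in> space M. \<forall>l\<in>{1..n}. \<bar>proj v l \<omega> - c\<bar> \<le> r} = prob (\<Inter>l\<in>{1..n}. (\<lambda>\<omega>. proj v l \<omega> / q) -` ?A \<inter> space M)"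
    by simp
  also have "\<dots> = (\<Prod>l\<in>{1..n}. prob ((\<lambda>\<omega>. proj v l \<omega> / q) -` ?A \<inter> space M))"
    by (rule indep_varsD_finite[OF indep_proj]) (use n_pos in auto)
  also have "\<dots> \<le> (\<Prod>l\<in>{1..n}. r / sqrt lam)"
  proof (rule prod_mono, rule conjI)
    fix l assume l: "l \<in> {1..n}"
    have "(\<lambda>\<omega>. proj v l \<omega> / q) -` ?A \<inter> space M = {\<omega> \<in> space M. \<bar>proj v l \<omega> / q - c / q\<bar> \<le> r / q}" by auto
    then have "prob ((\<lambda>\<omega>. proj v l \<omega> / q) -` ?A \<inter> space M) \<le> r / q"
      using std_normal_interval[OF proj_std[OF l v0], of "r / q" "c / q"] r q0 by (simp add: q_def)
    also have "\<dots> \<le> r / sqrt lam" using r q lam_pos q0 by (intro divide_left_mono) auto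
    finally show "prob ((\<lambda>\<omega>. proj v l \<omega> / q) -` ?A \<inter> space M) \<le> r / sqrt lam" .
  qed simp
  finally show ?thesis by simp
qed

text \<open>The vectors \<open>e\<^sub>i + e\<^sub>j\<close>; by polarization the projections on them determine
  all empirical covariances. They are nonzero even for \<open>i = j\<close>, which keeps all variances
  positive.\<close>

definition pair_vec :: "nat \<Rightarrow> nat \<Rightarrow> nat \<Rightarrow> real" where
  "pair_vec i j k = of_bool (k = i) + of_bool (k = j)"

lemma proj_pair: "i < p \<Longrightarrow> j < p \<Longrightarrow> proj (pair_vec i j) l \<omega> = (X l \<omega> $ i - \<mu> $ i) + (X l \<omega> $ j - \<mu> $ j)"
  unfolding proj_def pair_vec_def distrib_right sum.distrib
  by (simp add: of_bool_def if_distrib if_distribR cong: if_cong)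

lemma sqnorm_pair:
  assumes "i < p" "j < p"
  shows "0 < sqnorm p (pair_vec i j)" "sqnorm p (pair_vec i j) \<le> 4"
proof -
  show "0 < sqnorm p (pair_vec i j)" by (rule sqnorm_pos[OF assms(1)]) (simp add: pair_vec_def)
  have "sqnorm p (pair_vec i j) \<le> (\<Sum>k<p. (if k = i then 2 else 0) + (if k = j then 2 else 0))"
    unfolding sqnorm_def by (intro sum_mono) (auto simp: pair_vec_def)
  also have "\<dots> = 4" using assms by (simp add: sum.distrib)
  finally show "sqnorm p (pair_vec i j) \<le> 4" .
qed

lemma qform_pair:
  assumes "i < p" "j < p"
  shows "qform \<Sigma> (pair_vec i j) = \<Sigma> $$ (i, i) + \<Sigma> $$ (j, j) + 2 * \<Sigma> $$ (i, j)"
proof -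
  note c = coerciveD(1)[OF Sigma]
  have "qform \<Sigma> (pair_vec i j) = (\<Sum>k<p. pair_vec i j k * mv \<Sigma> (pair_vec i j) k)"
    using c by (simp add: qform_eq_mv)
  also have "mv \<Sigma> (pair_vec i j) = (\<lambda>k. \<Sigma> $$ (k, i) + \<Sigma> $$ (k, j))"
    unfolding mv_def pair_vec_def distrib_left sum.distrib using c assms
    by (simp add: of_bool_def if_distrib cong: if_cong)
  also have "(\<Sum>k<p. pair_vec i j k * (\<Sigma> $$ (k, i) + \<Sigma> $$ (k, j))) = \<Sigma> $$ (i, i) + \<Sigma> $$ (i, j) + (\<Sigma> $$ (j, i) + \<Sigma> $$ (j, j))"
    unfolding pair_vec_def distrib_right sum.distrib using assms
    by (simp add: of_bool_def if_distrib if_distribR cong: if_cong)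
  finally show ?thesis using sym_matD[OF coerciveD(2)[OF Sigma] c assms(2,1)] by simp
qed

definition concentrated :: "real \<Rightarrow> 'a \<Rightarrow> bool" where
  "concentrated t \<omega> \<longleftrightarrow> (\<forall>i<p. \<forall>j<p.
     \<bar>\<Sum>l=1..n. (proj (pair_vec i j) l \<omega> / sqrt (qform \<Sigma> (pair_vec i j)))\<^sup>2 - 1\<bar> < real n * t \<and>
     \<bar>\<Sum>l=1..n. proj (pair_vec i j) l \<omega> / sqrt (qform \<Sigma> (pair_vec i j))\<bar> < real n * sqrt t)"

lemma concentratedD:
  assumes "concentrated t \<omega>" "i < p" "j < p"
  shows "\<bar>\<Sum>l=1..n. (proj (pair_vec i j) l \<omega> / sqrt (qform \<Sigma> (pair_vec i j)))\<^sup>2 - 1\<bar> < real n * t"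
    "\<bar>\<Sum>l=1..n. proj (pair_vec i j) l \<omega> / sqrt (qform \<Sigma> (pair_vec i j))\<bar> < real n * sqrt t"
  using assms by (simp_all add: concentrated_def)

lemma prob_not_concentrated:
  assumes t: "0 \<le> t" "t \<le> 2"
  shows "prob {\<omega> \<in> space M. \<not> concentrated t \<omega>} \<le> 4 * (real p)\<^sup>2 * exp (- real n * t\<^sup>2 / 16)"
proof -
  let ?W = "\<lambda>i j l \<omega>. proj (pair_vec i j) l \<omega> / sqrt (qform \<Sigma> (pair_vec i j))"
  define A where "A i j = {\<omega> \<in> space M. real n * t \<le> \<bar>\<Sum>l=1..n. (?W i j l \<omega>)\<^sup>2 - 1\<bar>}" for i j
  define B where "B i j = {\<omega> \<in> space M. real n * sqrt t \<le> \<bar>\<Sum>l=1..n. ?W i j l \<omega>\<bar>}" for i j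
  have AB[measurable]: "A i j \<in> events" "B i j \<in> events" for i j unfolding A_def B_def by measurable
  have e: "{\<omega> \<in> space M. \<not> concentrated t \<omega>} = (\<Union>i\<in>{..<p}. \<Union>j\<in>{..<p}. A i j \<union> B i j)"
    unfolding concentrated_def A_def B_def by (auto simp: not_less)
  have one: "prob (A i j \<union> B i j) \<le> 4 * exp (- real n * t\<^sup>2 / 16)" if ij: "i < p" "j < p" for i j
  proof -
    have "prob (A i j \<union> B i j) \<le> prob (A i j) + prob (B i j)" by (rule measure_Un_le) (rule AB)+
    also have "\<dots> \<le> 2 * exp (- real n * t\<^sup>2 / 16) + 2 * exp (- real n * (sqrt t)\<^sup>2 / 2)"
      unfolding A_def B_def using t sqnorm_pair(1)[OF ij]
      by (intro add_mono prob_square_deviation prob_mean_deviation) auto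
    also have "exp (- real n * (sqrt t)\<^sup>2 / 2) \<le> exp (- real n * t\<^sup>2 / 16)"
    proof -
      have "t\<^sup>2 \<le> 8 * t" using t by (simp add: power2_eq_square mult_right_mono)
      then have "real n * t\<^sup>2 \<le> real n * (8 * t)" by (intro mult_left_mono) auto
      then show ?thesis using t by simp
    qed
    finally show ?thesis by simp
  qed
  have "prob (\<Union>i\<in>{..<p}. \<Union>j\<in>{..<p}. A i j \<union> B i j) \<le> (\<Sum>i<p. prob (\<Union>j\<in>{..<p}. A i j \<union> B i j))"
    by (rule measure_UNION_le) auto
  also have "\<dots> \<le> (\<Sum>i<p. \<Sum>j<p. prob (A i j \<union> B i j))"
    by (intro sum_mono measure_UNION_le) auto
  also have "\<dots> \<le> (\<Sum>i<p. \<Sum>j<p. 4 * exp (- real n * t\<^sup>2 / 16))"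
    by (intro sum_mono one) auto
  also have "\<dots> = 4 * (real p)\<^sup>2 * exp (- real n * t\<^sup>2 / 16)" by (simp add: power2_eq_square)
  finally show ?thesis unfolding e .
qed

lemma Lam_pos: "0 < Lam"
proof -
  have "0 < qform \<Sigma> (pair_vec 0 0)" using qform_Sigma_pos sqnorm_pair(1)[OF p_pos p_pos] by auto
  also have "\<dots> \<le> Lam * sqnorm p (pair_vec 0 0)" by (rule Sigma_le)
  finally show ?thesis using sqnorm_nonneg[of p "pair_vec 0 0"] by (simp add: zero_less_mult_iff)
qed

lemma qform_pair_le:
  assumes "i < p" "j < p"
  shows "qform \<Sigma> (pair_vec i j) \<le> 4 * Lam"
proof -
  have "qform \<Sigma> (pair_vec i j) \<le> Lam * sqnorm p (pair_vec i j)" by (rule Sigma_le)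
  also have "\<dots> \<le> Lam * 4" using Lam_pos sqnorm_pair(2)[OF assms] by (intro mult_left_mono) auto
  finally show ?thesis by simp
qed

definition mean_dev :: "nat \<Rightarrow> 'a \<Rightarrow> real" where
  "mean_dev i \<omega> = (\<Sum>l=1..n. X l \<omega> $ i - \<mu> $ i) / real n"

lemma concentrated_mean:
  assumes c: "concentrated t \<omega>" and i: "i < p" and t: "0 \<le> t"
  shows "\<bar>mean_dev i \<omega>\<bar> \<le> sqrt (Lam * t)"
proof -
  define q where "q = sqrt (qform \<Sigma> (pair_vec i i))"
  have q0: "0 < q" using qform_Sigma_pos[OF sqnorm_pair(1)[OF i i]] by (simp add: q_def)
  have q2: "q \<le> 2 * sqrt Lam"
  proof -
    have "q \<le> sqrt (4 * Lam)" unfolding q_def by (rule real_sqrt_le_mono[OF qform_pair_le[OF i i]])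
    then show ?thesis by (simp add: real_sqrt_mult)
  qed
  have sX: "(\<Sum>l=1..n. X l \<omega> $ i - \<mu> $ i) = real n * mean_dev i \<omega>" using n_pos by (simp add: mean_dev_def)
  have "(\<Sum>l=1..n. proj (pair_vec i i) l \<omega> / q) = (2 * (\<Sum>l=1..n. X l \<omega> $ i - \<mu> $ i)) / q"
    unfolding sum_divide_distrib[symmetric] sum_distrib_left by (simp add: proj_pair[OF i i])
  then have e: "(\<Sum>l=1..n. proj (pair_vec i i) l \<omega> / q) = 2 * real n * mean_dev i \<omega> / q"
    unfolding sX by simp
  have "\<bar>2 * real n * mean_dev i \<omega> / q\<bar> < real n * sqrt t"
    unfolding e[symmetric] using concentratedD(2)[OF c i i] by (simp only: q_def)
  then have "real n * \<bar>mean_dev i \<omega>\<bar> \<le> real n * (sqrt t * q / 2)"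
    using q0 by (simp add: abs_mult abs_divide field_simps)
  then have "\<bar>mean_dev i \<omega>\<bar> \<le> sqrt t * q / 2" using n_pos by simp
  also have "\<dots> \<le> sqrt t * (2 * sqrt Lam) / 2" using q2 t by (intro divide_right_mono mult_left_mono) auto
  finally show ?thesis by (simp add: real_sqrt_mult mult.commute)
qed

lemma S_index:
  assumes "i < p" "j < p"
  shows "S \<omega> $$ (i, j) = (\<Sum>l=1..n. (X l \<omega> $ i - \<mu> $ i) * (X l \<omega> $ j - \<mu> $ j)) / real n - mean_dev i \<omega> * mean_dev j \<omega>"
  unfolding S_def mean_dev_def by (rule emp_cov_index[OF assms n_pos])

text \<open>Polarization: \<open>x\<^sub>i x\<^sub>j\<close> is recovered from the squares of \<open>x\<^sub>i +
  x\<^sub>j\<close>, \<open>2 x\<^sub>i\<close> and \<open>2 x\<^sub>j\<close>, with total weight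
  \<open>3 / 4\<close>; each square is off by at most \<open>4 Lam t\<close>. The correction by the
  empirical means contributes another \<open>Lam t\<close>.\<close>

lemma concentrated_S:
  assumes c: "concentrated t \<omega>" and ij: "i < p" "j < p" and t: "0 \<le> t"
  shows "\<bar>S \<omega> $$ (i, j) - \<Sigma> $$ (i, j)\<bar> \<le> 4 * Lam * t"
proof -
  define D where "D i j = (\<Sum>l=1..n. (proj (pair_vec i j) l \<omega>)\<^sup>2) / real n - qform \<Sigma> (pair_vec i j)" for i j
  have D: "\<bar>D i j\<bar> \<le> 4 * Lam * t" if ij: "i < p" "j < p" for i j
  proof -
    define q where "q = qform \<Sigma> (pair_vec i j)"
    have q0: "0 < q" using qform_Sigma_pos[OF sqnorm_pair(1)[OF ij]] by (simp add: q_def)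
    have e: "(\<Sum>l=1..n. (proj (pair_vec i j) l \<omega> / sqrt q)\<^sup>2 - 1) = real n * (D i j / q)"
      using n_pos q0 by (simp add: D_def q_def[symmetric] power_divide sum_subtractf sum_divide_distrib[symmetric] field_simps)
    have "\<bar>real n * (D i j / q)\<bar> < real n * t"
      unfolding e[symmetric] using concentratedD(1)[OF c ij] by (simp only: q_def)
    then have "real n * \<bar>D i j / q\<bar> < real n * t" by (simp only: abs_mult abs_of_nat)
    then have "\<bar>D i j / q\<bar> < t" using n_pos by (simp only: mult_less_cancel_left_pos of_nat_0_less_iff)
    then have "\<bar>D i j\<bar> < t * q" using q0 by (simp add: abs_divide pos_divide_less_eq)
    also have "\<dots> \<le> t * (4 * Lam)" using t qform_pair_le[OF ij] by (intro mult_left_mono) (auto simp: q_def)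
    finally show ?thesis by (simp add: mult_ac)
  qed
  define A where "A i j = (\<Sum>l=1..n. (X l \<omega> $ i - \<mu> $ i) * (X l \<omega> $ j - \<mu> $ j)) / real n" for i j
  have DA: "D i j = A i i + A j j + 2 * A i j - (\<Sigma> $$ (i, i) + \<Sigma> $$ (j, j) + 2 * \<Sigma> $$ (i, j))" if ij: "i < p" "j < p" for i j
  proof -
    have "(\<Sum>l=1..n. (proj (pair_vec i j) l \<omega>)\<^sup>2) = (\<Sum>l=1..n. (X l \<omega> $ i - \<mu> $ i) * (X l \<omega> $ i - \<mu> $ i)
       + (X l \<omega> $ j - \<mu> $ j) * (X l \<omega> $ j - \<mu> $ j) + 2 * ((X l \<omega> $ i - \<mu> $ i) * (X l \<omega> $ j - \<mu> $ j)))"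
      unfolding proj_pair[OF ij] by (intro sum.cong refl) (simp add: power2_eq_square algebra_simps)
    then show ?thesis
      by (simp only: D_def A_def qform_pair[OF ij] sum.distrib sum_distrib_left[symmetric] add_divide_distrib times_divide_eq_right)
  qed
  have e: "A i j - \<Sigma> $$ (i, j) = (D i j - D i i / 4 - D j j / 4) / 2"
    using DA[OF ij] DA[OF ij(1,1)] DA[OF ij(2,2)] by (simp add: field_simps)
  have a: "\<bar>A i j - \<Sigma> $$ (i, j)\<bar> \<le> 3 * Lam * t"
    using D[OF ij] D[OF ij(1,1)] D[OF ij(2,2)] unfolding e by (auto simp: abs_le_iff)
  have "\<bar>mean_dev i \<omega> * mean_dev j \<omega>\<bar> \<le> sqrt (Lam * t) * sqrt (Lam * t)"
    unfolding abs_mult using concentrated_mean[OF c ij(1) t] concentrated_mean[OF c ij(2) t] t Lam_pos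
    by (intro mult_mono) auto
  then have b: "\<bar>mean_dev i \<omega> * mean_dev j \<omega>\<bar> \<le> Lam * t" using t Lam_pos by simp
  have "S \<omega> $$ (i, j) - \<Sigma> $$ (i, j) = (A i j - \<Sigma> $$ (i, j)) - mean_dev i \<omega> * mean_dev j \<omega>"
    by (simp add: S_index[OF ij] A_def)
  then show ?thesis using a b by (simp add: abs_le_iff)
qed

end

section \<open>Vanishing entries and the smallest eigenvalue\<close>

text \<open>Fubini in the coordinate \<open>i\<close>: a line meets the hyperplane in one point.\<close>

lemma AE_PiM_coordinate_neq:
  assumes I: "finite I" and i: "i \<in> (I :: nat set)"
  shows "AE x in (\<Pi>\<^sub>M i\<in>I. (lborel :: real measure)). x i \<noteq> c"
proof -
  interpret product_sigma_finite "\<lambda>_::nat. lborel :: real measure" by standard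
  define J where "J = I - {i}"
  have J: "finite J" "i \<notin> J" "I = insert i J" using I i by (auto simp: J_def)
  have m: "{x \<in> space (\<Pi>\<^sub>M i\<in>I. (lborel :: real measure)). x i = c} \<in> sets (\<Pi>\<^sub>M i\<in>I. lborel)"
    using i by measurable
  have "emeasure (\<Pi>\<^sub>M i\<in>I. lborel) {x \<in> space (\<Pi>\<^sub>M i\<in>I. (lborel :: real measure)). x i = c}
    = (\<integral>\<^sup>+x. indicator {x \<in> space (\<Pi>\<^sub>M i\<in>I. (lborel :: real measure)). x i = c} x \<partial>(\<Pi>\<^sub>M i\<in>I. lborel))"
    using m by simp
  also have "\<dots> = (\<integral>\<^sup>+x. (\<integral>\<^sup>+y. indicator {x \<in> space (\<Pi>\<^sub>M i\<in>I. (lborel :: real measure)). x i = c} (x(i := y)) \<partial>lborel) \<partial>(\<Pi>\<^sub>M i\<in>J. lborel))"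
    unfolding J(3) by (rule product_nn_integral_insert[OF J(1,2)]) (use m in \<open>simp add: J(3)[symmetric]\<close>)
  also have "\<dots> = (\<integral>\<^sup>+x. 0 \<partial>(\<Pi>\<^sub>M i\<in>J. (lborel :: real measure)))"
  proof (rule nn_integral_cong)
    fix x :: "nat \<Rightarrow> real"
    have "(\<integral>\<^sup>+y. indicator {x \<in> space (\<Pi>\<^sub>M i\<in>I. (lborel :: real measure)). x i = c} (x(i := y)) \<partial>lborel)
      \<le> (\<integral>\<^sup>+y. indicator {c} y \<partial>lborel)"
      by (intro nn_integral_mono) (auto simp: indicator_def)
    also have "\<dots> = 0" by simp
    finally show "(\<integral>\<^sup>+y. indicator {x \<in> space (\<Pi>\<^sub>M i\<in>I. (lborel :: real measure)). x i = c} (x(i := y)) \<partial>lborel) = 0" by simp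
  qed
  finally have "emeasure (\<Pi>\<^sub>M i\<in>I. lborel) {x \<in> space (\<Pi>\<^sub>M i\<in>I. (lborel :: real measure)). x i = c} = 0" by simp
  then show ?thesis using m by (subst AE_iff_measurable[OF m]) auto
qed

text \<open>As a function of \<open>x\<^sub>j\<close> the expression is affine with slope \<open>A x\<^sub>i +
  C\<close>, which vanishes only on a hyperplane.\<close>

lemma bilinear_zero_set_null:
  fixes A B C D :: real
  assumes I: "finite I" and ij: "i \<in> I" "j \<in> (I :: nat set)" "i \<noteq> j" and A: "A \<noteq> 0"
  shows "(\<integral>\<^sup>+x. indicator {x. A * x i * x j + B * x i + C * x j + D = 0} x \<partial>(\<Pi>\<^sub>M i\<in>I. (lborel :: real measure))) = 0"
proof -
  interpret product_sigma_finite "\<lambda>_::nat. lborel :: real measure" by standard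
  define J where "J = I - {j}"
  have J: "finite J" "j \<notin> J" "I = insert j J" "i \<in> J" using I ij by (auto simp: J_def)
  let ?Z = "{x. A * x i * x j + B * x i + C * x j + D = 0}"
  let ?f = "\<lambda>x. indicator ?Z x :: ennreal"
  have m: "?f \<in> borel_measurable (\<Pi>\<^sub>M i\<in>I. (lborel :: real measure))"
  proof -
    have [measurable]: "(\<lambda>x. x i) \<in> borel_measurable (\<Pi>\<^sub>M i\<in>I. (lborel :: real measure))"
      "(\<lambda>x. x j) \<in> borel_measurable (\<Pi>\<^sub>M i\<in>I. (lborel :: real measure))"
      using measurable_component_singleton[OF ij(1), of "\<lambda>_. lborel"]
        measurable_component_singleton[OF ij(2), of "\<lambda>_. lborel"] by (simp_all cong: measurable_cong_sets)
    show ?thesis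
      by (rule borel_measurable_indicator') measurable
  qed
  have "(\<integral>\<^sup>+x. ?f x \<partial>(\<Pi>\<^sub>M i\<in>I. lborel)) = (\<integral>\<^sup>+x. (\<integral>\<^sup>+y. ?f (x(j := y)) \<partial>lborel) \<partial>(\<Pi>\<^sub>M i\<in>J. lborel))"
    unfolding J(3) by (rule product_nn_integral_insert[OF J(1,2)]) (use m in \<open>simp add: J(3)[symmetric]\<close>)
  also have "\<dots> = (\<integral>\<^sup>+x. 0 \<partial>(\<Pi>\<^sub>M i\<in>J. (lborel :: real measure)))"
  proof (rule nn_integral_cong_AE)
    show "AE x in (\<Pi>\<^sub>M i\<in>J. (lborel :: real measure)). (\<integral>\<^sup>+y. ?f (x(j := y)) \<partial>lborel) = 0"
      using AE_PiM_coordinate_neq[OF J(1,4), of "- C / A"]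
    proof eventually_elim
      case (elim x)
      then have ne: "A * x i + C \<noteq> 0" using A by (simp add: field_simps)
      have "(\<integral>\<^sup>+y. ?f (x(j := y)) \<partial>lborel) \<le> (\<integral>\<^sup>+y. indicator {- (B * x i + D) / (A * x i + C)} y \<partial>lborel)"
      proof (intro nn_integral_mono)
        fix y
        have "y = - (B * x i + D) / (A * x i + C)" if "A * x i * y + B * x i + C * y + D = 0"
        proof -
          have "y * (A * x i + C) = - (B * x i + D)" using that by (simp add: algebra_simps add_eq_0_iff2)
          then show ?thesis using ne by (simp only: eq_divide_eq) simp
        qed
        then show "?f (x(j := y)) \<le> indicator {- (B * x i + D) / (A * x i + C)} y"
          using ij(3) by (simp add: indicator_def)
      qed
      also have "\<dots> = 0" by simp
      finally show ?case by simp
    qed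
  qed
  finally show ?thesis by simp
qed

lemma floor_grid_approx:
  assumes "0 < N"
  shows "\<bar>real_of_int \<lfloor>x * real N\<rfloor> / real N - x\<bar> \<le> 1 / real N"
proof -
  have "\<bar>real_of_int \<lfloor>x * real N\<rfloor> - x * real N\<bar> \<le> 1" by linarith
  then have "\<bar>(real_of_int \<lfloor>x * real N\<rfloor> - x * real N) / real N\<bar> \<le> 1 / real N"
    using assms by (simp add: abs_divide divide_right_mono)
  moreover have "(real_of_int \<lfloor>x * real N\<rfloor> - x * real N) / real N = real_of_int \<lfloor>x * real N\<rfloor> / real N - x"
    using assms by (simp add: field_simps)
  ultimately show ?thesis by simp
qed

context gaussian_sample
begin

lemma X_bilinear_zero_set_null:
  fixes A B C D :: real
  assumes l: "l \<in> {1..n}" and ij: "i < p" "j < p" "i \<noteq> j" and A: "A \<noteq> 0"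
  shows "emeasure (distr M (vec_lborel p) (X l))
    {x \<in> space (vec_lborel p). A * x $ i * x $ j + B * x $ i + C * x $ j + D = 0} = 0"
proof -
  let ?Q = "{x \<in> space (vec_lborel p). A * x $ i * x $ j + B * x $ i + C * x $ j + D = 0}"
  have [measurable]: "(\<lambda>x. x $ i) \<in> borel_measurable (vec_lborel p)" "(\<lambda>x. x $ j) \<in> borel_measurable (vec_lborel p)"
    using ij by (auto intro: measurable_vec_index)
  have Q: "?Q \<in> sets (vec_lborel p)" by measurable
  have "(\<integral>\<^sup>+x. indicator ?Q x \<partial>vec_lborel p) = (\<integral>\<^sup>+x. indicator ?Q (vec p x) \<partial>(\<Pi>\<^sub>M i\<in>{..<p}. (lborel :: real measure)))"
    by (rule nn_integral_vec_lborel) (use Q in simp)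
  also have "\<dots> = (\<integral>\<^sup>+x. indicator {x. A * x i * x j + B * x i + C * x j + D = 0} x \<partial>(\<Pi>\<^sub>M i\<in>{..<p}. (lborel :: real measure)))"
    using ij by (intro nn_integral_cong) (simp add: indicator_def space_vec_lborel)
  also have "\<dots> = 0" by (rule bilinear_zero_set_null) (use ij A in auto)
  finally have "emeasure (vec_lborel p) ?Q = 0" using Q by simp
  then have "?Q \<in> null_sets (vec_lborel p)" using Q by (auto simp: null_sets_def)
  then have "AE x in vec_lborel p. x \<notin> ?Q" by (rule AE_not_in)
  then have "(\<integral>\<^sup>+x. ennreal (mvn_density \<mu> \<Sigma> x) * indicator ?Q x \<partial>vec_lborel p) = (\<integral>\<^sup>+x. 0 \<partial>vec_lborel p)"
    by (intro nn_integral_cong_AE) (auto simp: indicator_def)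
  then show ?thesis
    unfolding distributed_distr_eq_density[OF normal[OF l]]
    using emeasure_density[OF distributed_borel_measurable[OF normal[OF l]] Q] by simp
qed

text \<open>Conditionally on the observations \<open>2, \<dots>, n\<close>, the entry is a bilinear expression
  in the coordinates \<open>i\<close> and \<open>j\<close> of the first one, with the nonzero leading
  coefficient \<open>(n - 1) / n\<^sup>2\<close>. The other observations enter through three sums
  only.\<close>

lemma prob_S_zero:
  assumes n: "2 \<le> n" and ij: "i < p" "j < p" "i \<noteq> j"
  shows "prob {\<omega> \<in> space M. S \<omega> $$ (i, j) = 0} = 0"
proof -
  have one: "1 \<in> {1..n}" using n by simp
  define T where "T x = (\<Sum>l\<in>{2..n}. x l $ i, \<Sum>l\<in>{2..n}. x l $ j, \<Sum>l\<in>{2..n}. x l $ i * x l $ j)" for x :: "nat \<Rightarrow> real vec"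
  define TX where "TX \<omega> = T (\<lambda>l. X l \<omega>)" for \<omega>
  let ?B = "borel \<Otimes>\<^sub>M borel \<Otimes>\<^sub>M borel :: (real \<times> real \<times> real) measure"
  have [measurable]: "(\<lambda>x. x $ i) \<in> borel_measurable (vec_lborel p)" "(\<lambda>x. x $ j) \<in> borel_measurable (vec_lborel p)"
    using ij by (auto intro: measurable_vec_index)
  have comp: "(\<lambda>x. x l $ k) \<in> borel_measurable (PiM L (\<lambda>_. vec_lborel p))" if "l \<in> L" "k < p" for l k L
    using measurable_compose[OF measurable_component_singleton[OF that(1), of "\<lambda>_. vec_lborel p"] measurable_vec_index[OF that(2)]] .
  have Tm: "T \<in> PiM {2..n} (\<lambda>_. vec_lborel p) \<rightarrow>\<^sub>M ?B"
    unfolding T_def by (intro measurable_Pair borel_measurable_sum borel_measurable_times comp ij) auto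
  have iv: "indep_var (PiM {2..n} (\<lambda>_. vec_lborel p)) (\<lambda>\<omega>. restrict (\<lambda>l. X l \<omega>) {2..n})
     (PiM {1} (\<lambda>_. vec_lborel p)) (\<lambda>\<omega>. restrict (\<lambda>l. X l \<omega>) {1})"
    by (rule indep_var_restrict[OF indep]) (use n in auto)
  (* Independence is stated for variables with values in one type, hence the dummy third component. *)
  define V where "V x = (x $ i, x $ j, 0 :: real)" for x :: "real vec"
  have Vm: "V \<in> vec_lborel p \<rightarrow>\<^sub>M ?B" unfolding V_def by measurable
  have X1: "X 1 \<in> M \<rightarrow>\<^sub>M vec_lborel p" by (rule distributed_measurable[OF normal[OF one]])
  define VX where "VX \<omega> = V (X 1 \<omega>)" for \<omega>
  have iv2: "indep_var ?B (T \<circ> (\<lambda>\<omega>. restrict (\<lambda>l. X l \<omega>) {2..n})) ?B ((\<lambda>x. V (x 1)) \<circ> (\<lambda>\<omega>. restrict (\<lambda>l. X l \<omega>) {1}))"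
    by (rule indep_var_compose[OF iv Tm], rule measurable_compose[OF _ Vm], rule measurable_component_singleton) simp
  have TX: "T \<circ> (\<lambda>\<omega>. restrict (\<lambda>l. X l \<omega>) {2..n}) = TX"
    by (rule ext) (simp add: TX_def T_def)
  have VX: "(\<lambda>x. V (x 1)) \<circ> (\<lambda>\<omega>. restrict (\<lambda>l. X l \<omega>) {1}) = VX" by (rule ext) (simp add: VX_def)
  have rv: "random_variable ?B TX" "random_variable ?B VX"
    and joint: "distr M ?B TX \<Otimes>\<^sub>M distr M ?B VX = distr M (?B \<Otimes>\<^sub>M ?B) (\<lambda>\<omega>. (TX \<omega>, VX \<omega>))"
    using iv2 unfolding TX VX indep_var_distribution_eq by auto
  define q where "q z = (real n - 1) * fst (snd z) * fst (snd (snd z)) + (- fst (snd (fst z))) * fst (snd z)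
     + (- fst (fst z)) * fst (snd (snd z)) + (real n * snd (snd (fst z)) - fst (fst z) * fst (snd (fst z)))"
    for z :: "(real \<times> real \<times> real) \<times> (real \<times> real \<times> real)"
  define Q where "Q = {z \<in> space (?B \<Otimes>\<^sub>M ?B). q z = 0}"
  have qm[measurable]: "q \<in> borel_measurable (?B \<Otimes>\<^sub>M ?B)" unfolding q_def by measurable
  have Q: "Q \<in> sets (?B \<Otimes>\<^sub>M ?B)" unfolding Q_def by measurable
  have S_q: "(real n)\<^sup>2 * S \<omega> $$ (i, j) = q (TX \<omega>, VX \<omega>)" for \<omega>
  proof -
    have sp: "(\<Sum>l=1..n. f l) = f 1 + (\<Sum>l\<in>{2..n}. f l)" for f :: "nat \<Rightarrow> real"
      using n by (simp add: sum.atLeast_Suc_atMost numeral_2_eq_2)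
    have "S \<omega> $$ (i, j) = (\<Sum>l=1..n. X l \<omega> $ i * X l \<omega> $ j) / real n - ((\<Sum>l=1..n. X l \<omega> $ i) / real n) * ((\<Sum>l=1..n. X l \<omega> $ j) / real n)"
      using emp_cov_index[OF ij(1,2) n_pos, of "\<lambda>l. X l \<omega>" "\<lambda>_. 0"] by (simp add: S_def)
    then have "(real n)\<^sup>2 * S \<omega> $$ (i, j) = real n * (\<Sum>l=1..n. X l \<omega> $ i * X l \<omega> $ j) - (\<Sum>l=1..n. X l \<omega> $ i) * (\<Sum>l=1..n. X l \<omega> $ j)"
      using n_pos by (simp add: power2_eq_square right_diff_distrib)
    then show ?thesis unfolding sp by (simp add: q_def TX_def T_def VX_def V_def algebra_simps)
  qed
  have zero_iff: "S \<omega> $$ (i, j) = 0 \<longleftrightarrow> q (TX \<omega>, VX \<omega>) = 0" for \<omega>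
    unfolding S_q[symmetric] using n_pos by simp
  have "{\<omega> \<in> space M. S \<omega> $$ (i, j) = 0} = (\<lambda>\<omega>. (TX \<omega>, VX \<omega>)) -` Q \<inter> space M"
    using zero_iff by (auto simp: Q_def space_pair_measure)
  then have "emeasure M {\<omega> \<in> space M. S \<omega> $$ (i, j) = 0} = emeasure (distr M (?B \<Otimes>\<^sub>M ?B) (\<lambda>\<omega>. (TX \<omega>, VX \<omega>))) Q"
    using rv Q by (subst emeasure_distr) (auto intro: measurable_Pair)
  also have "\<dots> = emeasure (distr M ?B TX \<Otimes>\<^sub>M distr M ?B VX) Q" by (simp only: joint)
  also have "\<dots> = (\<integral>\<^sup>+t. emeasure (distr M ?B VX) (Pair t -` Q) \<partial>distr M ?B TX)"
  proof -
    interpret D: prob_space "distr M ?B VX" by (rule prob_space_distr[OF rv(2)])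
    have "sets (distr M ?B TX \<Otimes>\<^sub>M distr M ?B VX) = sets (?B \<Otimes>\<^sub>M ?B)"
      by (intro sets_pair_measure_cong) auto
    then show ?thesis using Q by (intro D.emeasure_pair_measure_alt) simp
  qed
  also have "\<dots> = (\<integral>\<^sup>+t. 0 \<partial>distr M ?B TX)"
  proof (rule nn_integral_cong)
    fix t
    let ?Q = "{x \<in> space (vec_lborel p). (real n - 1) * x $ i * x $ j + (- fst (snd t)) * x $ i
     + (- fst t) * x $ j + (real n * snd (snd t) - fst t * fst (snd t)) = 0}"
    have "emeasure (distr M ?B VX) (Pair t -` Q) = emeasure M (VX -` (Pair t -` Q) \<inter> space M)"
      by (rule emeasure_distr[OF rv(2) sets_Pair1[OF Q]])
    also have "VX -` (Pair t -` Q) \<inter> space M = X 1 -` ?Q \<inter> space M"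
      using measurable_space[OF X1] by (auto simp: Q_def q_def VX_def V_def space_pair_measure)
    also have "emeasure M (X 1 -` ?Q \<inter> space M) = emeasure (distr M (vec_lborel p) (X 1)) ?Q"
      by (rule emeasure_distr[OF X1, symmetric]) measurable
    also have "\<dots> = 0" by (rule X_bilinear_zero_set_null[OF one ij]) (use n in simp)
    finally show "emeasure (distr M ?B VX) (Pair t -` Q) = 0" .
  qed
  finally show ?thesis by (simp add: measure_def)
qed

definition grid :: "nat \<Rightarrow> (nat \<Rightarrow> int) set" where
  "grid N = {k \<in> {..<p} \<rightarrow>\<^sub>E {- int N..int N}. \<exists>i<p. \<bar>k i\<bar> = int N}"

text \<open>The index \<open>k\<close> gives the direction and \<open>c\<close> the offset of the hyperplane,
  both in multiples of \<open>1 / N\<close>; \<open>grid\<close> keeps the directions of maximum norm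
  \<open>1\<close>.\<close>

definition near_hyperplane :: "nat \<Rightarrow> real \<Rightarrow> 'a \<Rightarrow> bool" where
  "near_hyperplane N r \<omega> \<longleftrightarrow> (\<exists>k\<in>grid N. \<exists>c\<in>{- int (n * N)..int (n * N)}.
     \<forall>l\<in>{1..n}. \<bar>proj (\<lambda>i. real_of_int (k i) / real N) l \<omega> - real_of_int c / real N\<bar> \<le> r)"

lemma finite_grid: "finite (grid N)"
  unfolding grid_def by (rule finite_subset[of _ "{..<p} \<rightarrow>\<^sub>E {- int N..int N}"]) (auto intro: finite_PiE)

lemma card_grid: "card (grid N) \<le> (2 * N + 1) ^ p"
proof -
  have "card (grid N) \<le> card ({..<p} \<rightarrow>\<^sub>E {- int N..int N})"
    unfolding grid_def by (rule card_mono) (auto intro: finite_PiE)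
  also have "\<dots> = (2 * N + 1) ^ p" 
  proof -
    have "nat (int N - - int N + 1) = 2 * N + 1" by simp
    then show ?thesis by (simp only: card_PiE[OF finite_lessThan] card_atLeastAtMost_int prod_constant card_lessThan)
  qed
  finally show ?thesis .
qed

lemma prob_near_hyperplane:
  assumes N: "0 < N" and r: "0 \<le> r"
  shows "prob {\<omega> \<in> space M. near_hyperplane N r \<omega>}
    \<le> real ((2 * N + 1) ^ p) * real (2 * n * N + 1) * (r / sqrt lam) ^ n"
proof -
  let ?C = "{- int (n * N)..int (n * N)}"
  define E where "E k c = {\<omega> \<in> space M. \<forall>l\<in>{1..n}. \<bar>proj (\<lambda>i. real_of_int (k i) / real N) l \<omega> - real_of_int c / real N\<bar> \<le> r}"
    for k :: "nat \<Rightarrow> int" and c :: int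
  have Em: "E k c \<in> events" for k c unfolding E_def by measurable
  have e: "{\<omega> \<in> space M. near_hyperplane N r \<omega>} = (\<Union>k\<in>grid N. \<Union>c\<in>?C. E k c)"
    by (auto simp: near_hyperplane_def E_def)
  have r0: "0 \<le> (r / sqrt lam) ^ n" using r lam_pos by simp
  have one: "prob (E k c) \<le> (r / sqrt lam) ^ n" if k: "k \<in> grid N" for k c
    unfolding E_def
  proof (rule prob_confined[OF _ r])
    obtain i where i: "i < p" "\<bar>k i\<bar> = int N" using k by (auto simp: grid_def)
    have "(real_of_int (k i) / real N)\<^sup>2 = 1"
    proof -
      have "\<bar>real_of_int (k i)\<bar> = real N" using i(2) by (metis of_int_abs of_int_of_nat_eq)
      then have "(real_of_int (k i))\<^sup>2 = (real N)\<^sup>2" by (metis power2_abs)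
      then show ?thesis using N by (simp add: power_divide)
    qed
    moreover have "(real_of_int (k i) / real N)\<^sup>2 \<le> sqnorm p (\<lambda>i. real_of_int (k i) / real N)"
      unfolding sqnorm_def by (rule member_le_sum) (use i in auto)
    ultimately show "1 \<le> sqnorm p (\<lambda>i. real_of_int (k i) / real N)" by simp
  qed
  have "prob (\<Union>k\<in>grid N. \<Union>c\<in>?C. E k c) \<le> (\<Sum>k\<in>grid N. prob (\<Union>c\<in>?C. E k c))"
    by (rule measure_UNION_le[OF finite_grid]) (use Em in auto)
  also have "\<dots> \<le> (\<Sum>k\<in>grid N. \<Sum>c\<in>?C. prob (E k c))"
    by (intro sum_mono measure_UNION_le) (use Em in auto)
  also have "\<dots> \<le> (\<Sum>k\<in>grid N. \<Sum>c\<in>?C. (r / sqrt lam) ^ n)"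
    by (intro sum_mono one)
  also have "\<dots> = real (card (grid N)) * (real (card ?C) * (r / sqrt lam) ^ n)" by simp
  also have "real (card ?C) = real (2 * n * N + 1)" by (simp add: nat_add_distrib nat_mult_distrib)
  also have "real (card (grid N)) * (real (2 * n * N + 1) * (r / sqrt lam) ^ n)
     \<le> real ((2 * N + 1) ^ p) * (real (2 * n * N + 1) * (r / sqrt lam) ^ n)"
    using card_grid[of N] r0 by (intro mult_right_mono) (auto simp del: of_nat_power)
  finally show ?thesis unfolding e by (simp only: mult.assoc)
qed

text \<open>The coordinates of the observations after subtraction of the empirical mean.\<close>

definition centred :: "nat \<Rightarrow> nat \<Rightarrow> 'a \<Rightarrow> real" where
  "centred l i \<omega> = X l \<omega> $ i - \<mu> $ i - mean_dev i \<omega>"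

lemma S_index_centred:
  assumes "i < p" "j < p"
  shows "S \<omega> $$ (i, j) = (\<Sum>l=1..n. centred l i \<omega> * centred l j \<omega>) / real n"
proof -
  have z: "(\<Sum>l=1..n. X l \<omega> $ i - (\<mu> $ i + mean_dev i \<omega>)) = 0" for i
  proof -
    have "(\<Sum>l=1..n. X l \<omega> $ i - (\<mu> $ i + mean_dev i \<omega>)) = (\<Sum>l=1..n. X l \<omega> $ i - \<mu> $ i) - real n * mean_dev i \<omega>"
      by (simp add: sum_subtractf distrib_left)
    then show ?thesis using n_pos by (simp add: mean_dev_def)
  qed
  show ?thesis
    unfolding S_def emp_cov_index[OF assms n_pos, of "\<lambda>l. X l \<omega>" "\<lambda>i. \<mu> $ i + mean_dev i \<omega>"] z
    by (simp add: centred_def diff_diff_eq)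
qed

lemma S_carrier: "S \<omega> \<in> carrier_mat p p"
  by (simp add: S_def)

lemma sym_S: "sym_mat (S \<omega>)"
  unfolding sym_mat_def carrier_matD(1)[OF S_carrier] by (auto simp: S_index_centred mult.commute)

lemma qform_S: "real n * qform (S \<omega>) v = (\<Sum>l=1..n. (\<Sum>i<p. v i * centred l i \<omega>)\<^sup>2)"
proof -
  have "real n * qform (S \<omega>) v = (\<Sum>i<p. \<Sum>j<p. \<Sum>l=1..n. (v i * centred l i \<omega>) * (v j * centred l j \<omega>))"
    unfolding qform_def carrier_matD(1)[OF S_carrier] sum_distrib_left
  proof (intro sum.cong refl)
    fix i j assume "i \<in> {..<p}" "j \<in> {..<p}"
    then have "real n * (S \<omega> $$ (i, j)) = (\<Sum>l=1..n. centred l i \<omega> * centred l j \<omega>)" using n_pos by (simp add: S_index_centred)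
    then have "real n * (S \<omega> $$ (i, j) * v i * v j) = (\<Sum>l=1..n. centred l i \<omega> * centred l j \<omega>) * (v i * v j)"
      by (simp only: mult.assoc[symmetric])
    also have "\<dots> = (\<Sum>l=1..n. (v i * centred l i \<omega>) * (v j * centred l j \<omega>))"
      unfolding sum_distrib_right by (intro sum.cong refl) (simp add: mult_ac)
    finally show "real n * (S \<omega> $$ (i, j) * v i * v j) = (\<Sum>l=1..n. (v i * centred l i \<omega>) * (v j * centred l j \<omega>))" .
  qed
  also have "\<dots> = (\<Sum>l=1..n. \<Sum>i<p. \<Sum>j<p. (v i * centred l i \<omega>) * (v j * centred l j \<omega>))"
    by (rule sum_swap3[symmetric])
  finally show ?thesis by (simp only: power2_eq_square sum_product)
qed

text \<open>A vector \<open>w\<close> of maximum norm \<open>1\<close> with a small value of the form would make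
  every centred observation nearly orthogonal to \<open>w\<close>. Rounding \<open>w\<close> and the
  offset to the grid costs an error of order \<open>n\<^sup>2 / N\<close>, because the centred
  observations are at most \<open>n\<close> in each coordinate, and produces a hyperplane of the list.\<close>

lemma coercive_S:
  assumes N: "0 < N" and pn: "p \<le> n" and far: "\<not> near_hyperplane N (3 * (real n)\<^sup>2 / real N) \<omega>"
    and mean: "\<And>i. i < p \<Longrightarrow> \<bar>mean_dev i \<omega>\<bar> \<le> 1" and diag: "\<And>i. i < p \<Longrightarrow> S \<omega> $$ (i, i) \<le> real n"
  shows "coercive p (1 / (real N)\<^sup>2) (S \<omega>)"
proof -
  have Zb: "\<bar>centred l i \<omega>\<bar> \<le> real n" if l: "l \<in> {1..n}" and i: "i < p" for l i
  proof -
    have "(centred l i \<omega>)\<^sup>2 \<le> (\<Sum>l=1..n. (centred l i \<omega>)\<^sup>2)" by (rule member_le_sum) (use l in auto)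
    also have "\<dots> = real n * S \<omega> $$ (i, i)" using n_pos by (simp add: S_index_centred[OF i i] power2_eq_square)
    also have "\<dots> \<le> real n * real n" by (intro mult_left_mono diag i) simp
    finally have "(centred l i \<omega>)\<^sup>2 \<le> (real n)\<^sup>2" by (simp add: power2_eq_square)
    then show ?thesis by (simp add: abs_le_square_iff[symmetric])
  qed
  have "1 / (real N)\<^sup>2 * sqnorm p v \<le> qform (S \<omega>) v" for v
  proof (rule ccontr)
    assume neg: "\<not> 1 / (real N)\<^sup>2 * sqnorm p v \<le> qform (S \<omega>) v"
    (* Normalize to maximum norm 1. *)
    define b where "b = Max ((\<lambda>i. \<bar>v i\<bar>) ` {..<p})"
    have fin: "finite ((\<lambda>i. \<bar>v i\<bar>) ` {..<p})" "(\<lambda>i. \<bar>v i\<bar>) ` {..<p} \<noteq> {}" using p_pos by auto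
    have vb: "\<bar>v i\<bar> \<le> b" if "i < p" for i unfolding b_def using that by (intro Max_ge[OF fin(1)]) auto
    obtain i0 where i0: "i0 < p" "\<bar>v i0\<bar> = b" using Max_in[OF fin] by (auto simp: b_def)
    have b0: "b \<noteq> 0"
    proof
      assume "b = 0"
      then have "sqnorm p v = 0" using vb by (auto simp: sqnorm_def intro!: sum.neutral)
      moreover have "0 \<le> qform (S \<omega>) v"
      proof -
        have "0 \<le> real n * qform (S \<omega>) v" unfolding qform_S by (rule sum_nonneg) simp
        then show ?thesis using n_pos by (simp add: zero_le_mult_iff)
      qed
      ultimately show False using neg by simp
    qed
    then have b: "0 < b" using i0 by linarith
    define w where "w i = (1 / b) * v i" for i
    have wb: "\<bar>w i\<bar> \<le> 1" if "i < p" for i using vb[OF that] b by (simp add: w_def abs_mult abs_divide)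
    have w0: "\<bar>w i0\<bar> = 1" using i0 b by (simp add: w_def abs_mult)
    have "qform (S \<omega>) w < 1 / (real N)\<^sup>2 * sqnorm p w"
    proof -
      have "sqnorm p w = (1 / b)\<^sup>2 * sqnorm p v" unfolding sqnorm_def w_def sum_distrib_left power_mult_distrib ..
      then have "1 / (real N)\<^sup>2 * sqnorm p w = (1 / b)\<^sup>2 * (1 / (real N)\<^sup>2 * sqnorm p v)" by simp
      moreover have "qform (S \<omega>) w = (1 / b)\<^sup>2 * qform (S \<omega>) v" unfolding w_def by (rule qform_scale)
      ultimately show ?thesis using neg b by (simp only: not_le) (rule mult_strict_left_mono, auto)
    qed
    also have "\<dots> \<le> 1 / (real N)\<^sup>2 * real n"
    proof (rule mult_left_mono)
      have "sqnorm p w \<le> (\<Sum>i<p. 1)" unfolding sqnorm_def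
        by (intro sum_mono) (use wb in \<open>auto simp: abs_square_le_1\<close>)
      then show "sqnorm p w \<le> real n" using pn by simp
    qed simp
    finally have qw: "qform (S \<omega>) w < real n / (real N)\<^sup>2" by simp
    have lin: "\<bar>\<Sum>i<p. w i * centred l i \<omega>\<bar> \<le> real n / real N" if l: "l \<in> {1..n}" for l
    proof -
      have "(\<Sum>i<p. w i * centred l i \<omega>)\<^sup>2 \<le> (\<Sum>l=1..n. (\<Sum>i<p. w i * centred l i \<omega>)\<^sup>2)"
        by (rule member_le_sum) (use l in auto)
      also have "\<dots> \<le> real n * (real n / (real N)\<^sup>2)"
        unfolding qform_S[symmetric] using qw by (intro mult_left_mono) auto
      also have "\<dots> = (real n / real N)\<^sup>2" by (simp add: power2_eq_square)
      finally show ?thesis by (simp add: abs_le_square_iff[symmetric])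
    qed
    define k where "k i = (if i < p then \<lfloor>w i * real N\<rfloor> else undefined)" for i
    have kw: "\<bar>real_of_int (k i) / real N - w i\<bar> \<le> 1 / real N" if "i < p" for i
      using floor_grid_approx[OF N, of "w i"] that by (simp add: k_def)
    have kb: "- int N \<le> k i \<and> k i \<le> int N" if "i < p" for i
    proof -
      have "- 1 \<le> w i" "w i \<le> 1" using wb[OF that] by auto
      then have "- 1 * real N \<le> w i * real N" "w i * real N \<le> 1 * real N"
        using mult_right_mono[of "- 1" "w i" "real N"] mult_right_mono[of "w i" 1 "real N"] by simp_all
      then have "- real N \<le> w i * real N" "w i * real N < real N + 1" by auto
      then show ?thesis using that by (auto simp: k_def le_floor_iff floor_le_iff)
    qed
    have kg: "k \<in> grid N"
      unfolding grid_def
    proof (intro CollectI conjI)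
      show "k \<in> {..<p} \<rightarrow>\<^sub>E {- int N..int N}" using kb by (auto simp: PiE_iff extensional_def k_def)
      (* Rounding does not move the coordinate of modulus 1, so the rounded direction keeps norm 1. *)
      have "w i0 = 1 \<or> w i0 = - 1" using w0 by linarith
      moreover have "\<lfloor>- real N\<rfloor> = - int N" by (metis floor_of_int of_int_minus of_int_of_nat_eq)
      ultimately have "k i0 = int N \<or> k i0 = - int N" using i0 by (auto simp: k_def)
      then show "\<exists>i<p. \<bar>k i\<bar> = int N" using i0 by auto
    qed
    define kk where "kk i = real_of_int (k i) / real N" for i
    define c' where "c' = (\<Sum>i<p. kk i * mean_dev i \<omega>)"
    define c where "c = \<lfloor>c' * real N\<rfloor>"
    have kk1: "\<bar>kk i\<bar> \<le> 1" if "i < p" for i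
      using kb[OF that] N unfolding kk_def by (simp add: abs_divide divide_le_eq abs_le_iff)
    have "\<bar>c'\<bar> \<le> (\<Sum>i<p. \<bar>kk i * mean_dev i \<omega>\<bar>)" unfolding c'_def by (rule sum_abs)
    also have "\<dots> \<le> (\<Sum>i<p. 1 * 1)"
      unfolding abs_mult by (intro sum_mono mult_mono kk1 mean) auto
    finally have c'b: "\<bar>c'\<bar> \<le> real n" using pn by simp
    have cb: "c \<in> {- int (n * N)..int (n * N)}"
    proof -
      have "- real n \<le> c'" "c' \<le> real n" using c'b by auto
      then have "- real n * real N \<le> c' * real N" "c' * real N \<le> real n * real N"
        using mult_right_mono[of "- real n" c' "real N"] mult_right_mono[of c' "real n" "real N"] by simp_all
      then have "- (real n * real N) \<le> c' * real N" "c' * real N < real n * real N + 1" by auto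
      then show ?thesis by (auto simp: c_def le_floor_iff floor_le_iff)
    qed
    have cc: "\<bar>real_of_int c / real N - c'\<bar> \<le> 1 / real N"
      unfolding c_def by (rule floor_grid_approx[OF N])
    have "\<bar>proj kk l \<omega> - real_of_int c / real N\<bar> \<le> 3 * (real n)\<^sup>2 / real N" if l: "l \<in> {1..n}" for l
    proof -
      have "proj kk l \<omega> - c' = (\<Sum>i<p. kk i * centred l i \<omega>)"
        unfolding proj_def c'_def sum_subtractf[symmetric] by (intro sum.cong refl) (simp add: centred_def algebra_simps)
      also have "\<dots> = (\<Sum>i<p. w i * centred l i \<omega>) + (\<Sum>i<p. (kk i - w i) * centred l i \<omega>)"
        unfolding sum.distrib[symmetric] by (intro sum.cong refl) (simp add: algebra_simps)
      finally have e: "proj kk l \<omega> - c' = (\<Sum>i<p. w i * centred l i \<omega>) + (\<Sum>i<p. (kk i - w i) * centred l i \<omega>)" .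
      have "\<bar>\<Sum>i<p. (kk i - w i) * centred l i \<omega>\<bar> \<le> (\<Sum>i<p. \<bar>(kk i - w i) * centred l i \<omega>\<bar>)" by (rule sum_abs)
      also have "\<dots> \<le> (\<Sum>i<p. 1 / real N * real n)"
        unfolding abs_mult kk_def by (intro sum_mono mult_mono kw Zb l) auto
      also have "\<dots> = real p * (real n / real N)" by simp
      also have "\<dots> \<le> real n * (real n / real N)" using pn by (intro mult_right_mono) auto
      finally have a: "\<bar>\<Sum>i<p. (kk i - w i) * centred l i \<omega>\<bar> \<le> (real n)\<^sup>2 / real N" by (simp add: power2_eq_square)
      have n1: "1 \<le> real n" using n_pos by simp
      then have "real n * 1 \<le> real n * real n" by (intro mult_left_mono) auto
      then have n2: "real n \<le> (real n)\<^sup>2" by (simp add: power2_eq_square)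
      have "\<bar>proj kk l \<omega> - real_of_int c / real N\<bar> \<le> real n / real N + (real n)\<^sup>2 / real N + 1 / real N"
        using e lin[OF l] a cc by linarith
      also have "\<dots> = (real n + (real n)\<^sup>2 + 1) / real N" by (simp add: add_divide_distrib)
      also have "\<dots> \<le> 3 * (real n)\<^sup>2 / real N"
      proof (rule divide_right_mono)
        show "real n + (real n)\<^sup>2 + 1 \<le> 3 * (real n)\<^sup>2" using n1 n2 by linarith
      qed simp
      finally show ?thesis .
    qed
    then have "near_hyperplane N (3 * (real n)\<^sup>2 / real N) \<omega>"
      unfolding near_hyperplane_def kk_def using kg cb by (intro bexI[of _ k] bexI[of _ c]) auto
    then show False using far by simp
  qed
  then show ?thesis using S_carrier sym_S N by (simp add: coercive_def)
qed

end

section \<open>Measurability and the probability of correct selection\<close>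

text \<open>Entrywise, since a random matrix of fixed size is given by finitely many real random variables.\<close>

definition measurable_entries :: "'a measure \<Rightarrow> nat \<Rightarrow> ('a \<Rightarrow> real mat) \<Rightarrow> bool" where
  "measurable_entries M p F \<longleftrightarrow> (\<forall>\<omega>. F \<omega> \<in> carrier_mat p p) \<and>
     (\<forall>i<p. \<forall>j<p. (\<lambda>\<omega>. F \<omega> $$ (i, j)) \<in> borel_measurable M)"

lemma measurable_entriesD:
  assumes "measurable_entries M p F"
  shows "F \<omega> \<in> carrier_mat p p" "i < p \<Longrightarrow> j < p \<Longrightarrow> (\<lambda>\<omega>. F \<omega> $$ (i, j)) \<in> borel_measurable M"
  using assms by (simp_all add: measurable_entries_def)

lemma measurable_entries_restrict_blocks:
  assumes F: "measurable_entries M p F"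
  shows "measurable_entries M p (\<lambda>\<omega>. restrict_blocks (F \<omega>) B)"
  unfolding measurable_entries_def
proof (intro conjI allI impI)
  show "restrict_blocks (F \<omega>) B \<in> carrier_mat p p" for \<omega>
    by (rule restrict_blocks_carrier[OF measurable_entriesD(1)[OF F]])
  fix i j assume ij: "i < p" "j < p"
  show "(\<lambda>\<omega>. restrict_blocks (F \<omega>) B $$ (i, j)) \<in> borel_measurable M"
    unfolding restrict_blocks_index[OF measurable_entriesD(1)[OF F] ij]
    using measurable_entriesD(2)[OF F ij] by simp
qed

lemma measurable_det:
  assumes F: "measurable_entries M p F"
  shows "(\<lambda>\<omega>. det (F \<omega>)) \<in> borel_measurable M"
proof -
  have "(\<lambda>\<omega>. signof \<pi> * (\<Prod>i = 0..<p. F \<omega> $$ (i, \<pi> i))) \<in> borel_measurable M" if \<pi>: "\<pi> permutes {0..<p}" for \<pi>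
  proof (intro borel_measurable_times borel_measurable_prod)
    fix i assume "i \<in> {0..<p}"
    then show "(\<lambda>\<omega>. F \<omega> $$ (i, \<pi> i)) \<in> borel_measurable M"
      using permutes_in_image[OF \<pi>, of i] by (intro measurable_entriesD(2)[OF F]) auto
  qed simp
  then show ?thesis
    unfolding det_def'[OF measurable_entriesD(1)[OF F]] by (intro borel_measurable_sum) auto
qed

lemma measurable_cofactor:
  assumes F: "measurable_entries M p F"
  shows "(\<lambda>\<omega>. cofactor (F \<omega>) i j) \<in> borel_measurable M"
proof -
  note c = carrier_matD[OF measurable_entriesD(1)[OF F]]
  have "measurable_entries M (p - 1) (\<lambda>\<omega>. mat_delete (F \<omega>) i j)"
    unfolding measurable_entries_def
  proof (intro conjI allI impI)
    show "mat_delete (F \<omega>) i j \<in> carrier_mat (p - 1) (p - 1)" for \<omega>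
      by (rule mat_delete_carrier[OF measurable_entriesD(1)[OF F]])
    fix k l assume kl: "k < p - 1" "l < p - 1"
    define k' l' where "k' = (if k < i then k else Suc k)" and "l' = (if l < j then l else Suc l)"
    have "k' \<le> Suc k" "l' \<le> Suc l" by (simp_all add: k'_def l'_def)
    then have "k' < p" "l' < p" using kl by linarith+
    then have "(\<lambda>\<omega>. F \<omega> $$ (k', l')) \<in> borel_measurable M" by (rule measurable_entriesD(2)[OF F])
    moreover have "mat_delete (F \<omega>) i j $$ (k, l) = F \<omega> $$ (k', l')" for \<omega>
      unfolding mat_delete_def c k'_def l'_def using kl by simp
    ultimately show "(\<lambda>\<omega>. mat_delete (F \<omega>) i j $$ (k, l)) \<in> borel_measurable M" by simp
  qed
  note d = measurable_det[OF this]
  have "(\<lambda>\<omega>. (- 1) ^ (i + j) * det (mat_delete (F \<omega>) i j)) \<in> borel_measurable M"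
    by (rule borel_measurable_times[OF borel_measurable_const d])
  then show ?thesis unfolding cofactor_def .
qed

text \<open>Reading a matrix outside its column range gives a value that does not depend on the
  entries, so that even the junk value of the criterion at a singular matrix is measurable.\<close>

lemma mat_index_out_of_cols:
  assumes "i < nr" "nc \<le> j"
  shows "mat nr nc f $$ (i, j) = [] ! (j - nc)"
proof -
  have nth_ge: "\<not> j < length xs \<Longrightarrow> xs ! j = [] ! (j - length xs)" for xs :: "'a list"
    by (metis append_Nil2 nth_append)
  have "mat nr nc f $$ (i, j) = undef_mat nr nc f (i, j)"
    using assms by transfer (simp add: mk_mat_def)
  also have "\<dots> = map (\<lambda>j. f (i, j)) [0..<nc] ! j" using assms by (simp add: undef_mat_def)
  also have "\<dots> = [] ! (j - nc)" using assms nth_ge[of "map (\<lambda>j. f (i, j)) [0..<nc]"] by simp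
  finally show ?thesis .
qed

lemma measurable_trace_const_mult:
  assumes F: "measurable_entries M p F"
  shows "(\<lambda>\<omega>. mat_trace (C * F \<omega>)) \<in> borel_measurable M"
proof -
  note c = carrier_matD[OF measurable_entriesD(1)[OF F]]
  have "(\<lambda>\<omega>. (C * F \<omega>) $$ (i, i)) \<in> borel_measurable M" if i: "i < dim_row C" for i
  proof (cases "i < p")
    case True
    have "(C * F \<omega>) $$ (i, i) = (\<Sum>k<p. row C i $ k * F \<omega> $$ (k, i))" for \<omega>
      using True i by (auto simp: c scalar_prod_def atLeast0LessThan intro!: sum.cong)
    then show ?thesis using measurable_entriesD(2)[OF F _ True] by simp
  next
    case False
    have "(C * F \<omega>) $$ (i, i) = [] ! (i - p)" for \<omega>
      unfolding times_mat_def c using False i by (intro mat_index_out_of_cols) auto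
    then show ?thesis by simp
  qed
  then show ?thesis unfolding mat_trace_def by simp
qed

text \<open>At a singular matrix the inverse is a fixed matrix about which nothing else is known.\<close>

lemma mat_inv_singular:
  assumes A: "A \<in> carrier_mat n n" and d: "det A = 0"
  shows "mat_inv A = the None"
proof (cases "mat_inverse A")
  case (Some B)
  then have "A * B = 1\<^sub>m n" "B \<in> carrier_mat n n" using mat_inverse(2)[OF A] by auto
  then have "det A * det B = 1" using det_mult[OF A] by (metis det_one)
  then show ?thesis using d by simp
qed (simp add: mat_inv_def)

lemma mat_inv_nonsingular:
  assumes A: "A \<in> carrier_mat n n" and d: "det A \<noteq> 0"
  shows "mat_inv A = (1 / det A) \<cdot>\<^sub>m adj_mat A"
  by (rule mat_inv_eqI[OF A adjugate_inverse[OF A d]])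

text \<open>For nonsingular arguments the inverse is given by cofactors; for singular ones the trace term is a
  fixed affine function of the entries.\<close>

lemma measurable_neg_loglik:
  assumes F: "measurable_entries M p F" and G: "measurable_entries M p G"
  shows "(\<lambda>\<omega>. neg_loglik (F \<omega>) (G \<omega>)) \<in> borel_measurable M"
proof -
  note cF = measurable_entriesD(1)[OF F] and cG = measurable_entriesD(1)[OF G]
  note [measurable] = measurable_det[OF G] measurable_cofactor[OF G]
  define h where "h \<omega> = (\<Sum>i<p. \<Sum>k<p. 1 / det (G \<omega>) * cofactor (G \<omega>) k i * F \<omega> $$ (k, i))" for \<omega>
  have "mat_trace (mat_inv (G \<omega>) * F \<omega>) = (if det (G \<omega>) = 0 then mat_trace (the None * F \<omega>) else h \<omega>)" for \<omega>
  proof (cases "det (G \<omega>) = 0")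
    case False
    have c: "(1 / det (G \<omega>)) \<cdot>\<^sub>m adj_mat (G \<omega>) \<in> carrier_mat p p" using adj_mat(1)[OF cG] by simp
    have "mat_trace ((1 / det (G \<omega>)) \<cdot>\<^sub>m adj_mat (G \<omega>) * F \<omega>)
      = (\<Sum>i<p. \<Sum>k<p. ((1 / det (G \<omega>)) \<cdot>\<^sub>m adj_mat (G \<omega>)) $$ (i, k) * F \<omega> $$ (k, i))"
      unfolding mat_trace_def index_mult_mat(2) carrier_matD(1)[OF c]
      by (intro sum.cong refl times_mat_entry[OF c cF]) auto
    also have "\<dots> = h \<omega>"
      unfolding h_def using carrier_matD[OF cG[of \<omega>]] by (intro sum.cong refl) (simp add: adj_mat_def)
    finally show ?thesis using False by (simp add: mat_inv_nonsingular[OF cG False])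
  qed (simp add: mat_inv_singular[OF cG])
  moreover have "h \<in> borel_measurable M"
    unfolding h_def by (intro borel_measurable_sum borel_measurable_times borel_measurable_divide measurable_entriesD(2)[OF F]
        measurable_det[OF G] measurable_cofactor[OF G]) auto
  moreover note measurable_trace_const_mult[OF F, of "the None"]
  ultimately have "(\<lambda>\<omega>. mat_trace (mat_inv (G \<omega>) * F \<omega>)) \<in> borel_measurable M" by simp
  moreover have "dim_row (G \<omega>) = p" for \<omega> using cG[of \<omega>] by simp
  ultimately show ?thesis unfolding neg_loglik_def by simp
qed

lemma finite_partitions: "finite {B. partition_on {..<p :: nat} B}"
  by (rule finitely_many_partition_on) simp

lemma pred_eq_restrict_blocks:
  assumes F: "measurable_entries M p F"
  shows "Measurable.pred M (\<lambda>\<omega>. F \<omega> = restrict_blocks (F \<omega>) B)"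
proof -
  note c = measurable_entriesD(1)[OF F]
  have "F \<omega> = restrict_blocks (F \<omega>) B \<longleftrightarrow>
      (\<forall>i\<in>{..<p}. \<forall>j\<in>{..<p}. same_block B i j \<or> F \<omega> $$ (i, j) = 0)" for \<omega>
  proof
    assume eq: "F \<omega> = restrict_blocks (F \<omega>) B"
    have "F \<omega> $$ (i, j) = 0" if "i < p" "j < p" "\<not> same_block B i j" for i j
      by (rule trans[OF arg_cong[of _ _ "\<lambda>R. R $$ (i, j)", OF eq]])
        (simp add: restrict_blocks_index[OF c that(1,2)] that(3))
    then show "\<forall>i\<in>{..<p}. \<forall>j\<in>{..<p}. same_block B i j \<or> F \<omega> $$ (i, j) = 0" by auto
  next
    assume *: "\<forall>i\<in>{..<p}. \<forall>j\<in>{..<p}. same_block B i j \<or> F \<omega> $$ (i, j) = 0"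
    show "F \<omega> = restrict_blocks (F \<omega>) B"
      using carrier_matD[OF c[of \<omega>]] carrier_matD[OF restrict_blocks_carrier[OF c[of \<omega>], of B]] *
      by (intro eq_matI) (auto simp: restrict_blocks_index[OF c])
  qed
  moreover have "{\<omega> \<in> space M. \<forall>i\<in>{..<p}. \<forall>j\<in>{..<p}. same_block B i j \<or> F \<omega> $$ (i, j) = 0} \<in> sets M"
  proof (rule sets.sets_Collect_finite_All[OF sets.sets_Collect_finite_All])
    fix i j assume "i \<in> {..<p}" "j \<in> {..<p}"
    then have [measurable]: "(\<lambda>\<omega>. F \<omega> $$ (i, j)) \<in> borel_measurable M" by (intro measurable_entriesD(2)[OF F]) auto
    have "{\<omega> \<in> space M. F \<omega> $$ (i, j) = 0} \<in> sets M" by measurable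
    then show "{\<omega> \<in> space M. same_block B i j \<or> F \<omega> $$ (i, j) = 0} \<in> sets M"
      by (cases "same_block B i j") simp_all
  qed simp_all
  ultimately show ?thesis by (simp add: pred_def)
qed

lemma pred_is_finest_decomp:
  assumes F: "measurable_entries M p F"
  shows "Measurable.pred M (\<lambda>\<omega>. is_finest_decomp (F \<omega>) B)"
proof -
  have d: "dim_row (F \<omega>) = p" for \<omega> using measurable_entriesD(1)[OF F, of \<omega>] by simp
  have "is_finest_decomp (F \<omega>) B \<longleftrightarrow> partition_on {..<p} B \<and> F \<omega> = restrict_blocks (F \<omega>) B \<and>
     (\<forall>B'\<in>{B'. partition_on {..<p} B'}. \<not> (finer_than p B' B \<and> F \<omega> = restrict_blocks (F \<omega>) B'))" for \<omega>
  proof -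
    have "finer_than p B' B \<Longrightarrow> partition_on {..<p} B'" for B' by (simp add: finer_than_def refines_def)
    then show ?thesis unfolding is_finest_decomp_def d by auto
  qed
  moreover have "{\<omega> \<in> space M. partition_on {..<p} B \<and> F \<omega> = restrict_blocks (F \<omega>) B \<and>
     (\<forall>B'\<in>{B'. partition_on {..<p} B'}. \<not> (finer_than p B' B \<and> F \<omega> = restrict_blocks (F \<omega>) B'))} \<in> sets M"
  proof -
    have e: "{\<omega> \<in> space M. F \<omega> = restrict_blocks (F \<omega>) B'} \<in> sets M" for B'
      using pred_eq_restrict_blocks[OF F] by (simp add: pred_def)
    have "{\<omega> \<in> space M. \<not> (finer_than p B' B \<and> F \<omega> = restrict_blocks (F \<omega>) B')} \<in> sets M" for B'
      using sets.sets_Collect_neg[OF e[of B']] by (cases "finer_than p B' B") simp_all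
    then have "{\<omega> \<in> space M. \<forall>B'\<in>{B'. partition_on {..<p} B'}.
        \<not> (finer_than p B' B \<and> F \<omega> = restrict_blocks (F \<omega>) B')} \<in> sets M"
      by (rule sets.sets_Collect_finite_All[OF _ finite_partitions])
    from sets.sets_Collect_conj[OF this e[of B]] show ?thesis by (cases "partition_on {..<p} B") simp_all
  qed
  ultimately show ?thesis by (simp add: pred_def)
qed

text \<open>The penalty takes finitely many values, one for each possible finest decomposition.\<close>

lemma measurable_pen:
  assumes F: "measurable_entries M p F"
  shows "(\<lambda>\<omega>. pen (F \<omega>)) \<in> borel_measurable M"
proof -
  have d: "dim_row (F \<omega>) = p" "dim_col (F \<omega>) = p" for \<omega> using measurable_entriesD(1)[OF F, of \<omega>] by simp_all
  have "pen (F \<omega>) = (\<Sum>B\<in>{B. partition_on {..<p} B}. if is_finest_decomp (F \<omega>) B then \<Sum>A\<in>B. (real (card A))\<^sup>2 else 0)" for \<omega>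
  proof -
    have ex: "\<exists>!B. is_finest_decomp (F \<omega>) B" by (rule is_finest_decomp_ex1) (simp add: d)
    then have b: "is_finest_decomp (F \<omega>) (block_decomp (F \<omega>))" unfolding block_decomp_def by (rule theI')
    have i: "is_finest_decomp (F \<omega>) B \<longleftrightarrow> B = block_decomp (F \<omega>)" for B using ex b by auto
    have "block_decomp (F \<omega>) \<in> {B. partition_on {..<p} B}" using b by (simp add: is_finest_decomp_def d)
    then show ?thesis unfolding i pen_def by (simp add: finite_partitions)
  qed
  moreover have "(\<lambda>\<omega>. \<Sum>B\<in>{B. partition_on {..<p} B}. if is_finest_decomp (F \<omega>) B then \<Sum>A\<in>B. (real (card A))\<^sup>2 else 0) \<in> borel_measurable M"
    using pred_is_finest_decomp[OF F] by (intro borel_measurable_sum measurable_If) (auto simp: pred_def)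
  ultimately show ?thesis by simp
qed

lemma measurable_Psi:
  assumes F: "measurable_entries M p F"
  shows "(\<lambda>\<omega>. Psi \<kappa> (F \<omega>) B) \<in> borel_measurable M"
  unfolding Psi_def Phi_def
  using measurable_neg_loglik[OF F measurable_entries_restrict_blocks[OF F]]
    measurable_pen[OF measurable_entries_restrict_blocks[OF F]] by measurable

lemma Collect_singleton_iff: "{C \<in> P. Q C} = {B} \<longleftrightarrow> B \<in> P \<and> (\<forall>C\<in>P. C = B \<longleftrightarrow> Q C)"
  by auto

text \<open>There are finitely many partitions, so being the only minimizer is a finite Boolean combination of
  comparisons of measurable functions.\<close>

lemma pred_B_tot:
  assumes F: "measurable_entries M p F"
  shows "Measurable.pred M (\<lambda>\<omega>. B_tot \<kappa> (F \<omega>) = {B})"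
proof -
  let ?P = "{B. partition_on {..<p} B}"
  have d: "dim_row (F \<omega>) = p" for \<omega> using measurable_entriesD(1)[OF F, of \<omega>] by simp
  have "B_tot \<kappa> (F \<omega>) = {B} \<longleftrightarrow> B \<in> ?P \<and>
     (\<forall>C\<in>?P. C = B \<longleftrightarrow> (\<forall>D\<in>?P. \<not> Psi \<kappa> (F \<omega>) D < Psi \<kappa> (F \<omega>) C))" for \<omega>
  proof -
    have "B_tot \<kappa> (F \<omega>) = {C \<in> ?P. \<forall>D\<in>?P. \<not> Psi \<kappa> (F \<omega>) D < Psi \<kappa> (F \<omega>) C}"
      by (auto simp: B_tot_def is_arg_min_def d)
    then show ?thesis by (simp only: Collect_singleton_iff)
  qed
  moreover have "{\<omega> \<in> space M. B \<in> ?P \<and> (\<forall>C\<in>?P. C = B \<longleftrightarrow> (\<forall>D\<in>?P. \<not> Psi \<kappa> (F \<omega>) D < Psi \<kappa> (F \<omega>) C))} \<in> sets M"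
  proof -
    have "{\<omega> \<in> space M. Psi \<kappa> (F \<omega>) D < Psi \<kappa> (F \<omega>) C} \<in> sets M" for C D
      by (rule borel_measurable_less[OF measurable_Psi[OF F] measurable_Psi[OF F]])
    then have "{\<omega> \<in> space M. \<not> Psi \<kappa> (F \<omega>) D < Psi \<kappa> (F \<omega>) C} \<in> sets M" for C D
      by (rule sets.sets_Collect_neg)
    then have opt: "{\<omega> \<in> space M. \<forall>D\<in>?P. \<not> Psi \<kappa> (F \<omega>) D < Psi \<kappa> (F \<omega>) C} \<in> sets M" for C
      by (rule sets.sets_Collect_finite_All[OF _ finite_partitions])
    have "{\<omega> \<in> space M. C = B \<longleftrightarrow> (\<forall>D\<in>?P. \<not> Psi \<kappa> (F \<omega>) D < Psi \<kappa> (F \<omega>) C)} \<in> sets M" for C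
      using opt[of C] sets.sets_Collect_neg[OF opt[of C]] by (cases "C = B") simp_all
    then have "{\<omega> \<in> space M. \<forall>C\<in>?P. C = B \<longleftrightarrow> (\<forall>D\<in>?P. \<not> Psi \<kappa> (F \<omega>) D < Psi \<kappa> (F \<omega>) C)} \<in> sets M"
      by (rule sets.sets_Collect_finite_All[OF _ finite_partitions])
    then show ?thesis by (cases "B \<in> ?P") simp_all
  qed
  ultimately show ?thesis by (simp add: pred_def)
qed

context gaussian_sample
begin

lemma measurable_entries_S: "measurable_entries M p S"
  unfolding measurable_entries_def
proof (intro conjI allI impI S_carrier)
  fix i j assume ij: "i < p" "j < p"
  have [measurable]: "mean_dev k \<in> borel_measurable M" if "k < p" for k
    unfolding mean_dev_def using that by measurable
  show "(\<lambda>\<omega>. S \<omega> $$ (i, j)) \<in> borel_measurable M"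
    unfolding S_index[OF ij] using ij by measurable
qed

lemma Sigma_entry_le:
  assumes "i < p" "j < p"
  shows "\<bar>\<Sigma> $$ (i, j)\<bar> \<le> 2 * Lam" "\<Sigma> $$ (i, i) \<le> Lam"
proof -
  have d: "0 < \<Sigma> $$ (i, i)" "\<Sigma> $$ (i, i) \<le> Lam" if "i < p" for i
    using qform_pair[OF that that] qform_pair_le[OF that that] qform_Sigma_pos[OF sqnorm_pair(1)[OF that that]] by auto
  show "\<Sigma> $$ (i, i) \<le> Lam" by (rule d(2)[OF assms(1)])
  show "\<bar>\<Sigma> $$ (i, j)\<bar> \<le> 2 * Lam"
    using qform_pair[OF assms] qform_pair_le[OF assms] qform_Sigma_pos[OF sqnorm_pair(1)[OF assms]]
      d[OF assms(1)] d[OF assms(2)] by (simp add: abs_le_iff)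
qed

text \<open>Combines the three exceptional events: poor concentration, observations near a hyperplane of the
  list, and a vanishing entry, which has probability zero.\<close>

lemma prob_selection:
  fixes m N :: nat and t b \<beta> :: real
  assumes Bs: "partition_on {..<p} Bs" and size: "\<And>D. D \<in> Bs \<Longrightarrow> card D \<le> m"
    and Sig0: "\<And>i j. i < p \<Longrightarrow> j < p \<Longrightarrow> \<not> same_block Bs i j \<Longrightarrow> \<Sigma> $$ (i, j) = 0"
    and sep: "\<And>B. finer_than p B Bs \<Longrightarrow> \<exists>i<p. \<exists>j<p. \<not> same_block B i j \<and> same_block Bs i j \<and> 2 * b \<le> \<bar>\<Sigma> $$ (i, j)\<bar>"
    and n: "2 \<le> n" "p \<le> n" "Lam + 4 \<le> real n" and t: "0 \<le> t" "t \<le> 2" "Lam * t \<le> 1"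
    and lL: "lam \<le> Lam" and N: "0 < N" "1 / (real N)\<^sup>2 \<le> 2 * Lam"
    and m: "1 \<le> m" "real m * (4 * Lam * t) \<le> lam / 2" and b: "0 < b" "4 * Lam * t \<le> b"
    and small_split: "(2 + 4 * ln (2 * Lam * (real N)\<^sup>2)) * (real m * (4 * Lam * t) / (lam / 2))\<^sup>2 < \<beta>"
    and small_merge: "\<beta> * (real m)\<^sup>2 < b\<^sup>2 / (10 * (2 * Lam)\<^sup>2)"
  shows "1 - prob {\<omega> \<in> space M. B_tot (\<beta> / real p) (S \<omega>) = {Bs}}
    \<le> 4 * (real p)\<^sup>2 * exp (- real n * t\<^sup>2 / 16)
      + real ((2 * N + 1) ^ p) * real (2 * n * N + 1) * (3 * (real n)\<^sup>2 / real N / sqrt lam) ^ n"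
proof -
  let ?r = "3 * (real n)\<^sup>2 / real N"
  let ?E = "{\<omega> \<in> space M. B_tot (\<beta> / real p) (S \<omega>) = {Bs}}"
  let ?B1 = "{\<omega> \<in> space M. \<not> concentrated t \<omega>}"
  let ?B2 = "{\<omega> \<in> space M. near_hyperplane N ?r \<omega>}"
  let ?I = "{(i, j). i < p \<and> j < p \<and> i \<noteq> j}"
  let ?B3 = "\<Union>z\<in>?I. {\<omega> \<in> space M. S \<omega> $$ z = 0}"
  have E: "?E \<in> events" using pred_B_tot[OF measurable_entries_S] by (simp add: pred_def)
  have B1: "?B1 \<in> events" unfolding concentrated_def by measurable
  have B2: "?B2 \<in> events"
    unfolding near_hyperplane_def
    by (intro sets.sets_Collect_finite_Ex finite_grid finite_atLeastAtMost_int) measurable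
  have zm: "{\<omega> \<in> space M. S \<omega> $$ (i, j) = 0} \<in> events" if "i < p" "j < p" for i j
    using measurable_entriesD(2)[OF measurable_entries_S that] by measurable
  have fin: "finite ?I" by (rule finite_subset[of _ "{..<p} \<times> {..<p}"]) auto
  have zm': "{\<omega> \<in> space M. S \<omega> $$ z = 0} \<in> events" if "z \<in> ?I" for z using zm that by auto
  have B3: "?B3 \<in> events" by (rule sets.finite_UN[OF fin zm'])
  have good: "B_tot (\<beta> / real p) (S \<omega>) = {Bs}"
    if w: "\<omega> \<in> space M" "\<omega> \<notin> ?B1" "\<omega> \<notin> ?B2" "\<omega> \<notin> ?B3" for \<omega>
  proof -
    have conc: "concentrated t \<omega>" and far: "\<not> near_hyperplane N ?r \<omega>" using w by auto
    note close = concentrated_S[OF conc _ _ t(1)]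
    have mean: "\<bar>mean_dev i \<omega>\<bar> \<le> 1" if "i < p" for i
    proof -
      have "\<bar>mean_dev i \<omega>\<bar> \<le> sqrt (Lam * t)" by (rule concentrated_mean[OF conc that t(1)])
      also have "\<dots> \<le> sqrt 1" by (rule real_sqrt_le_mono[OF t(3)])
      finally show ?thesis by simp
    qed
    have diag: "S \<omega> $$ (i, i) \<le> real n" if "i < p" for i
      using close[OF that that] Sigma_entry_le(2)[OF that that] n(3) t(3) by (simp add: abs_le_iff)
    have co: "coercive p (1 / (real N)\<^sup>2) (S \<omega>)" by (rule coercive_S[OF N(1) n(2) far mean diag])
    show ?thesis
    proof (rule true_partition_is_unique_minimizer[OF p_pos Bs size Sigma Sigma_le Sig0 Sigma_entry_le(1) sep co _ close lL N(2) m(2,1) b(2,1)])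
      show "S \<omega> $$ (i, j) \<noteq> 0" if "i < p" "j < p" "i \<noteq> j" for i j using w that by auto
      show "(2 + 4 * ln (2 * Lam / (1 / (real N)\<^sup>2))) * (real m * (4 * Lam * t) / (lam / 2))\<^sup>2 < \<beta>"
        using small_split by simp
    qed (assumption | rule small_merge)+
  qed
  have "1 - prob ?E = prob (space M - ?E)" by (rule prob_compl[OF E, symmetric])
  also have "\<dots> \<le> prob (?B1 \<union> (?B2 \<union> ?B3))"
  proof (rule finite_measure_mono)
    show "space M - ?E \<subseteq> ?B1 \<union> (?B2 \<union> ?B3)" using good by auto
    show "?B1 \<union> (?B2 \<union> ?B3) \<in> events" using B1 B2 B3 by (intro sets.Un)
  qed
  also have "\<dots> \<le> prob ?B1 + prob (?B2 \<union> ?B3)" using B1 B2 B3 by (intro measure_Un_le sets.Un)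
  also have "prob (?B2 \<union> ?B3) \<le> prob ?B2 + prob ?B3" using B2 B3 by (intro measure_Un_le)
  also have "prob ?B3 \<le> (\<Sum>z\<in>?I. prob {\<omega> \<in> space M. S \<omega> $$ z = 0})"
    by (rule measure_UNION_le[OF fin zm'])
  also have "\<dots> = 0" using prob_S_zero[OF n(1)] by (intro sum.neutral) auto
  finally show ?thesis
    using prob_not_concentrated[OF t(1,2)] prob_near_hyperplane[OF N(1), of ?r] by simp
qed

end

section \<open>Consistency\<close>

lemma block_decomp_props:
  assumes "A \<in> carrier_mat p p"
  shows "partition_on {..<p} (block_decomp A)" "A = restrict_blocks A (block_decomp A)"
proof -
  have "\<exists>!B. is_finest_decomp A B" using assms by (intro is_finest_decomp_ex1) simp
  then have "is_finest_decomp A (block_decomp A)" unfolding block_decomp_def by (rule theI')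
  then show "partition_on {..<p} (block_decomp A)" "A = restrict_blocks A (block_decomp A)"
    using assms by (auto simp: is_finest_decomp_def)
qed

lemma zero_outside_block_decomp:
  assumes A: "A \<in> carrier_mat p p" and ij: "i < p" "j < p" "\<not> same_block (block_decomp A) i j"
  shows "A $$ (i, j) = 0"
  by (rule trans[OF arg_cong[of _ _ "\<lambda>R. R $$ (i, j)", OF block_decomp_props(2)[OF A]]])
    (simp add: restrict_blocks_index[OF A ij(1,2)] ij(3))

text \<open>The entries of \<open>A\<^sub>B - A\<close> within the blocks of \<open>B\<close> are zero, so the
  maximum is attained at a pair that \<open>B\<close> splits.\<close>

lemma max_norm_restrict_blocks_ge:
  assumes A: "A \<in> carrier_mat p p" and p: "0 < p" and c: "0 < c"
    and ge: "c \<le> max_norm (restrict_blocks A B - A)"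
  shows "\<exists>i<p. \<exists>j<p. \<not> same_block B i j \<and> c \<le> \<bar>A $$ (i, j)\<bar>"
proof -
  let ?D = "restrict_blocks A B - A"
  have r: "restrict_blocks A B \<in> carrier_mat p p" using A by simp
  have D: "?D \<in> carrier_mat p p" using A r by auto
  have "finite (abs ` elements_mat ?D)" by (simp add: elements_mat_def)
  moreover have "?D $$ (0, 0) \<in> elements_mat ?D" using D p by (intro elements_matI[OF D]) auto
  then have "abs ` elements_mat ?D \<noteq> {}" by auto
  ultimately have "max_norm ?D \<in> abs ` elements_mat ?D" unfolding max_norm_def by (rule Max_in)
  then obtain d where d: "d \<in> elements_mat ?D" "max_norm ?D = \<bar>d\<bar>" by auto
  obtain i j where "i < dim_row ?D" "j < dim_col ?D" and dij: "d = ?D $$ (i, j)" using elements_matD[OF d(1)] by blast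
  then have ij: "i < p" "j < p" "d = ?D $$ (i, j)" by (simp_all only: carrier_matD[OF D])
  have "d = (if same_block B i j then 0 else - A $$ (i, j))"
    using ij A r by (simp add: restrict_blocks_index[OF A])
  then have "\<not> same_block B i j \<and> c \<le> \<bar>A $$ (i, j)\<bar>" using ge c d(2) by (auto split: if_splits)
  then show ?thesis using ij by auto
qed

text \<open>With \<open>N = n\<^sup>K\<close> and \<open>C = 3 / sqrt lam\<close> the bound is at most \<open>n
  (3 C n\<^sup>2)\<^sup>n N\<^sup>p\<^sup>+\<^sup>1\<^sup>-\<^sup>n\<close>. Since \<open>n - p -
  1\<close> is at least a fixed fraction \<open>\<gamma>\<close> of \<open>n\<close>, the choice
  \<open>K \<gamma> \<ge> 4\<close> gives \<open>N\<^sup>n\<^sup>-\<^sup>p\<^sup>-\<^sup>1 \<ge>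
  n\<^sup>4\<^sup>n\<close>.\<close>

lemma grid_bound_tendsto:
  fixes lam y :: real and p :: "nat \<Rightarrow> nat"
  assumes ratio: "(\<lambda>n. real (p n) / real n) \<longlonglongrightarrow> y" "y < 1" and lam: "0 < lam"
  shows "\<exists>K\<ge>1. \<forall>\<^sub>F n in sequentially. real ((2 * n ^ K + 1) ^ p n) * real (2 * n * n ^ K + 1)
    * (3 * (real n)\<^sup>2 / real (n ^ K) / sqrt lam) ^ n \<le> 1 / real n"
proof -
  define \<gamma> where "\<gamma> = (1 - y) / 2"
  have \<gamma>: "0 < \<gamma>" using ratio(2) by (simp add: \<gamma>_def)
  define K where "K = nat \<lceil>4 / \<gamma>\<rceil>"
  have K4: "4 \<le> real K * \<gamma>"
  proof -
    have "4 / \<gamma> \<le> real K" unfolding K_def by linarith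
    then show ?thesis using \<gamma> by (simp add: pos_divide_le_eq)
  qed
  have K1: "1 \<le> K"
  proof (rule ccontr)
    assume "\<not> 1 \<le> K"
    then have "K = 0" by simp
    then show False using K4 by simp
  qed
  define C where "C = 3 / sqrt lam"
  have C0: "0 < C" using lam by (simp add: C_def)
  have "(\<lambda>n. (real (p n) + 1) / real n) \<longlonglongrightarrow> y"
  proof -
    have "(\<lambda>n. real (p n) / real n + 1 / real n) \<longlonglongrightarrow> y + 0"
      by (intro tendsto_add ratio(1) lim_1_over_n)
    then show ?thesis by (simp add: add_divide_distrib)
  qed
  then have "\<forall>\<^sub>F n in sequentially. (real (p n) + 1) / real n < 1 - \<gamma>"
    by (rule order_tendstoD) (use ratio(2) in \<open>simp add: \<gamma>_def field_simps\<close>)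
  moreover have "\<forall>\<^sub>F n in sequentially. 3 * C \<le> real n"
    using filterlim_real_sequentially by (simp add: filterlim_at_top)
  moreover have "\<forall>\<^sub>F n in sequentially. 3 \<le> n" by (rule eventually_ge_at_top)
  ultimately have "\<forall>\<^sub>F n in sequentially. real ((2 * n ^ K + 1) ^ p n) * real (2 * n * n ^ K + 1)
    * (3 * (real n)\<^sup>2 / real (n ^ K) / sqrt lam) ^ n \<le> 1 / real n"
  proof eventually_elim
    case (elim n)
    define N where "N = real n ^ K"
    have n0: "0 < real n" and n3: "3 \<le> real n" using elim by auto
    have N1: "1 \<le> N" unfolding N_def using n3 by (intro one_le_power) simp
    have pn: "real (p n) + 1 < (1 - \<gamma>) * real n" using elim(1) n0 by (simp add: pos_divide_less_eq)
    also have "\<dots> \<le> 1 * real n" using \<gamma> by (intro mult_right_mono) auto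
    finally have pn1: "p n + 1 \<le> n" by linarith
    have "real ((2 * n ^ K + 1) ^ p n) = (2 * N + 1) ^ p n" by (simp add: N_def add.commute)
    also have "\<dots> \<le> (3 * N) ^ p n" using N1 by (intro power_mono) auto
    finally have 1: "real ((2 * n ^ K + 1) ^ p n) \<le> (3 * N) ^ p n" .
    have "real (2 * n * n ^ K + 1) = 2 * (real n * N) + 1" by (simp add: N_def)
    also have "\<dots> \<le> 3 * (real n * N)"
    proof -
      have "1 * 1 \<le> real n * N" using n3 N1 by (intro mult_mono) auto
      then show ?thesis by linarith
    qed
    finally have 2: "real (2 * n * n ^ K + 1) \<le> real n * (3 * N)" by simp
    have 3: "3 * (real n)\<^sup>2 / real (n ^ K) / sqrt lam = C * (real n)\<^sup>2 / N" by (simp add: C_def N_def)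
    have "real ((2 * n ^ K + 1) ^ p n) * real (2 * n * n ^ K + 1) * (3 * (real n)\<^sup>2 / real (n ^ K) / sqrt lam) ^ n
      \<le> (3 * N) ^ p n * (real n * (3 * N)) * (C * (real n)\<^sup>2 / N) ^ n"
      unfolding 3 using C0 N1 by (intro mult_mono 1 2 order_refl mult_nonneg_nonneg zero_le_power) auto
    also have "\<dots> = real n * (3 * N) ^ (p n + 1) * (C * (real n)\<^sup>2) ^ n / N ^ n"
      by (simp add: power_divide)
    also have "\<dots> \<le> real n * (3 ^ n * N ^ (p n + 1)) * (C * (real n)\<^sup>2) ^ n / N ^ n"
    proof (intro divide_right_mono mult_right_mono mult_left_mono)
      have "(3 :: real) ^ (p n + 1) \<le> 3 ^ n" by (rule power_increasing[OF pn1]) simp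
      then show "(3 * N) ^ (p n + 1) \<le> 3 ^ n * N ^ (p n + 1)"
        unfolding power_mult_distrib using N1 by (intro mult_right_mono) auto
    qed (use N1 C0 in auto)
    also have "N ^ n = N ^ (p n + 1) * N ^ (n - (p n + 1))" using pn1 by (simp only: power_add[symmetric]) simp
    also have "real n * (3 ^ n * N ^ (p n + 1)) * (C * (real n)\<^sup>2) ^ n / (N ^ (p n + 1) * N ^ (n - (p n + 1)))
      = real n * (3 * C * (real n)\<^sup>2) ^ n / N ^ (n - (p n + 1))"
      using N1 by (simp add: power_mult_distrib)
    also have "\<dots> \<le> real n * (3 * C * (real n)\<^sup>2) ^ n / (real n ^ 4) ^ n"
    proof (intro divide_left_mono)
      have "4 * real n \<le> real K * \<gamma> * real n" using K4 by (intro mult_right_mono) auto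
      also have "\<dots> = real K * (real n - (1 - \<gamma>) * real n)" by (simp add: algebra_simps)
      also have "\<dots> \<le> real K * (real n - (real (p n) + 1))" using pn by (intro mult_left_mono) auto
      also have "\<dots> = real (K * (n - (p n + 1)))" using pn1 by (simp add: of_nat_diff)
      finally have "4 * n \<le> K * (n - (p n + 1))" by linarith
      then have "real n ^ (4 * n) \<le> real n ^ (K * (n - (p n + 1)))" using n3 by (intro power_increasing) auto
      then show "(real n ^ 4) ^ n \<le> N ^ (n - (p n + 1))" by (simp only: N_def power_mult)
    qed (use C0 N1 n0 in auto)
    also have "\<dots> = real n * (3 * C / (real n)\<^sup>2) ^ n"
      using n0 by (simp add: power_divide power_mult_distrib power_mult[symmetric] field_simps power_add[symmetric])
    also have "\<dots> \<le> real n * (1 / real n) ^ n"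
    proof (intro mult_left_mono power_mono)
      have "3 * C / (real n)\<^sup>2 \<le> real n / (real n)\<^sup>2" by (rule divide_right_mono[OF elim(2)]) simp
      then show "3 * C / (real n)\<^sup>2 \<le> 1 / real n" using n0 by (simp add: power2_eq_square)
    qed (use C0 in auto)
    also have "\<dots> \<le> real n * (1 / real n) ^ 2"
      using n3 elim(3) by (intro mult_left_mono power_decreasing) auto
    also have "\<dots> = 1 / real n" using n0 by (simp add: power2_eq_square)
    finally show ?case .
  qed
  then show ?thesis using K1 by blast
qed

text \<open>The error level \<open>t\<close> is \<open>n\<^sup>-\<^sup>d\<^sup>/\<^sup>2\<close> with \<open>d =
  \<delta> + 2 e = (1 + \<delta>) / 2\<close>, halfway between \<open>\<delta>\<close> and
  \<open>1\<close>: \<open>d < 1\<close> makes \<open>p\<^sup>2 exp (- n t\<^sup>2 / 16)\<close>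
  vanish, and \<open>d > \<delta>\<close> makes \<open>t\<^sup>2 ln n\<close> negligible against the
  penalty \<open>n\<^sup>-\<^sup>\<delta>\<close>.\<close>

theorem proposition2:
  fixes p :: "nat \<Rightarrow> nat"
    and M :: "nat \<Rightarrow> 'a measure"
    and X :: "nat \<Rightarrow> nat \<Rightarrow> 'a \<Rightarrow> real vec"
    and \<mu> :: "nat \<Rightarrow> real vec"
    and \<Sigma> :: "nat \<Rightarrow> real mat"
    and y lam_inf lam_sup a \<delta> :: real
    and m :: nat
  assumes p_lim: "filterlim p at_top sequentially"
    and prob: "\<And>n. n \<ge> 1 \<Longrightarrow> prob_space (M n)"
    and mu: "\<And>n. n \<ge> 1 \<Longrightarrow> \<mu> n \<in> carrier_vec (p n)"
    and Sigma_dim: "\<And>n. n \<ge> 1 \<Longrightarrow> \<Sigma> n \<in> carrier_mat (p n) (p n)"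
    and Sigma_pd: "\<And>n. n \<ge> 1 \<Longrightarrow> sym_pos_def (\<Sigma> n)"
    and indep: "\<And>n. n \<ge> 1 \<Longrightarrow>
      prob_space.indep_vars (M n) (\<lambda>_. vec_lborel (p n)) (X n) {1..n}"
    and normal: "\<And>n l. n \<ge> 1 \<Longrightarrow> l \<in> {1..n} \<Longrightarrow>
      distributed (M n) (vec_lborel (p n)) (X n l) (\<lambda>x. ennreal (mvn_density (\<mu> n) (\<Sigma> n) x))"
    and ratio: "(\<lambda>n. real (p n) / real n) \<longlonglongrightarrow> y" "0 < y" "y < 1"
    and spectrum: "lam_inf > 0"
      "\<And>n k. n \<ge> 1 \<Longrightarrow> eigenvalue (\<Sigma> n) k \<Longrightarrow> lam_inf \<le> k \<and> k \<le> lam_sup"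
    and block_size: "m \<ge> 1"
      "\<And>n A. n \<ge> 1 \<Longrightarrow> A \<in> block_decomp (\<Sigma> n) \<Longrightarrow> card A \<le> m"
    and separation: "a > 0"
      "\<And>n B. n \<ge> 1 \<Longrightarrow> finer_than (p n) B (block_decomp (\<Sigma> n)) \<Longrightarrow>
        max_norm (restrict_blocks (\<Sigma> n) B - \<Sigma> n) \<ge> a * real n powr (- 1 / 4)"
    and delta: "1 / 2 < \<delta>" "\<delta> < 1"
  shows "(\<lambda>n. measure (M n) {\<omega> \<in> space (M n).
            B_tot (1 / (real (p n) * real n powr \<delta>)) (emp_cov (p n) n (\<lambda>l. X n l \<omega>))
              = {block_decomp (\<Sigma> n)}}) \<longlonglongrightarrow> 1"
proof -
  (* The maximum makes lam_inf <= Lam evident; lam_sup alone is an upper bound of the spectrum. *)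
  define Lam where "Lam = max lam_sup lam_inf"
  have Lam: "0 < Lam" "lam_inf \<le> Lam" "lam_sup \<le> Lam" using spectrum(1) by (auto simp: Lam_def)
  obtain K where K: "1 \<le> K" and grid_small: "\<forall>\<^sub>F n in sequentially. real ((2 * n ^ K + 1) ^ p n) * real (2 * n * n ^ K + 1)
    * (3 * (real n)\<^sup>2 / real (n ^ K) / sqrt lam_inf) ^ n \<le> 1 / real n"
    using grid_bound_tendsto[OF ratio(1,3) spectrum(1)] by blast
  define e where "e = (1 - \<delta>) / 4"
  have e: "0 < e" using delta by (simp add: e_def)
  define t where "t n = real n powr (- (\<delta> + 2 * e) / 2)" for n
  define b where "b n = a / 2 * real n powr (- 1 / 4)" for n
  define \<beta> where "\<beta> n = real n powr (- \<delta>)" for n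
  have t2: "(t n)\<^sup>2 = real n powr (- \<delta>) * real n powr (- 2 * e)" if "1 \<le> n" for n
    using that by (simp add: t_def power2_eq_square powr_add[symmetric])
  have powr0: "(\<lambda>n. c * real n powr (- f)) \<longlonglongrightarrow> 0" if "0 < f" for c f
    using tendsto_mult_right_zero[OF tendsto_neg_powr[OF _ filterlim_real_sequentially, of "- f"], of c] that by simp
  have t0: "(\<lambda>n. c * t n) \<longlonglongrightarrow> 0" for c
    using powr0[of "(\<delta> + 2 * e) / 2" c] delta e unfolding t_def minus_divide_left[symmetric] by simp
  have ev1: "\<forall>\<^sub>F n in sequentially. 2 \<le> n" by (rule eventually_ge_at_top)
  have ev2: "\<forall>\<^sub>F n in sequentially. 1 \<le> p n" using p_lim by (simp add: filterlim_at_top)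
  have ev3: "\<forall>\<^sub>F n in sequentially. real (p n) / real n < 1" by (rule order_tendstoD(2)[OF ratio(1,3)])
  have ev4: "\<forall>\<^sub>F n in sequentially. max (Lam + 4) (1 / (2 * Lam)) \<le> real n"
    using filterlim_real_sequentially by (simp only: filterlim_at_top)
  have ev5: "\<forall>\<^sub>F n in sequentially. 1 * t n < 2" by (rule order_tendstoD(2)[OF t0]) simp
  have ev6: "\<forall>\<^sub>F n in sequentially. Lam * t n < 1" by (rule order_tendstoD(2)[OF t0]) simp
  have ev7: "\<forall>\<^sub>F n in sequentially. real m * (4 * Lam) * t n < lam_inf / 2"
    by (rule order_tendstoD(2)[OF t0]) (use spectrum(1) in simp)
  have ev8: "\<forall>\<^sub>F n in sequentially. 4 * Lam * real n powr (- ((\<delta> + 2 * e) / 2 - 1 / 4)) < a / 2"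
    by (rule order_tendstoD(2)[OF powr0]) (use separation(1) delta e in \<open>simp_all add: field_simps\<close>)
  have ev9: "\<forall>\<^sub>F n in sequentially. (real m)\<^sup>2 * real n powr (- (\<delta> - 1 / 2)) < (a / 2)\<^sup>2 / (10 * (2 * Lam)\<^sup>2)"
    by (rule order_tendstoD(2)[OF powr0]) (use separation(1) delta Lam in simp_all)
  define c1 where "c1 = (real m * (4 * Lam) / (lam_inf / 2))\<^sup>2"
  have "(\<lambda>n. (2 + 4 * (ln (2 * Lam) + 2 * real K * ln (real n))) * c1 * real n powr (- 2 * e)) \<longlonglongrightarrow> 0"
    using e by real_asymp
  then have ev10: "\<forall>\<^sub>F n in sequentially. (2 + 4 * (ln (2 * Lam) + 2 * real K * ln (real n))) * c1 * real n powr (- 2 * e) < 1"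
    by (rule order_tendstoD(2)) simp
  define P where "P n = measure (M n) {\<omega> \<in> space (M n).
            B_tot (1 / (real (p n) * real n powr \<delta>)) (emp_cov (p n) n (\<lambda>l. X n l \<omega>))
              = {block_decomp (\<Sigma> n)}}" for n
  define R where "R n = 4 * (real n)\<^sup>2 * exp (- (real n powr (2 * e)) / 16) + 1 / real n" for n
  have R0: "R \<longlonglongrightarrow> 0" unfolding R_def using e by real_asymp
  have "\<forall>\<^sub>F n in sequentially. 1 - P n \<le> R n \<and> P n \<le> 1"
    using ev1 ev2 ev3 ev4 ev5 ev6 ev7 ev8 ev9 ev10 grid_small
  proof eventually_elim
    case (elim n)
    have n1: "n \<ge> 1" and nr: "0 < real n" using elim(1) by auto
    have pp: "0 < p n" using elim(2) by simp
    interpret Pn: prob_space "M n" by (rule prob[OF n1])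
    note Sc = Sigma_dim[OF n1]
    have spec: "\<And>k. eigenvalue (\<Sigma> n) k \<Longrightarrow> lam_inf \<le> k \<and> k \<le> Lam" using spectrum(2)[OF n1] Lam(3) by force
    note co = spectrum_coercive[OF Sc Sigma_pd[OF n1] pp spec spectrum(1)]
    interpret gaussian_sample "M n" n "p n" "X n" "\<mu> n" "\<Sigma> n" lam_inf Lam
      by unfold_locales (use nr pp mu[OF n1] co indep[OF n1] normal[OF n1] in auto)
    have pn: "p n \<le> n" using elim(3) nr by (simp add: divide_less_eq)
    have tn0: "0 \<le> t n" by (simp add: t_def)
    have bn: "0 < b n" using separation(1) nr by (simp add: b_def)
    have sep: "\<exists>i<p n. \<exists>j<p n. \<not> same_block B i j \<and> same_block (block_decomp (\<Sigma> n)) i j \<and> 2 * b n \<le> \<bar>\<Sigma> n $$ (i, j)\<bar>"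
      if B: "finer_than (p n) B (block_decomp (\<Sigma> n))" for B
    proof -
      obtain i j where ij: "i < p n" "j < p n" "\<not> same_block B i j" "2 * b n \<le> \<bar>\<Sigma> n $$ (i, j)\<bar>"
        using max_norm_restrict_blocks_ge[OF Sc pp, of "2 * b n" B] separation(2)[OF n1 B] bn by (auto simp: b_def)
      then have "same_block (block_decomp (\<Sigma> n)) i j"
        using zero_outside_block_decomp[OF Sc ij(1,2)] bn by (cases "same_block (block_decomp (\<Sigma> n)) i j") auto
      then show ?thesis using ij by blast
    qed
    have N0: "0 < n ^ K" using nr by simp
    have nN: "real n \<le> (real (n ^ K))\<^sup>2"
    proof -
      have "real n ^ 1 \<le> real n ^ (K * 2)" using K n1 by (intro power_increasing) auto
      then show ?thesis by (simp add: power_mult)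
    qed
    have N2: "1 / (real (n ^ K))\<^sup>2 \<le> 2 * Lam"
    proof -
      have "1 / (2 * Lam) \<le> (real (n ^ K))\<^sup>2" using elim(4) nN by simp
      then show ?thesis using Lam(1) N0 by (simp add: field_simps)
    qed
    have tb: "4 * Lam * t n \<le> b n"
    proof -
      have "4 * Lam * t n = 4 * Lam * real n powr (- ((\<delta> + 2 * e) / 2 - 1 / 4)) * real n powr (- 1 / 4)"
      proof -
        have "- (\<delta> + 2 * e) / 2 = - ((\<delta> + 2 * e) / 2 - 1 / 4) + - 1 / 4" by (simp add: field_simps)
        then show ?thesis unfolding t_def by (simp only: powr_add mult.assoc)
      qed
      also have "\<dots> \<le> a / 2 * real n powr (- 1 / 4)" using elim(8) by (intro mult_right_mono) auto
      finally show ?thesis by (simp add: b_def)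
    qed
    have lnN: "ln (2 * Lam * (real (n ^ K))\<^sup>2) = ln (2 * Lam) + 2 * real K * ln (real n)"
    proof -
      have "ln (2 * Lam * (real n ^ (K * 2))) = ln (2 * Lam) + ln (real n ^ (K * 2))"
        using Lam(1) nr by (simp add: ln_mult)
      also have "ln (real n ^ (K * 2)) = real (K * 2) * ln (real n)" using nr by (simp add: ln_realpow)
      finally show ?thesis by (simp add: power_mult)
    qed
    have split: "(2 + 4 * ln (2 * Lam * (real (n ^ K))\<^sup>2)) * (real m * (4 * Lam * t n) / (lam_inf / 2))\<^sup>2 < \<beta> n"
    proof -
      have "(real m * (4 * Lam * t n) / (lam_inf / 2))\<^sup>2 = c1 * (t n)\<^sup>2"
        unfolding c1_def power_mult_distrib[symmetric] by (simp add: mult_ac)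
      also have "\<dots> = c1 * real n powr (- 2 * e) * \<beta> n" unfolding t2[OF n1] \<beta>_def by simp
      finally have "(2 + 4 * ln (2 * Lam * (real (n ^ K))\<^sup>2)) * (real m * (4 * Lam * t n) / (lam_inf / 2))\<^sup>2
        = ((2 + 4 * (ln (2 * Lam) + 2 * real K * ln (real n))) * c1 * real n powr (- 2 * e)) * \<beta> n"
        unfolding lnN by simp
      also have "\<dots> < 1 * \<beta> n" by (rule mult_strict_right_mono[OF elim(10)]) (use nr in \<open>simp add: \<beta>_def\<close>)
      finally show ?thesis by simp
    qed
    have merge: "\<beta> n * (real m)\<^sup>2 < (b n)\<^sup>2 / (10 * (2 * Lam)\<^sup>2)"
    proof -
      have "\<beta> n * (real m)\<^sup>2 = (real m)\<^sup>2 * real n powr (- (\<delta> - 1 / 2)) * real n powr (- 1 / 2)"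
        unfolding \<beta>_def mult.assoc powr_add[symmetric] by simp
      also have "\<dots> < (a / 2)\<^sup>2 / (10 * (2 * Lam)\<^sup>2) * real n powr (- 1 / 2)"
        by (rule mult_strict_right_mono[OF elim(9)]) (use nr in simp)
      also have "real n powr (- 1 / 2) = (real n powr (- 1 / 4))\<^sup>2"
        using nr by (simp add: power2_eq_square powr_add[symmetric])
      finally have "\<beta> n * (real m)\<^sup>2 < (a / 2)\<^sup>2 / (10 * (2 * Lam)\<^sup>2) * (real n powr (- 1 / 4))\<^sup>2" .
      moreover have "(b n)\<^sup>2 = (a / 2)\<^sup>2 * (real n powr (- 1 / 4))\<^sup>2" by (simp only: b_def power_mult_distrib)
      ultimately show ?thesis by simp
    qed
    have "1 - Pn.prob {\<omega> \<in> space (M n). B_tot (\<beta> n / real (p n)) (S \<omega>) = {block_decomp (\<Sigma> n)}}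
      \<le> 4 * (real (p n))\<^sup>2 * exp (- real n * (t n)\<^sup>2 / 16)
      + real ((2 * n ^ K + 1) ^ p n) * real (2 * n * n ^ K + 1) * (3 * (real n)\<^sup>2 / real (n ^ K) / sqrt lam_inf) ^ n"
    proof (rule prob_selection[where m = m and b = "b n"])
      show "partition_on {..<p n} (block_decomp (\<Sigma> n))" by (rule block_decomp_props(1)[OF Sc])
      show "real m * (4 * Lam * t n) \<le> lam_inf / 2" using elim(7) by (simp add: mult_ac)
    qed (use block_size block_size(2)[OF n1] zero_outside_block_decomp[OF Sc] sep elim pn tn0 Lam N0 N2 bn tb split merge in auto)
    moreover have "\<beta> n / real (p n) = 1 / (real (p n) * real n powr \<delta>)"
      by (simp add: \<beta>_def powr_minus_divide)
    ultimately have "1 - P n \<le> 4 * (real (p n))\<^sup>2 * exp (- real n * (t n)\<^sup>2 / 16) + 1 / real n"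
      using elim(11) by (simp add: P_def S_def)
    also have "4 * (real (p n))\<^sup>2 * exp (- real n * (t n)\<^sup>2 / 16) \<le> 4 * (real n)\<^sup>2 * exp (- real n * (t n)\<^sup>2 / 16)"
      using pn by (intro mult_right_mono mult_left_mono power_mono) auto
    also have "- real n * (t n)\<^sup>2 = - (real n powr (2 * e))"
    proof -
      have "real n * (t n)\<^sup>2 = real n powr 1 * (real n powr (- \<delta>) * real n powr (- 2 * e))" using nr by (simp add: t2[OF n1])
      also have "\<dots> = real n powr (1 + (- \<delta> + - 2 * e))" by (simp only: powr_add)
      also have "1 + (- \<delta> + - 2 * e) = 2 * e" by (simp add: e_def field_simps)
      finally show ?thesis by simp
    qed
    finally show ?case by (simp add: R_def P_def)
  qed
  then have ev: "\<forall>\<^sub>F n in sequentially. 1 - R n \<le> P n" "\<forall>\<^sub>F n in sequentially. P n \<le> 1"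
    by (auto elim: eventually_mono)
  have "P \<longlonglongrightarrow> 1"
  proof (rule tendsto_sandwich[OF ev])
    show "(\<lambda>n. 1 - R n) \<longlonglongrightarrow> 1" using tendsto_diff[OF tendsto_const[of 1] R0] by simp
  qed simp
  then show ?thesis by (simp add: P_def[abs_def])
qed

end
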